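(* Let $\mathbb{D}$ be a non-dictatorial, unidimensional domain. Then the following two statements hold. (i) There exists an invariant, tops-only and strategy-proof rule on $\mathbb{D}$, (a) if and only if $\mathbb{D}$ is a semi-single-peaked domain, and (b) if and only if $\mathbb{D}$ admits a two-voter, strategy-proof projection rule. Furthermore, every invariant, tops-only and strategy-proof rule on $\mathbb{D}$ is a projection rule. (ii) There exists no invariant, tops-only and strategy-proof rule on $\mathbb{D}$ if and only if $\mathbb{D}$ is a semi-hybrid domain satisfying the unique seconds property. Furthermore, in this case, every two-voter, tops-only and strategy-proof rule on $\mathbb{D}$ is a hybrid rule that behaves like a dictatorship on a weak superset of the free zone (that is, whenever $\mathbb{D}$ is an $(a,b)$-semi-hybrid domain on a tree $\mathcal{T}^A$, on some set $B\supseteq\langle a,b|\mathcal{T}^A\rangle$).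
   Context: **Model.** $A$ is a finite set of alternatives, $|A|=m\ge 3$. A preference is a linear order $P_i$ on $A$; $r_k(P_i)$ is its $k$-th ranked alternative, $r_1(P_i)$ its peak, $\max^{P_i}(B)$ the $P_i$-best element of $B\subseteq A$. A domain $\mathbb{D}$ is a set of preferences; $\mathbb{D}^a=\{P_i\in\mathbb{D}:r_1(P_i)=a\}$. Voters: $N=\{1,\dots,n\}$, $n\ge2$. An SCF is a map $f:\mathbb{D}^n\to A$; it is a rule if unanimous ($f(P)=a$ whenever all peaks at $P$ equal $a$); strategy-proof if for all $i$, $P_i,P_i'\in\mathbb{D}$, $P_{-i}\in\mathbb{D}^{n-1}$, either $f(P_i,P_{-i})=f(P_i',P_{-i})$ or $f(P_i,P_{-i})\mathrel{P_i}f(P_i',P_{-i})$; tops-only if $f(P)=f(P')$ whenever $r_1(P_i)=r_1(P_i')$ for all $i$; a dictatorship if for some $i$, $f(P)=r_1(P_i)$ for all $P$. $f$ behaves like a dictatorship on a nonempty $B\subseteq A$ if for some $i$, $f(P)=r_1(P_i)$ for all $P\in\mathbb{D}^n$ with all peaks in $B$. $\mathbb{D}$ is non-dictatorial if for some $n\ge2$ it admits a strategy-proof rule that is not a dictatorship. **Unidimensional domains.** $a\ne b$ are adjacent ($a\sim b$) if there are $P_i,P_i'\in\mathbb{D}$ with $r_1(P_i)=r_2(P_i')=a$, $r_1(P_i')=r_2(P_i)=b$, $r_k(P_i)=r_k(P_i')$ for $k\ge3$. The adjacency graph $G_\sim^A$ has vertex set $A$ and edges the adjacent pairs; for $B\subseteq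 A$, $G_\sim^B$ is the induced subgraph on $B$. $\mathrm{Leaf}(G)$ is the set of vertices with exactly one neighbor in a graph $G$; $\mathcal{N}_\sim^A(x)$ is the set of neighbors of $x$ in $G^A_\sim$. Path-connectedness: $G_\sim^A$ is connected. Diversity: $\mathbb{D}$ contains two completely reversed preferences ($a\mathrel{P_i}b\Leftrightarrow b\mathrel{P_i'}a$ for all $a\neq b$); for a domain satisfying diversity, fix such a pair $\underline{P},\overline{P}\in\mathbb{D}$. With $\mathcal{S}(\mathbb{D}^a)=\{r_2(P_i):P_i\in\mathbb{D}^a\}$, leaf symmetry: for each $x\in\mathrm{Leaf}(G_\sim^A)$ with $|\mathcal{S}(\mathbb{D}^x)|>1$ there is $z\in\mathcal{S}(\mathbb{D}^x)$ with $z\notin\mathcal{N}_\sim^A(x)$ and $x\in\mathcal{S}(\mathbb{D}^z)$. A domain is unidimensional if it satisfies path-connectedness, diversity and leaf symmetry. Unique seconds property: $|\mathcal{S}(\mathbb{D}^x)|=1$ for some $x\in A$. **Invariance.** A two-voter SCF $f:\mathbb{D}^2\to A$ is invariant if $f(\underline{P},\overline{P})=f(\overline{P},\underline{P})$ (first coordinate: voter 1, second: voter 2). An "invariant rule" is thus a two-voter rule. **Trees.** $\mathcal{T}^A$ denotes a tree with vertex set $A$; $\langle x,y|\mathcal{T}^A\rangle$ is the unique path between $x$ and $y$ (also its vertex set). For a subtree with vertex set $B$, $\mathrm{Proj}(a,\mathcal{T}^B)$ is $a$ if $a\in B$, and otherwise the unique $a'\in B$ lying on $\langle a,b|\mathcal{T}^A\rangle$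 for all $b\in B$. For a profile $P$, $\mathcal{T}^{\Gamma(P)}$ is the minimal subtree containing all voters' peaks. For $x\ne y$, $A^{x\rightharpoonup y}=\{z\in A: x\in\langle z,y|\mathcal{T}^A\rangle\}$. Distinct $a,b$ are dual-thresholds in $\mathcal{T}^A$ if $\mathrm{Proj}(c,\langle a,b|\mathcal{T}^A\rangle)\in\{a,b\}$ for all $c\in A\setminus\langle a,b|\mathcal{T}^A\rangle$. **Semi-single-peakedness.** $P_i$ is semi-single-peaked on $\mathcal{T}^A$ w.r.t. a threshold $\bar{x}\in A$ if (1) for distinct $a,b\in\langle r_1(P_i),\bar{x}|\mathcal{T}^A\rangle$, $a\in\langle r_1(P_i),b|\mathcal{T}^A\rangle$ implies $a\mathrel{P_i}b$; and (2) for $a\notin\langle r_1(P_i),\bar{x}|\mathcal{T}^A\rangle$ with projection $a'$ on that path, $a'\mathrel{P_i}a$. $\mathbb{D}_{\mathrm{SSP}}(\mathcal{T}^A,\bar{x})$ is the set of all such preferences. $\mathbb{D}$ is a semi-single-peaked domain if $\mathbb{D}\subseteq\mathbb{D}_{\mathrm{SSP}}(\mathcal{T}^A,\bar{x})$ for some tree $\mathcal{T}^A$ and $\bar x\in A$, and $G_\sim^A$ is connected. **Semi-hybridness.** Given dual-thresholds $a,b$ in $\mathcal{T}^A$, $P_i$ is $(a,b)$-semi-hybrid on $\mathcal{T}^A$ if: (1) if $r_1(P_i)\in A^{a\rightharpoonup b}\setminus\{a\}$, then $P_i$ is semi-single-peaked on $\mathcal{T}^A$ w.r.t. $a$ and $\max^{P_i}(A^{b\rightharpoonup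 a})=b$; (2) if $r_1(P_i)\in A^{b\rightharpoonup a}\setminus\{b\}$, then $P_i$ is semi-single-peaked on $\mathcal{T}^A$ w.r.t. $b$ and $\max^{P_i}(A^{a\rightharpoonup b})=a$; (3) if $r_1(P_i)\in\langle a,b|\mathcal{T}^A\rangle$, then $\max^{P_i}(A^{a\rightharpoonup b})=a$ and $\max^{P_i}(A^{b\rightharpoonup a})=b$. $\mathbb{D}_{\mathrm{SH}}(\mathcal{T}^A,a,b)$ is the set of all such preferences. $\mathbb{D}$ is an $(a,b)$-semi-hybrid domain on $\mathcal{T}^A$ ($a,b$ dual-thresholds in $\mathcal{T}^A$) if: (i) $\mathbb{D}\subseteq\mathbb{D}_{\mathrm{SH}}(\mathcal{T}^A,a,b)$ and $G_\sim^A$ is connected; (ii) there are no tree $\widehat{\mathcal{T}}^A$ and dual-thresholds $\hat a,\hat b$ in it with $\mathbb{D}\subseteq\mathbb{D}_{\mathrm{SH}}(\widehat{\mathcal{T}}^A,\hat a,\hat b)$ and $\langle\hat a,\hat b|\widehat{\mathcal{T}}^A\rangle\subsetneq\langle a,b|\mathcal{T}^A\rangle$ as vertex sets; (iii) if $G_\sim^A$ is a tree, then for each $x\in\mathrm{Leaf}(G_\sim^{\langle a,b|\mathcal{T}^A\rangle})$ some $P_i\in\mathbb{D}$ is not semi-single-peaked on $G_\sim^A$ w.r.t. $x$. The set $\langle a,b|\mathcal{T}^A\rangle$ is then called the free zone. $\mathbb{D}$ is a semi-hybrid domain if it is so for some $\mathcal{T}^A,a,b$. **Rules.** $f:\mathbb{D}^n\to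 A$ is a projection rule if there are a tree $\mathcal{T}^A$ and $\bar x\in A$ with $f(P)=\mathrm{Proj}(\bar x,\mathcal{T}^{\Gamma(P)})$ for all $P$. $f$ is a hybrid rule if there are a tree $\mathcal{T}^A$, dual-thresholds $a,b$ with $|\langle a,b|\mathcal{T}^A\rangle|\ge3$, and a voter $i$ such that for all $P$: $f(P)=r_1(P_i)$ if $r_1(P_i)\in\langle a,b|\mathcal{T}^A\rangle$; $f(P)=\mathrm{Proj}(a,\mathcal{T}^{\Gamma(P)})$ if $r_1(P_i)\in A^{a\rightharpoonup b}\setminus\{a\}$; $f(P)=\mathrm{Proj}(b,\mathcal{T}^{\Gamma(P)})$ if $r_1(P_i)\in A^{b\rightharpoonup a}\setminus\{b\}$. *)

theory Defs
  imports "HOL.Hull" "HOL-Library.FuncSet" "HOL-Library.Cardinality"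
begin

section \<open>Graphs and trees\<close>

text \<open>A simple graph is a vertex set together with a symmetric, irreflexive edge relation.
  (The trees of the Graph-Theory entry of the AFP are directed: there an undirected edge,
  i.e. a pair of opposite arcs, is already a cycle.)\<close>

definition simple_graph :: "'a set \<Rightarrow> 'a rel \<Rightarrow> bool" where
  "simple_graph V E \<longleftrightarrow> E \<subseteq> V \<times> V \<and> sym E \<and> irrefl E"

definition is_path :: "'a rel \<Rightarrow> 'a \<Rightarrow> 'a list \<Rightarrow> 'a \<Rightarrow> bool" where
  "is_path E x p y \<longleftrightarrow>
     p \<noteq> [] \<and> hd p = x \<and> last p = y \<and> distinct p \<and> successively (\<lambda>u v. (u, v) \<in> E) p"

definition connected_graph :: "'a set \<Rightarrow> 'a rel \<Rightarrow> bool" where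
  "connected_graph V E \<longleftrightarrow> (\<forall>x\<in>V. \<forall>y\<in>V. \<exists>p. set p \<subseteq> V \<and> is_path E x p y)"

definition has_cycle :: "'a rel \<Rightarrow> bool" where
  "has_cycle E \<longleftrightarrow> (\<exists>x p y. length p \<ge> 3 \<and> is_path E x p y \<and> (y, x) \<in> E)"

definition tree :: "'a set \<Rightarrow> 'a rel \<Rightarrow> bool" where
  "tree V E \<longleftrightarrow> V \<noteq> {} \<and> simple_graph V E \<and> connected_graph V E \<and> \<not> has_cycle E"

definition neighbors :: "'a rel \<Rightarrow> 'a \<Rightarrow> 'a set" where
  "neighbors E x = {y. (x, y) \<in> E}"

definition leaves :: "'a set \<Rightarrow> 'a rel \<Rightarrow> 'a set" where
  "leaves V E = {x \<in> V. card (neighbors E x) = 1}"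

text \<open>All trees below have vertex set \<open>UNIV\<close>. The path between two vertices of a tree is
  unique, so the following set is the vertex set of that path.\<close>

definition path_set :: "'a rel \<Rightarrow> 'a \<Rightarrow> 'a \<Rightarrow> 'a set" where
  "path_set T x y = {z. \<exists>p. is_path T x p y \<and> z \<in> set p}"

definition subtree :: "'a rel \<Rightarrow> 'a set \<Rightarrow> bool" where
  "subtree T B \<longleftrightarrow> tree B (Restr T B)"

definition proj :: "'a rel \<Rightarrow> 'a set \<Rightarrow> 'a \<Rightarrow> 'a" where
  "proj T B a = (if a \<in> B then a else (THE a'. a' \<in> B \<and> (\<forall>b\<in>B. a' \<in> path_set T a b)))"

text \<open>\<open>beyond T x y\<close> is the set $A^{x\rightharpoonup y}$.\<close>

definition beyond :: "'a rel \<Rightarrow> 'a \<Rightarrow> 'a \<Rightarrow> 'a set" where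
  "beyond T x y = {z. x \<in> path_set T z y}"

definition dual_thresholds :: "'a rel \<Rightarrow> 'a \<Rightarrow> 'a \<Rightarrow> bool" where
  "dual_thresholds T a b \<longleftrightarrow>
     a \<noteq> b \<and> (\<forall>c. c \<notin> path_set T a b \<longrightarrow> proj T (path_set T a b) c \<in> {a, b})"


section \<open>Preferences\<close>

text \<open>\<open>(x, y) \<in> R\<close> means that \<open>x\<close> is strictly better than \<open>y\<close>.\<close>

type_synonym 'a pref = "'a rel"

abbreviation preference :: "'a pref \<Rightarrow> bool" where
  "preference R \<equiv> strict_linear_order_on UNIV R"

definition ranked :: "nat \<Rightarrow> 'a pref \<Rightarrow> 'a" where
  "ranked k R = (THE x. card {y. (y, x) \<in> R} + 1 = k)"

abbreviation peak :: "'a pref \<Rightarrow> 'a" where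
  "peak R \<equiv> ranked 1 R"

definition best :: "'a pref \<Rightarrow> 'a set \<Rightarrow> 'a" where
  "best R B = (THE x. x \<in> B \<and> (\<forall>y\<in>B. y \<noteq> x \<longrightarrow> (x, y) \<in> R))"

definition completely_reversed :: "'a pref \<Rightarrow> 'a pref \<Rightarrow> bool" where
  "completely_reversed R R' \<longleftrightarrow> (\<forall>a b. a \<noteq> b \<longrightarrow> ((a, b) \<in> R \<longleftrightarrow> (b, a) \<in> R'))"


section \<open>Domains\<close>

definition is_domain :: "'a pref set \<Rightarrow> bool" where
  "is_domain D \<longleftrightarrow> (\<forall>R\<in>D. preference R)"

definition seconds :: "'a pref set \<Rightarrow> 'a \<Rightarrow> 'a set" where
  "seconds D a = {ranked 2 R |R. R \<in> D \<and> peak R = a}"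

definition adjacent :: "'a pref set \<Rightarrow> 'a \<Rightarrow> 'a \<Rightarrow> bool" where
  "adjacent D a b \<longleftrightarrow> a \<noteq> b \<and>
     (\<exists>R\<in>D. \<exists>R'\<in>D. ranked 1 R = a \<and> ranked 2 R' = a \<and> ranked 1 R' = b \<and> ranked 2 R = b \<and>
        (\<forall>k\<in>{3..CARD('a)}. ranked k R = ranked k R'))"

definition adj_graph :: "'a pref set \<Rightarrow> 'a rel" where
  "adj_graph D = {(a, b). adjacent D a b}"

definition path_connected_dom :: "'a pref set \<Rightarrow> bool" where
  "path_connected_dom D \<longleftrightarrow> connected_graph UNIV (adj_graph D)"

definition diversity :: "'a pref set \<Rightarrow> bool" where
  "diversity D \<longleftrightarrow> (\<exists>R\<in>D. \<exists>R'\<in>D. completely_reversed R R')"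

definition leaf_symmetry :: "'a pref set \<Rightarrow> bool" where
  "leaf_symmetry D \<longleftrightarrow>
     (\<forall>x\<in>leaves UNIV (adj_graph D). card (seconds D x) > 1 \<longrightarrow>
        (\<exists>z\<in>seconds D x. z \<notin> neighbors (adj_graph D) x \<and> x \<in> seconds D z))"

definition unidimensional :: "'a pref set \<Rightarrow> bool" where
  "unidimensional D \<longleftrightarrow> path_connected_dom D \<and> diversity D \<and> leaf_symmetry D"

definition unique_seconds :: "'a pref set \<Rightarrow> bool" where
  "unique_seconds D \<longleftrightarrow> (\<exists>x. card (seconds D x) = 1)"

definition semi_single_peaked :: "'a rel \<Rightarrow> 'a \<Rightarrow> 'a pref \<Rightarrow> bool" where
  "semi_single_peaked T x R \<longleftrightarrow>
     (\<forall>a\<in>path_set T (peak R) x. \<forall>b\<in>path_set T (peak R) x.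
        a \<noteq> b \<longrightarrow> a \<in> path_set T (peak R) b \<longrightarrow> (a, b) \<in> R) \<and>
     (\<forall>a. a \<notin> path_set T (peak R) x \<longrightarrow> (proj T (path_set T (peak R) x) a, a) \<in> R)"

definition ssp_prefs :: "'a rel \<Rightarrow> 'a \<Rightarrow> 'a pref set" where
  "ssp_prefs T x = {R. preference R \<and> semi_single_peaked T x R}"

definition ssp_domain :: "'a pref set \<Rightarrow> bool" where
  "ssp_domain D \<longleftrightarrow> (\<exists>T x. tree UNIV T \<and> D \<subseteq> ssp_prefs T x) \<and> connected_graph UNIV (adj_graph D)"

definition semi_hybrid :: "'a rel \<Rightarrow> 'a \<Rightarrow> 'a \<Rightarrow> 'a pref \<Rightarrow> bool" where
  "semi_hybrid T a b R \<longleftrightarrow>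
     (peak R \<in> beyond T a b - {a} \<longrightarrow>
        semi_single_peaked T a R \<and> best R (beyond T b a) = b) \<and>
     (peak R \<in> beyond T b a - {b} \<longrightarrow>
        semi_single_peaked T b R \<and> best R (beyond T a b) = a) \<and>
     (peak R \<in> path_set T a b \<longrightarrow>
        best R (beyond T a b) = a \<and> best R (beyond T b a) = b)"

definition sh_prefs :: "'a rel \<Rightarrow> 'a \<Rightarrow> 'a \<Rightarrow> 'a pref set" where
  "sh_prefs T a b = {R. preference R \<and> semi_hybrid T a b R}"

text \<open>\<open>sh_domain_on D T a b\<close>: \<open>D\<close> is an $(a,b)$-semi-hybrid domain on the tree \<open>T\<close>; its free
  zone is \<open>path_set T a b\<close>.\<close>

definition sh_domain_on :: "'a pref set \<Rightarrow> 'a rel \<Rightarrow> 'a \<Rightarrow> 'a \<Rightarrow> bool" where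
  "sh_domain_on D T a b \<longleftrightarrow>
     tree UNIV T \<and> dual_thresholds T a b \<and>
     D \<subseteq> sh_prefs T a b \<and> connected_graph UNIV (adj_graph D) \<and>
     \<not> (\<exists>T' a' b'. tree UNIV T' \<and> dual_thresholds T' a' b' \<and> D \<subseteq> sh_prefs T' a' b' \<and>
          path_set T' a' b' \<subset> path_set T a b) \<and>
     (tree UNIV (adj_graph D) \<longrightarrow>
        (\<forall>x\<in>leaves (path_set T a b) (Restr (adj_graph D) (path_set T a b)).
           \<exists>R\<in>D. \<not> semi_single_peaked (adj_graph D) x R))"

definition sh_domain :: "'a pref set \<Rightarrow> bool" where
  "sh_domain D \<longleftrightarrow> (\<exists>T a b. sh_domain_on D T a b)"


section \<open>Social choice functions\<close>

text \<open>A profile is an extensional function on the voters \<open>{1..n}\<close>. Only the values of a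
  social choice function on \<open>profiles n D\<close> are ever inspected, so \<open>f\<close> stands for its
  restriction to that set.\<close>

type_synonym 'a profile = "nat \<Rightarrow> 'a pref"
type_synonym 'a scf = "'a profile \<Rightarrow> 'a"

abbreviation voters :: "nat \<Rightarrow> nat set" where
  "voters n \<equiv> {1..n}"

abbreviation profiles :: "nat \<Rightarrow> 'a pref set \<Rightarrow> 'a profile set" where
  "profiles n D \<equiv> voters n \<rightarrow>\<^sub>E D"

definition profile2 :: "'a pref \<Rightarrow> 'a pref \<Rightarrow> 'a profile" where
  "profile2 R R' = (\<lambda>i\<in>voters 2. if i = 1 then R else R')"

definition rule_on :: "nat \<Rightarrow> 'a pref set \<Rightarrow> 'a scf \<Rightarrow> bool" where
  "rule_on n D f \<longleftrightarrow> (\<forall>P\<in>profiles n D. \<forall>a. (\<forall>i\<in>voters n. peak (P i) = a) \<longrightarrow> f P = a)"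

definition strategy_proof :: "nat \<Rightarrow> 'a pref set \<Rightarrow> 'a scf \<Rightarrow> bool" where
  "strategy_proof n D f \<longleftrightarrow>
     (\<forall>P\<in>profiles n D. \<forall>i\<in>voters n. \<forall>R\<in>D. f P = f (P(i := R)) \<or> (f P, f (P(i := R))) \<in> P i)"

definition tops_only :: "nat \<Rightarrow> 'a pref set \<Rightarrow> 'a scf \<Rightarrow> bool" where
  "tops_only n D f \<longleftrightarrow>
     (\<forall>P\<in>profiles n D. \<forall>P'\<in>profiles n D.
        (\<forall>i\<in>voters n. peak (P i) = peak (P' i)) \<longrightarrow> f P = f P')"

definition dictatorship :: "nat \<Rightarrow> 'a pref set \<Rightarrow> 'a scf \<Rightarrow> bool" where
  "dictatorship n D f \<longleftrightarrow> (\<exists>i\<in>voters n. \<forall>P\<in>profiles n D. f P = peak (P i))"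

definition dictatorship_like_on :: "nat \<Rightarrow> 'a pref set \<Rightarrow> 'a scf \<Rightarrow> 'a set \<Rightarrow> bool" where
  "dictatorship_like_on n D f B \<longleftrightarrow>
     B \<noteq> {} \<and>
     (\<exists>i\<in>voters n. \<forall>P\<in>profiles n D. (\<forall>j\<in>voters n. peak (P j) \<in> B) \<longrightarrow> f P = peak (P i))"

definition non_dictatorial :: "'a pref set \<Rightarrow> bool" where
  "non_dictatorial D \<longleftrightarrow>
     (\<exists>n\<ge>2. \<exists>f. rule_on n D f \<and> strategy_proof n D f \<and> \<not> dictatorship n D f)"

text \<open>Vertex set of the minimal subtree containing all peaks; in a tree this is the
  intersection of all subtrees containing them.\<close>

definition peak_span :: "'a rel \<Rightarrow> nat \<Rightarrow> 'a profile \<Rightarrow> 'a set" where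
  "peak_span T n P = (subtree T) hull ((\<lambda>i. peak (P i)) ` voters n)"

definition projection_rule :: "nat \<Rightarrow> 'a pref set \<Rightarrow> 'a scf \<Rightarrow> bool" where
  "projection_rule n D f \<longleftrightarrow>
     (\<exists>T x. tree UNIV T \<and> (\<forall>P\<in>profiles n D. f P = proj T (peak_span T n P) x))"

definition hybrid_rule :: "nat \<Rightarrow> 'a pref set \<Rightarrow> 'a scf \<Rightarrow> bool" where
  "hybrid_rule n D f \<longleftrightarrow>
     (\<exists>T a b. tree UNIV T \<and> dual_thresholds T a b \<and> card (path_set T a b) \<ge> 3 \<and>
       (\<exists>i\<in>voters n. \<forall>P\<in>profiles n D.
          (peak (P i) \<in> path_set T a b \<longrightarrow> f P = peak (P i)) \<and>
          (peak (P i) \<in> beyond T a b - {a} \<longrightarrow> f P = proj T (peak_span T n P) a) \<and>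
          (peak (P i) \<in> beyond T b a - {b} \<longrightarrow> f P = proj T (peak_span T n P) b)))"

text \<open>Invariance refers to a fixed pair \<open>Rlo\<close>, \<open>Rhi\<close> of completely reversed preferences.\<close>

definition invariant :: "'a pref \<Rightarrow> 'a pref \<Rightarrow> 'a scf \<Rightarrow> bool" where
  "invariant Rlo Rhi f \<longleftrightarrow> f (profile2 Rlo Rhi) = f (profile2 Rhi Rlo)"

definition inv_to_sp_rule :: "'a pref set \<Rightarrow> 'a pref \<Rightarrow> 'a pref \<Rightarrow> 'a scf \<Rightarrow> bool" where
  "inv_to_sp_rule D Rlo Rhi f \<longleftrightarrow>
     rule_on 2 D f \<and> invariant Rlo Rhi f \<and> tops_only 2 D f \<and> strategy_proof 2 D f"

end

theory Submission
  imports Defs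
begin

text \<open>Write \<open>sep E x u y\<close> if every path from \<open>x\<close> to \<open>y\<close> in the graph \<open>E\<close> meets \<open>u\<close>. Strategy-proofness along
  an adjacency edge implies that the value \<open>F x y\<close> of a two-voter tops-only rule can only change when
  it is itself a peak that moves, so \<open>F x y\<close> separates \<open>x\<close> from \<open>y\<close>, and if \<open>F x y \<noteq> F x' y\<close>
  then \<open>F x y\<close> separates \<open>x\<close> from \<open>x'\<close>. Let \<open>s\<close>, \<open>t\<close> be the peaks of the two reversed
  preferences. If \<open>F s t = F t s = c\<close>, then \<open>F\<close> is the median with \<open>c\<close>, the adjacency graph is a
  tree and the domain is semi-single-peaked on it with respect to \<open>c\<close>. Otherwise \<open>F s t\<close> and \<open>F t s\<close>
  are the ends of a zone on which one voter dictates, and the two parts of the graph cut off by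
  them are semi-single-peaked. Conversely a line through a zone together with the two parts is a
  tree witnessing semi-hybridness, so that semi-hybrid domains correspond to minimal zones. Without unique seconds a two-voter strategy-proof
  rule that favours a voter on one edge favours the same voter on all edges, because the
  property propagates along walks that do not turn back, and such walks can be reversed.\<close>

section \<open>Separation in graphs\<close>

text \<open>The adjacency graph is not known to be a tree, and the tree of a semi-hybrid domain need
  not share its edges. Separation by a vertex makes sense in every connected graph and obeys a few
  betweenness axioms. Medians may fail to exist there, but they are unique, and strategy-proofness
  supplies them as values of the rule. Semi-single-peaked parts are described inside the adjacency
  graph alone, so that free zones coming from different trees can be compared as sets. The reversed
  pair enters twice: an alternative weakly better than another in both preferences equals it, so a
  value attained against both peaks is attained against everything; and every nonempty
  semi-single-peaked part contains one of the two peaks, so at most two disjoint ones exist.\<close>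

definition sep :: "'a rel \<Rightarrow> 'a \<Rightarrow> 'a \<Rightarrow> 'a \<Rightarrow> bool" where
  "sep E x u y \<longleftrightarrow> x = u \<or> y = u \<or> (x, y) \<notin> (Restr E (-{u}))\<^sup>*"

lemma sep_left [simp]: "sep E x x y" and sep_right [simp]: "sep E x y y"
  by (auto simp: sep_def)

lemma sym_Restr_rtrancl: "sym E \<Longrightarrow> (x, y) \<in> (Restr E A)\<^sup>* \<Longrightarrow> (y, x) \<in> (Restr E A)\<^sup>*"
proof -
  assume "sym E" and *: "(x, y) \<in> (Restr E A)\<^sup>*"
  then have "sym (Restr E A)" by (auto simp: sym_def)
  then show ?thesis using * by (meson sym_rtrancl symE)
qed

lemma sep_commute: "sym E \<Longrightarrow> sep E x u y \<longleftrightarrow> sep E y u x"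
  unfolding sep_def using sym_Restr_rtrancl[of E] by blast

text \<open>Otherwise the two walks that avoid \<open>u\<close> could be concatenated at
  \<open>z\<close>.\<close>

lemma sep_split: "sep E x u y \<Longrightarrow> sep E x u z \<or> sep E z u y"
  unfolding sep_def using rtrancl_trans by metis

lemma sep_edge: "sep E x u y \<Longrightarrow> (x, y) \<in> E \<Longrightarrow> u = x \<or> u = y"
  unfolding sep_def by (metis ComplI IntI mem_Sigma_iff r_into_rtrancl singletonD)

text \<open>On a walk from \<open>x\<close> to \<open>y\<close>, look at which of \<open>u\<close>
  and \<open>y\<close> is reached first: the part up to there avoids the other one, against one of
  the two separations.\<close>

lemma sep_antisym:
  assumes "(x, y) \<in> E\<^sup>*" and "sep E x u y" and "sep E x y u"
  shows "u = y"
proof (rule ccontr)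
  assume "u \<noteq> y"
  have xy: "x \<noteq> y" using assms(3) \<open>u \<noteq> y\<close> assms(2) by (auto simp: sep_def)
  have xu: "x \<noteq> u" using assms(3) \<open>u \<noteq> y\<close> xy by (auto simp: sep_def)
  \<comment> \<open>Invariant along the walk: both vertices have been avoided so far, or one of them
    has been reached while avoiding the other.\<close>
  have "z \<noteq> u \<and> z \<noteq> y \<and> (x, z) \<in> (Restr E (-{u, y}))\<^sup>*
      \<or> (x, y) \<in> (Restr E (-{u}))\<^sup>* \<or> (x, u) \<in> (Restr E (-{y}))\<^sup>*" if "(x, z) \<in> E\<^sup>*" for z
    using that
  proof induction
    case base
    then show ?case using xy xu by auto
  next
    case (step v z)
    then consider (a) "v \<noteq> u \<and> v \<noteq> y \<and> (x, v) \<in> (Restr E (-{u, y}))\<^sup>*"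
      | (b) "(x, y) \<in> (Restr E (-{u}))\<^sup>* \<or> (x, u) \<in> (Restr E (-{y}))\<^sup>*" by blast
    then show ?case
    proof cases
      case a
      have m: "(x, v) \<in> (Restr E (-{u}))\<^sup>*" "(x, v) \<in> (Restr E (-{y}))\<^sup>*"
        using a rtrancl_mono[of "Restr E (-{u, y})" "Restr E (-{u})"]
          rtrancl_mono[of "Restr E (-{u, y})" "Restr E (-{y})"] by auto
      consider "z = u" | "z = y" | "z \<noteq> u" "z \<noteq> y" by blast
      then show ?thesis
      proof cases
        case 1
        then have "(v, u) \<in> Restr E (-{y})" using a step.hyps \<open>u \<noteq> y\<close> by auto
        then show ?thesis using m(2) by (meson rtrancl.rtrancl_into_rtrancl)
      next
        case 2
        then have "(v, y) \<in> Restr E (-{u})" using a step.hyps \<open>u \<noteq> y\<close> by auto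
        then show ?thesis using m(1) by (meson rtrancl.rtrancl_into_rtrancl)
      next
        case 3
        then have "(v, z) \<in> Restr E (-{u, y})" using a step.hyps by auto
        then show ?thesis using a 3 by (meson rtrancl.rtrancl_into_rtrancl)
      qed
    qed auto
  qed
  from this[OF assms(1)] show False
    using assms(2,3) xy xu \<open>u \<noteq> y\<close> by (auto simp: sep_def)
qed

section \<open>Paths and separation\<close>

lemma is_path_Cons:
  "is_path E x (x # p) y \<longleftrightarrow>
     (p = [] \<and> x = y) \<or> (p \<noteq> [] \<and> (x, hd p) \<in> E \<and> x \<notin> set p \<and> is_path E (hd p) p y)"
  by (cases p) (auto simp: is_path_def)

lemma is_path_ConsE:
  assumes "is_path E x p y"
  obtains "p = [x]" "x = y"
  | p' where "p = x # p'" "p' \<noteq> []" "(x, hd p') \<in> E" "x \<notin> set p'" "is_path E (hd p') p' y"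
proof -
  from assms obtain p' where p: "p = x # p'" by (cases p) (auto simp: is_path_def)
  show ?thesis using assms that unfolding p is_path_Cons by blast
qed

lemma is_path_last_in: "is_path E x p y \<Longrightarrow> x \<in> set p \<and> y \<in> set p"
  by (auto simp: is_path_def)

lemma is_path_rtrancl: "is_path E x p y \<Longrightarrow> set p \<subseteq> A \<Longrightarrow> (x, y) \<in> (Restr E A)\<^sup>*"
proof (induction p arbitrary: x)
  case Nil
  then show ?case by (simp add: is_path_def)
next
  case (Cons a p)
  have ax: "a = x" using Cons.prems by (simp add: is_path_def)
  from Cons.prems(1)[unfolded ax is_path_Cons] show ?case
  proof (elim disjE conjE)
    assume "p \<noteq> []" "(x, hd p) \<in> E" "is_path E (hd p) p y"
    then have "(hd p, y) \<in> (Restr E A)\<^sup>*" "(x, hd p) \<in> Restr E A"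
      using Cons ax by (auto simp: subset_iff)
    then show ?thesis by (meson converse_rtrancl_into_rtrancl)
  qed auto
qed

lemma is_path_not_sep: "is_path E x p y \<Longrightarrow> u \<notin> set p \<Longrightarrow> \<not> sep E x u y"
  using is_path_rtrancl[of E x p y "-{u}"] is_path_last_in[of E x p y] by (auto simp: sep_def)

lemma sep_in_path: "sep E x u y \<Longrightarrow> is_path E x p y \<Longrightarrow> u \<in> set p"
  using is_path_not_sep[of E x p y u] by blast

lemma is_path_prefix:
  assumes "is_path E x p y" and "z \<in> set p"
  shows "\<exists>q. is_path E x q z \<and> set q \<subseteq> set p"
proof -
  obtain p1 p2 where p: "p = p1 @ z # p2" using assms(2) by (meson split_list)
  have "is_path E x (p1 @ [z]) z"
    using assms(1) unfolding is_path_def p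
    by (auto simp: successively_append_iff hd_append split: if_splits)
  then show ?thesis using p by (intro exI[of _ "p1 @ [z]"]) auto
qed

lemma rtrancl_imp_path: "(x, y) \<in> E\<^sup>* \<Longrightarrow> \<exists>p. is_path E x p y"
proof (induction rule: rtrancl_induct)
  case base
  then show ?case by (intro exI[of _ "[x]"]) (auto simp: is_path_def)
next
  case (step y z)
  then obtain p where p: "is_path E x p y" by blast
  show ?case
  proof (cases "z \<in> set p")
    case True
    then show ?thesis using is_path_prefix[OF p] by blast
  next
    case False
    then have "is_path E x (p @ [z]) z"
      using p step.hyps by (auto simp: is_path_def successively_append_iff)
    then show ?thesis by blast
  qed
qed

lemma is_path_mono: "is_path E x p y \<Longrightarrow> E \<subseteq> E' \<Longrightarrow> is_path E' x p y"
  unfolding is_path_def by (auto intro: successively_mono)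

lemma is_path_subset:
  "is_path E x p y \<Longrightarrow> E \<subseteq> V \<times> V \<Longrightarrow> x \<in> V \<Longrightarrow> set p \<subseteq> V"
proof (induction p arbitrary: x)
  case (Cons a p)
  have ax: "a = x" using Cons.prems by (simp add: is_path_def)
  then show ?case using Cons.prems(1)[unfolded ax is_path_Cons] Cons.IH Cons.prems by auto
qed simp

lemma is_path_Restr: "is_path E x p y \<Longrightarrow> set p \<subseteq> A \<Longrightarrow> is_path (Restr E A) x p y"
proof (induction p arbitrary: x)
  case (Cons a p)
  have ax: "a = x" using Cons.prems by (simp add: is_path_def)
  show ?case using Cons.prems(1)[unfolded ax is_path_Cons] Cons.IH Cons.prems(2)
    unfolding ax is_path_Cons by (cases p) auto
qed (simp add: is_path_def)

lemma connected_graph_iff: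
  assumes "E \<subseteq> V \<times> V"
  shows "connected_graph V E \<longleftrightarrow> (\<forall>x\<in>V. \<forall>y\<in>V. (x, y) \<in> E\<^sup>*)"
proof -
  have "(\<exists>p. set p \<subseteq> V \<and> is_path E x p y) \<longleftrightarrow> (x, y) \<in> E\<^sup>*" if "x \<in> V" "y \<in> V" for x y
  proof
    assume "\<exists>p. set p \<subseteq> V \<and> is_path E x p y"
    then obtain p where "is_path E x p y" by blast
    then show "(x, y) \<in> E\<^sup>*" using is_path_rtrancl[of E x p y UNIV] by simp
  next
    assume "(x, y) \<in> E\<^sup>*"
    then show "\<exists>p. set p \<subseteq> V \<and> is_path E x p y"
      using rtrancl_imp_path is_path_subset assms that by metis
  qed
  then show ?thesis unfolding connected_graph_def by blast
qed

section \<open>Trees\<close>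

text \<open>Two walks from \<open>x\<close> to the ends of an edge, each missing the other end,
  combine to a walk between the ends that does not use the edge, hence to a cycle; conversely a
  cycle gives two such walks for its first edge. In this form acyclicity can be derived from
  separation statements.\<close>

lemma tree_iff_sep:
  "tree V E \<longleftrightarrow> V \<noteq> {} \<and> simple_graph V E \<and> connected_graph V E \<and>
     (\<forall>u v x. (u, v) \<in> E \<longrightarrow> x \<in> V \<longrightarrow> sep E x u v \<or> sep E x v u)"
proof -
  have "(\<not> has_cycle E) \<longleftrightarrow> (\<forall>u v x. (u, v) \<in> E \<longrightarrow> x \<in> V \<longrightarrow> sep E x u v \<or> sep E x v u)"
    if g: "simple_graph V E" "connected_graph V E"
  proof (intro iffI allI impI)
    fix u v x
    assume nc: "\<not> has_cycle E" and uv: "(u, v) \<in> E" and "x \<in> V"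
    show "sep E x u v \<or> sep E x v u"
    proof (rule ccontr)
      assume "\<not> ?thesis"
      then have "(x, v) \<in> (Restr E (-{u}))\<^sup>*" "(x, u) \<in> (Restr E (-{v}))\<^sup>*"
        by (auto simp: sep_def)
      moreover have sym: "sym E" using g by (simp add: simple_graph_def)
      ultimately have "(u, x) \<in> (Restr E (-{v}))\<^sup>*" "(x, v) \<in> (Restr E (-{u}))\<^sup>*"
        using sym_Restr_rtrancl by auto
      \<comment> \<open>One walk misses \<open>v\<close> and the other misses \<open>u\<close>, so
        neither uses the arc from \<open>u\<close> to \<open>v\<close>.\<close>
      then have "(u, x) \<in> (E - {(u, v)})\<^sup>*" "(x, v) \<in> (E - {(u, v)})\<^sup>*"
        using rtrancl_mono[of "Restr E (-{v})" "E - {(u, v)}"]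
          rtrancl_mono[of "Restr E (-{u})" "E - {(u, v)}"] by auto
      then obtain p where p: "is_path (E - {(u, v)}) u p v"
        using rtrancl_imp_path by (meson rtrancl_trans)
      have "u \<noteq> v" using uv g by (auto simp: simple_graph_def irrefl_on_def)
      have "length p \<ge> 3"
      proof (rule ccontr)
        assume "\<not> length p \<ge> 3"
        then have "p = [] \<or> (\<exists>a. p = [a]) \<or> (\<exists>a b. p = [a, b])"
          by (cases p; cases "tl p"; cases "tl (tl p)") auto
        then show False using p \<open>u \<noteq> v\<close> by (auto simp: is_path_def)
      qed
      moreover have "is_path E u p v" using p by (rule is_path_mono) auto
      moreover have "(v, u) \<in> E" using uv sym by (auto simp: sym_def)
      ultimately show False using nc unfolding has_cycle_def by blast
    qed
  next
    assume *: "\<forall>u v x. (u, v) \<in> E \<longrightarrow> x \<in> V \<longrightarrow> sep E x u v \<or> sep E x v u"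
    show "\<not> has_cycle E"
    proof
      assume "has_cycle E"
      then obtain x p y where p: "length p \<ge> 3" "is_path E x p y" "(y, x) \<in> E"
        unfolding has_cycle_def by blast
      then obtain p' where p': "p = x # p'" "p' \<noteq> []" "(x, hd p') \<in> E" "x \<notin> set p'"
        "is_path E (hd p') p' y" by (cases rule: is_path_ConsE[OF p(2)]) auto
      have sym: "sym E" using g by (simp add: simple_graph_def)
      have "hd p' \<noteq> y" "x \<noteq> y"
      proof -
        obtain b q where q: "p' = b # q" "q \<noteq> []"
          using p(1) p'(1) by (cases p'; cases "tl p'") auto
        then have "y \<in> set q" using p'(5) by (auto simp: is_path_def)
        then show "hd p' \<noteq> y" using p'(5) q by (auto simp: is_path_def)
        show "x \<noteq> y" using p'(4) q \<open>y \<in> set q\<close> by auto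
      qed
      moreover have "hd p' \<noteq> x" using p'(2,4) hd_in_set[of p'] by auto
      \<comment> \<open>The witness is \<open>y\<close>, the other neighbour of \<open>x\<close> on
        the cycle: the closing edge leads to \<open>x\<close>, the rest of the cycle to
        \<open>hd p'\<close>.\<close>
      ultimately have "\<not> sep E y (hd p') x"
        using sep_edge[of E y "hd p'" x] p(3) by blast
      moreover have "\<not> sep E y x (hd p')"
        using is_path_not_sep[OF p'(5,4)] sep_commute[OF sym] by blast
      moreover have "y \<in> V" using g p(3) by (auto simp: simple_graph_def)
      ultimately show False using * p'(3) by blast
    qed
  qed
  then show ?thesis unfolding tree_def by blast
qed

lemma tree_sym: "tree V E \<Longrightarrow> sym E" and tree_subset: "tree V E \<Longrightarrow> E \<subseteq> V \<times> V"
  by (auto simp: tree_def simple_graph_def)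

lemma tree_edge_sep: "tree V E \<Longrightarrow> (u, v) \<in> E \<Longrightarrow> x \<in> V \<Longrightarrow> sep E x u v \<or> sep E x v u"
  unfolding tree_iff_sep by blast

lemma tree_rtrancl: "tree V E \<Longrightarrow> x \<in> V \<Longrightarrow> y \<in> V \<Longrightarrow> (x, y) \<in> E\<^sup>*"
  unfolding tree_def by (metis connected_graph_iff simple_graph_def)

text \<open>The rest of the path reaches \<open>y\<close> without \<open>x\<close>, so by acyclicity
  its first vertex separates \<open>x\<close> from \<open>y\<close>; a later vertex is handled by
  splitting at \<open>x\<close>.\<close>

lemma tree_in_path_sep:
  assumes "tree V E"
  shows "is_path E x p y \<Longrightarrow> x \<in> V \<Longrightarrow> z \<in> set p \<Longrightarrow> sep E x z y"
proof (induction p arbitrary: x)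
  case (Cons a p)
  have ax: "a = x" using Cons.prems by (simp add: is_path_def)
  show ?case
  proof (cases "z = x")
    case False
    then have p: "p \<noteq> []" "(x, hd p) \<in> E" "x \<notin> set p" "is_path E (hd p) p y" "z \<in> set p"
      using Cons.prems[unfolded ax is_path_Cons] by auto
    have V: "hd p \<in> V" "y \<in> V"
      using p tree_subset[OF assms] is_path_subset[OF p(4) tree_subset[OF assms]] is_path_last_in[OF p(4)]
      by auto
    have "sep E (hd p) z y" using Cons.IH[OF p(4) V(1) p(5)] .
    have "\<not> sep E y x (hd p)"
      using is_path_not_sep[OF p(4,3)] sep_commute[OF tree_sym[OF assms]] by blast
    then have 1: "sep E x (hd p) y"
      using tree_edge_sep[OF assms p(2) V(2)] sep_commute[OF tree_sym[OF assms]] by blast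
    consider "sep E (hd p) z x" | "sep E x z y"
      using sep_split[OF \<open>sep E (hd p) z y\<close>] by blast
    then show ?thesis
    proof cases
      case 1
      then have "z = hd p"
        using sep_edge[of E "hd p" z x] p(2) False tree_sym[OF assms] by (meson symE)
      then show ?thesis using \<open>sep E x (hd p) y\<close> by simp
    qed
  qed simp
qed simp

lemma path_set_eq_sep:
  assumes "tree V E" "x \<in> V" "y \<in> V"
  shows "path_set E x y = {u. sep E x u y}"
proof -
  obtain p where p: "is_path E x p y" using tree_rtrancl[OF assms] rtrancl_imp_path by metis
  show ?thesis
  proof (intro equalityI subsetI)
    fix u assume "u \<in> path_set E x y"
    then show "u \<in> {u. sep E x u y}"
      unfolding path_set_def using tree_in_path_sep[OF assms(1) _ assms(2)] by auto
  next
    fix u assume "u \<in> {u. sep E x u y}"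
    then show "u \<in> path_set E x y"
      unfolding path_set_def using sep_in_path[OF _ p] p by auto
  qed
qed

text \<open>Betweenness axioms valid for separation in any connected graph. They are instantiated
  with the adjacency graph and with trees, sometimes both within one argument.\<close>

locale separation =
  fixes S :: "'a \<Rightarrow> 'a \<Rightarrow> 'a \<Rightarrow> bool"
  assumes left [simp]: "S x x y"
    and commute: "S x u y \<Longrightarrow> S y u x"
    and split: "S x u y \<Longrightarrow> S x u z \<or> S z u y"
    and antisym: "S x u y \<Longrightarrow> S x y u \<Longrightarrow> u = y"
begin

lemma right [simp]: "S x y y"
  using commute[OF left] .

lemma refl_eq: "S x u x \<Longrightarrow> u = x"
  using antisym left by metis

lemma trans_outer: "S x u y \<Longrightarrow> S x w u \<Longrightarrow> S x w y"
  using split commute antisym by metis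

lemma trans_inner: "S x u y \<Longrightarrow> S x w u \<Longrightarrow> S w u y"
  using split antisym left by metis

lemma chain: "S x u y \<Longrightarrow> S x v y \<Longrightarrow> S x u v \<or> S x v u"
  using split commute antisym right by metis

lemma convex: "S x u y \<Longrightarrow> S x v y \<Longrightarrow> S u w v \<Longrightarrow> S x w y"
  using split trans_outer commute by metis

text \<open>Splitting at \<open>n\<close> shows that \<open>m\<close> separates \<open>n\<close>
  from at least two of the three vertices, and likewise \<open>n\<close> separates \<open>m\<close>
  from at least two. The two pairs share a vertex, and antisymmetry applies there.\<close>

lemma median_unique:
  assumes "S x m y" "S x m z" "S y m z" "S x n y" "S x n z" "S y n z"
  shows "m = n"
  using split[OF assms(1), of n] split[OF assms(2), of n] split[OF assms(3), of n]
    split[OF assms(4), of m] split[OF assms(5), of m] split[OF assms(6), of m]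
    antisym commute by metis

text \<open>\<open>m\<close> is the gate of \<open>a\<close> on the interval from \<open>x\<close>
  to \<open>y\<close>. If it did not separate \<open>a\<close> from \<open>b\<close>, it would
  separate \<open>b\<close> from both ends, while \<open>b\<close> separates \<open>m\<close> from
  one of them, so \<open>b = m\<close>.\<close>

lemma median_between: "S x m y \<Longrightarrow> S a m x \<Longrightarrow> S a m y \<Longrightarrow> S x b y \<Longrightarrow> S a m b"
  using split[of a m x b] split[of a m y b] split[of x b y m] commute antisym right by metis

end

lemma separation_sep:
  assumes "sym E" and "\<And>x y. (x, y) \<in> E\<^sup>*"
  shows "separation (sep E)"
proof
  show "sep E x x y" for x y by simp
  show "sep E y u x" if "sep E x u y" for x u y using that sep_commute[OF assms(1)] by blast
  show "sep E x u z \<or> sep E z u y" if "sep E x u y" for x u y z using sep_split[OF that] .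
  show "u = y" if "sep E x u y" "sep E x y u" for x u y using sep_antisym[OF assms(2) that] .
qed

lemma tree_separation: "tree UNIV T \<Longrightarrow> separation (sep T)"
  by (intro separation_sep) (auto dest: tree_sym tree_rtrancl)

lemma tree_path_set: "tree UNIV T \<Longrightarrow> path_set T x y = {u. sep T x u y}"
  by (simp add: path_set_eq_sep)

text \<open>Induction along a walk from \<open>x\<close> to the target. A step from \<open>a\<close>
  to \<open>a'\<close> destroys the median only if the median is \<open>a\<close> itself and the
  edge leads into the interval; then \<open>a'\<close> is the new median.\<close>

lemma tree_median:
  assumes T: "tree UNIV T"
  shows "\<exists>m. sep T x m y \<and> sep T x m a \<and> sep T y m a"
proof -
  interpret separation "sep T" using tree_separation[OF T] .
  have "(x, a) \<in> T\<^sup>*" using tree_rtrancl[OF T] by auto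
  then show ?thesis
  proof induction
    case base
    then show ?case by (intro exI[of _ x]) auto
  next
    case (step a a')
    then obtain m where m: "sep T x m y" "sep T x m a" "sep T y m a" by blast
    show ?case
    proof (cases "sep T x m a' \<and> sep T y m a'")
      case False
      then have "sep T a m a'" "m \<noteq> a'"
        using split[OF m(2), of a'] split[OF m(3), of a'] commute[of a' m a] by auto
      then have ma: "m = a" using sep_edge step.hyps(2) by metis
      obtain z where z: "z = x \<or> z = y" "\<not> sep T z a a'" using False ma by blast
      then have 1: "sep T z a' a" using tree_edge_sep[OF T step.hyps(2), of z] by blast
      have "sep T x a' y"
      proof (cases "z = x")
        case True
        then show ?thesis using trans_outer[OF m(1)] 1 ma by simp
      next
        case False
        then show ?thesis using trans_outer[OF commute[OF m(1)]] 1 ma z(1) commute by blast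
      qed
      then show ?thesis by (intro exI[of _ a']) auto
    qed (use m in blast)
  qed
qed

text \<open>The definite description inside \<open>proj\<close> selects the gate of \<open>a\<close>
  on the path, which is the median; later uses of \<open>proj\<close> go through this
  identification.\<close>

lemma proj_path_set:
  assumes T: "tree UNIV T" and m: "sep T x m y" "sep T x m a" "sep T y m a"
  shows "proj T (path_set T x y) a = m"
proof -
  interpret separation "sep T" using tree_separation[OF T] .
  show ?thesis
  proof (cases "sep T x a y")
    case True
    then have "m = a" using median_unique[of x m y a a] m by auto
    then show ?thesis using True by (simp add: proj_def tree_path_set[OF T])
  next
    case False
    have "sep T a m b" if "sep T x b y" for b
      using median_between[OF m(1) commute[OF m(2)] commute[OF m(3)] that] .
    then have "(THE a'. a' \<in> path_set T x y \<and> (\<forall>b\<in>path_set T x y. a' \<in> path_set T a b)) = m"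
      unfolding tree_path_set[OF T] using m(1) antisym by (intro the_equality) auto
    then show ?thesis using False by (simp add: proj_def tree_path_set[OF T])
  qed
qed

lemma proj_path_setD:
  assumes T: "tree UNIV T"
  shows "sep T x (proj T (path_set T x y) a) y" "sep T x (proj T (path_set T x y) a) a"
    "sep T y (proj T (path_set T x y) a) a"
  using tree_median[OF T, of x y a] proj_path_set[OF T] by auto

lemma subtree_path_set:
  assumes T: "tree UNIV T"
  shows "subtree T (path_set T x y)"
proof -
  interpret separation "sep T" using tree_separation[OF T] .
  define B where "B = path_set T x y"
  have B: "B = {u. sep T x u y}" by (simp add: B_def tree_path_set[OF T])
  have "\<exists>p. set p \<subseteq> B \<and> is_path (Restr T B) u p v" if "u \<in> B" "v \<in> B" for u v
  proof -
    obtain p where p: "is_path T u p v" using rtrancl_imp_path[OF tree_rtrancl[OF T]] by auto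
    have "set p \<subseteq> B"
      using tree_in_path_sep[OF T p] convex[of x u y v] that unfolding B by auto
    then show ?thesis using is_path_Restr[OF p] by blast
  qed
  moreover have "\<not> has_cycle (Restr T B)"
    using T is_path_mono[of "Restr T B" _ _ _ T] unfolding tree_def has_cycle_def by blast
  moreover have "simple_graph B (Restr T B)"
    using T unfolding tree_def simple_graph_def by (auto simp: sym_def irrefl_on_def)
  moreover have "x \<in> B" by (simp add: B)
  ultimately show ?thesis unfolding subtree_def tree_def connected_graph_def B_def[symmetric] by blast
qed

text \<open>A subtree contains a path between any two of its vertices, hence every vertex separating
  them.\<close>

lemma hull_pair:
  assumes T: "tree UNIV T"
  shows "subtree T hull {x, y} = path_set T x y"
proof (rule hull_unique)
  show "{x, y} \<subseteq> path_set T x y" by (simp add: tree_path_set[OF T])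
  show "subtree T (path_set T x y)" using subtree_path_set[OF T] .
next
  fix B assume "{x, y} \<subseteq> B" "subtree T B"
  then obtain p where p: "set p \<subseteq> B" "is_path (Restr T B) x p y"
    unfolding subtree_def tree_def connected_graph_def by blast
  then have "is_path T x p y" by (auto intro: is_path_mono)
  then show "path_set T x y \<subseteq> B"
    using p(1) sep_in_path unfolding tree_path_set[OF T] by fastforce
qed

lemma peak_span_2: "tree UNIV T \<Longrightarrow> peak_span T 2 P = path_set T (peak (P 1)) (peak (P 2))"
proof -
  assume "tree UNIV T"
  moreover have "(\<lambda>i. peak (P i)) ` {1..2} = {peak (P 1), peak (P 2)}"
  proof -
    have "{1..2::nat} = {1, 2}" by auto
    then show ?thesis by simp
  qed
  ultimately show ?thesis unfolding peak_span_def by (simp only: hull_pair)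
qed

subsection \<open>Gluing graphs at a vertex\<close>

text \<open>The second part is entered and left only through \<open>c\<close>, so excursions into it
  can be cut out. While the walk is outside \<open>V1\<close>, the invariant remembers that
  \<open>c\<close> was reached inside \<open>E1\<close>.\<close>

lemma glue_reach:
  assumes E: "E1 \<subseteq> V1 \<times> V1" "E2 \<subseteq> V2 \<times> V2" and c: "V1 \<inter> V2 = {c}" and x: "x \<in> V1"
    and r: "(x, z) \<in> (Restr (E1 \<union> E2) A)\<^sup>*"
  shows "(z \<in> V1 \<and> (x, z) \<in> (Restr E1 A)\<^sup>*) \<or>
    (z \<notin> V1 \<and> c \<in> A \<and> (x, c) \<in> (Restr E1 A)\<^sup>*)"
  using r
proof induction
  case base
  then show ?case using x by simp
next
  case (step z w)
  then consider "(z, w) \<in> Restr E1 A" | "(z, w) \<in> E2" "z \<in> A" "w \<in> A" by blast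
  then show ?case
  proof cases
    case 1
    then have "z \<in> V1" "w \<in> V1" using E by auto
    then show ?thesis using step.IH 1 by (auto intro: rtrancl.rtrancl_into_rtrancl)
  next
    case 2
    then have "z \<in> V2" "w \<in> V2" using E by auto
    then have "z \<in> V1 \<Longrightarrow> z = c" "w \<in> V1 \<Longrightarrow> w = c" using c by auto
    then show ?thesis using step.IH 2 by auto
  qed
qed

lemma glue_sep_left:
  assumes E: "E1 \<subseteq> V1 \<times> V1" "E2 \<subseteq> V2 \<times> V2" "V1 \<inter> V2 = {c}" and xy: "x \<in> V1" "y \<in> V1"
  shows "sep (E1 \<union> E2) x u y \<longleftrightarrow> sep E1 x u y"
proof -
  have "(x, y) \<in> (Restr (E1 \<union> E2) (-{u}))\<^sup>* \<longleftrightarrow> (x, y) \<in> (Restr E1 (-{u}))\<^sup>*"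
    using glue_reach[OF E xy(1), of y "-{u}"] xy(2)
      rtrancl_mono[of "Restr E1 (-{u})" "Restr (E1 \<union> E2) (-{u})"] by auto
  then show ?thesis by (simp add: sep_def)
qed

text \<open>Every walk from one part to the other passes through \<open>c\<close>, so it can be
  obstructed on either side of \<open>c\<close>.\<close>

lemma glue_sep_cross:
  assumes E: "E1 \<subseteq> V1 \<times> V1" "E2 \<subseteq> V2 \<times> V2" "V1 \<inter> V2 = {c}"
    and s: "sym E1" "sym E2" and xy: "x \<in> V1" "y \<in> V2"
  shows "sep (E1 \<union> E2) x u y \<longleftrightarrow> sep E1 x u c \<or> sep E2 c u y"
proof -
  let ?E = "E1 \<union> E2"
  have E': "V2 \<inter> V1 = {c}" using E(3) by auto
  have cV: "c \<in> V1" "c \<in> V2" using E(3) by auto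
  have 1: "sep ?E x u c \<longleftrightarrow> sep E1 x u c" using glue_sep_left[OF E xy(1) cV(1)] .
  have 2: "sep ?E c u y \<longleftrightarrow> sep E2 c u y"
    using glue_sep_left[OF E(2,1) E' cV(2) xy(2)] by (simp add: Un_commute)
  have "sep ?E x u c \<or> sep ?E c u y" if "sep ?E x u y"
    using sep_split[OF that] .
  moreover have "sep ?E x u y" if "sep ?E x u c \<or> sep ?E c u y"
  proof (rule ccontr)
    assume "\<not> ?thesis"
    then have n: "x \<noteq> u" "y \<noteq> u" "(x, y) \<in> (Restr ?E (-{u}))\<^sup>*" by (auto simp: sep_def)
    have "(y, x) \<in> (Restr ?E (-{u}))\<^sup>*"
      using sym_Restr_rtrancl[OF sym_Un[OF s] n(3)] .
    then have n': "(y, x) \<in> (Restr (E2 \<union> E1) (-{u}))\<^sup>*" by (simp add: Un_commute)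
    have "y \<in> V1 \<Longrightarrow> y = c" "x \<in> V2 \<Longrightarrow> x = c" using xy E(3) by auto
    then have "c \<noteq> u \<and> (x, c) \<in> (Restr E1 (-{u}))\<^sup>*" "c \<noteq> u \<and> (y, c) \<in> (Restr E2 (-{u}))\<^sup>*"
      using glue_reach[OF E xy(1) n(3)] glue_reach[OF E(2,1) E' xy(2) n'] n by auto
    then have "\<not> sep E1 x u c" "\<not> sep E2 y u c" using n by (auto simp: sep_def)
    then show False using that 1 2 sep_commute[OF s(2)] by blast
  qed
  ultimately show ?thesis using 1 2 by blast
qed

lemma glue_tree:
  assumes T: "tree V1 E1" "tree V2 E2" and c: "V1 \<inter> V2 = {c}"
  shows "tree (V1 \<union> V2) (E1 \<union> E2)"
proof -
  note sub = tree_subset[OF T(1)] tree_subset[OF T(2)]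
  note syms = tree_sym[OF T(1)] tree_sym[OF T(2)]
  have c': "V2 \<inter> V1 = {c}" using c by auto
  have cV: "c \<in> V1" "c \<in> V2" using c by auto
  \<comment> \<open>Stated for arbitrary parts because it is applied again with the two parts
    exchanged.\<close>
  have E: "sep (E1 \<union> E2) x u v \<or> sep (E1 \<union> E2) x v u"
    if T: "tree V1 E1" "tree V2 E2" and c: "V1 \<inter> V2 = {c}" and uv: "(u, v) \<in> E1" and x: "x \<in> V1 \<union> V2"
    for V1 V2 E1 E2 u v x
  proof -
    note sub = tree_subset[OF T(1)] tree_subset[OF T(2)]
    note syms = tree_sym[OF T(1)] tree_sym[OF T(2)]
    have sym: "sym (E1 \<union> E2)" using syms by (auto simp: sym_def)
    have V: "u \<in> V1" "v \<in> V1" "c \<in> V1" using uv sub c by auto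
    show ?thesis
    proof (cases "x \<in> V1")
      case True
      then show ?thesis
        using tree_edge_sep[OF T(1) uv True] glue_sep_left[OF sub c] V by simp
    next
      case False
      then have x: "x \<in> V2" using x by simp
      \<comment> \<open>Seen from the first part, a vertex of the second one behaves like
        \<open>c\<close>.\<close>
      have "sep E1 u v c \<or> sep E1 v u c"
        using tree_edge_sep[OF T(1) uv V(3)] sep_commute[OF syms(1)] by blast
      then show ?thesis
        using glue_sep_cross[OF sub c syms _ x] V sep_commute[OF sym] by blast
    qed
  qed
  have "(x, y) \<in> (E1 \<union> E2)\<^sup>*" if "x \<in> V1 \<union> V2" "y \<in> V1 \<union> V2" for x y
  proof -
    have *: "(z, c) \<in> (E1 \<union> E2)\<^sup>* \<and> (c, z) \<in> (E1 \<union> E2)\<^sup>*" if "z \<in> V1 \<union> V2" for z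
      using that tree_rtrancl[OF T(1), of z c] tree_rtrancl[OF T(2), of z c]
        tree_rtrancl[OF T(1), of c z] tree_rtrancl[OF T(2), of c z] cV
        rtrancl_mono[of E1 "E1 \<union> E2"] rtrancl_mono[of E2 "E1 \<union> E2"] by blast
    show ?thesis using *[OF that(1)] *[OF that(2)] by (meson rtrancl_trans)
  qed
  moreover have "E1 \<union> E2 \<subseteq> (V1 \<union> V2) \<times> (V1 \<union> V2)" using sub by auto
  moreover have "simple_graph (V1 \<union> V2) (E1 \<union> E2)"
    using T sub syms unfolding tree_def simple_graph_def by (auto simp: sym_def irrefl_on_def)
  moreover have "sep (E1 \<union> E2) x u v \<or> sep (E1 \<union> E2) x v u"
    if "(u, v) \<in> E1 \<union> E2" "x \<in> V1 \<union> V2" for u v x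
    using that E[OF T c, of u v x] E[OF T(2,1) c', of u v x] by (auto simp: Un_commute)
  ultimately show ?thesis using cV connected_graph_iff unfolding tree_iff_sep by blast
qed

lemma line_tree:
  assumes "ms \<noteq> []" "distinct ms"
  shows "\<exists>L. tree (set ms) L \<and> (\<forall>u\<in>set ms. sep L (hd ms) u (last ms))"
  using assms
proof (induction ms)
  case (Cons x xs)
  show ?case
  proof (cases "xs = []")
    case True
    have "tree {x} {}"
      unfolding tree_iff_sep simple_graph_def connected_graph_def
      by (auto simp: sym_def irrefl_on_def is_path_def intro!: exI[of _ "[x]"])
    then show ?thesis using True by (intro exI[of _ "{}"]) (auto simp: sep_def)
  next
    case False
    define y where "y = hd xs"
    have xy: "x \<noteq> y" "y \<in> set xs" "x \<notin> set xs" using False Cons.prems y_def by auto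
    obtain L where L: "tree (set xs) L" "\<forall>u\<in>set xs. sep L y u (last xs)"
      using Cons False unfolding y_def by auto
    let ?E = "{(x, y), (y, x)}"
    have E: "tree {x, y} ?E"
    proof -
      have "connected_graph {x, y} ?E"
        using xy by (subst connected_graph_iff) auto
      moreover have "simple_graph {x, y} ?E"
        using xy by (auto simp: simple_graph_def sym_def irrefl_on_def)
      ultimately show ?thesis unfolding tree_iff_sep by (auto simp: sep_def)
    qed
    have c: "{x, y} \<inter> set xs = {y}" using xy by auto
    have "tree (set (x # xs)) (?E \<union> L)"
      using glue_tree[OF E L(1) c] xy(2) by (simp add: insert_absorb)
    moreover have "sep (?E \<union> L) x u (last xs)" if "u \<in> set (x # xs)" for u
      using glue_sep_cross[OF tree_subset[OF E] tree_subset[OF L(1)] c tree_sym[OF E] tree_sym[OF L(1)],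
          of x "last xs" u] that L(2) False by auto
    ultimately show ?thesis using False by (intro exI[of _ "?E \<union> L"]) auto
  qed
qed simp

section \<open>Preferences\<close>

text \<open>Inverse of \<open>ranked\<close>; the definite description there is under control once
  this map is shown to be a bijection onto the positions.\<close>

definition rank :: "'a pref \<Rightarrow> 'a \<Rightarrow> nat" where
  "rank R x = card {y. (y, x) \<in> R} + 1"

lemma preferenceD:
  assumes "preference R"
  shows "(x, x) \<notin> R" "x \<noteq> y \<Longrightarrow> (x, y) \<in> R \<or> (y, x) \<in> R"
    "(x, y) \<in> R \<Longrightarrow> (y, z) \<in> R \<Longrightarrow> (x, z) \<in> R" "(x, y) \<in> R \<Longrightarrow> (y, x) \<notin> R"
proof -
  have r: "trans R" "irrefl R" "total R"
    using assms unfolding strict_linear_order_on_def by auto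
  show i: "(x, x) \<notin> R" for x using r(2) by (simp add: irrefl_on_def)
  show "x \<noteq> y \<Longrightarrow> (x, y) \<in> R \<or> (y, x) \<in> R" using r(3) by (simp add: total_on_def)
  show "(x, y) \<in> R \<Longrightarrow> (y, z) \<in> R \<Longrightarrow> (x, z) \<in> R" using r(1) by (rule transD)
  show "(x, y) \<in> R \<Longrightarrow> (y, x) \<notin> R" using r(1) i transD by metis
qed

lemma rank_less_iff:
  fixes R :: "'a::finite pref"
  assumes "preference R"
  shows "rank R x < rank R y \<longleftrightarrow> (x, y) \<in> R"
proof -
  have *: "rank R x < rank R y" if "(x, y) \<in> R" for x y
  proof -
    have "{z. (z, x) \<in> R} \<subset> {z. (z, y) \<in> R}"
      using that preferenceD(1,3)[OF assms] by blast
    then show ?thesis unfolding rank_def by (simp add: psubset_card_mono)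
  qed
  then show ?thesis using preferenceD(2)[OF assms, of x y] by (metis not_less_iff_gr_or_eq)
qed

lemma rank_eq_iff:
  fixes R :: "'a::finite pref"
  shows "preference R \<Longrightarrow> rank R x = rank R y \<longleftrightarrow> x = y"
  using rank_less_iff[of R x y] rank_less_iff[of R y x] preferenceD(2)[of R x y] by auto

lemma rank_bij:
  fixes R :: "'a::finite pref"
  assumes "preference R"
  shows "bij_betw (rank R) UNIV {1..CARD('a)}"
proof -
  have inj: "inj (rank R)" using rank_eq_iff[OF assms] by (simp add: inj_on_def)
  have "{y. (y, x) \<in> R} \<subset> UNIV" for x using preferenceD(1)[OF assms] by blast
  then have "rank R x \<in> {1..CARD('a)}" for x
    using psubset_card_mono[of UNIV "{y. (y, x) \<in> R}"] by (simp add: rank_def Suc_le_eq)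
  then have "rank R ` UNIV \<subseteq> {1..CARD('a)}" by blast
  moreover have "card (rank R ` UNIV) = card {1..CARD('a)}" using inj by (simp add: card_image)
  ultimately have "rank R ` UNIV = {1..CARD('a)}" by (intro card_subset_eq) auto
  then show ?thesis using inj by (simp add: bij_betw_def)
qed

lemma ranked_rank:
  fixes R :: "'a::finite pref"
  assumes "preference R"
  shows "ranked (rank R x) R = x"
  unfolding ranked_def rank_def[symmetric] using rank_eq_iff[OF assms] by blast

lemma rank_ranked:
  fixes R :: "'a::finite pref"
  assumes "preference R" "k \<in> {1..CARD('a)}"
  shows "rank R (ranked k R) = k"
proof -
  have "k \<in> range (rank R)" using rank_bij[OF assms(1)] assms(2) by (simp add: bij_betw_def)
  then obtain x where "k = rank R x" by blast
  then show ?thesis using ranked_rank[OF assms(1)] by simp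
qed

lemma peak_better:
  fixes R :: "'a::finite pref"
  assumes "preference R" "x \<noteq> peak R"
  shows "(peak R, x) \<in> R"
proof -
  have "rank R (peak R) = 1" using rank_ranked[OF assms(1), of 1] by (simp add: Suc_le_eq)
  moreover have "rank R x \<ge> 1" by (simp add: rank_def)
  moreover have "rank R x \<noteq> rank R (peak R)" using assms rank_eq_iff by metis
  ultimately show ?thesis using rank_less_iff[OF assms(1), of "peak R" x] by linarith
qed

lemma peak_unbeaten:
  fixes R :: "'a::finite pref"
  shows "preference R \<Longrightarrow> (x, peak R) \<notin> R"
  using peak_better preferenceD(1,4) by metis

lemma second_better:
  fixes R :: "'a::finite pref"
  assumes "preference R" "CARD('a) \<ge> 2"
  shows "ranked 2 R \<noteq> peak R" "x \<noteq> peak R \<Longrightarrow> x \<noteq> ranked 2 R \<Longrightarrow> (ranked 2 R, x) \<in> R"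
proof -
  have 1: "rank R (peak R) = 1" using rank_ranked[OF assms(1), of 1] assms(2) by simp
  have 2: "rank R (ranked 2 R) = 2" using rank_ranked[OF assms(1), of 2] assms(2) by simp
  show "ranked 2 R \<noteq> peak R" using 1 2 by auto
  assume "x \<noteq> peak R" "x \<noteq> ranked 2 R"
  then have "rank R x \<noteq> 1" "rank R x \<noteq> 2" using rank_eq_iff[OF assms(1)] 1 2 by metis+
  moreover have "rank R x \<ge> 1" by (simp add: rank_def)
  ultimately show "(ranked 2 R, x) \<in> R"
    using 2 rank_less_iff[OF assms(1), of "ranked 2 R" x] by linarith
qed

lemma best_iff:
  assumes "preference R" "a \<in> B" "finite B"
  shows "best R B = a \<longleftrightarrow> (\<forall>y\<in>B. y \<noteq> a \<longrightarrow> (a, y) \<in> R)"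
proof -
  have e: "best R B = x" if "x \<in> B" "\<forall>y\<in>B. y \<noteq> x \<longrightarrow> (x, y) \<in> R" for x
    unfolding best_def using that preferenceD(4)[OF assms(1)] by (intro the_equality) (auto, metis)
  have "\<exists>x\<in>B. \<forall>y\<in>B. y \<noteq> x \<longrightarrow> (x, y) \<in> R"
    using assms(3,2)
  proof (induction B arbitrary: a rule: finite_induct)
    case (insert b B)
    show ?case
    proof (cases "B = {}")
      case False
      then obtain x where x: "x \<in> B" "\<forall>y\<in>B. y \<noteq> x \<longrightarrow> (x, y) \<in> R" using insert.IH by blast
      show ?thesis
      proof (cases "(x, b) \<in> R")
        case True
        then show ?thesis using x by blast
      next
        case F: False
        then have "(b, x) \<in> R" using x(1) insert.hyps preferenceD(2)[OF assms(1)] by metis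
        then have "(b, y) \<in> R" if "y \<in> B" for y
          using x(2) that preferenceD(3)[OF assms(1), of b x y] by (cases "y = x") auto
        then show ?thesis by blast
      qed
    qed auto
  qed simp
  then obtain x where x: "x \<in> B" "\<forall>y\<in>B. y \<noteq> x \<longrightarrow> (x, y) \<in> R" by blast
  then have "best R B = x" by (rule e)
  then show ?thesis using x(2) e[OF assms(2)] by auto
qed

lemma completely_reversed_eqI:
  assumes "completely_reversed R R'" "preference R'" "x = y \<or> (x, y) \<in> R" "x = y \<or> (x, y) \<in> R'"
  shows "x = y"
  using assms preferenceD(4)[OF assms(2), of x y] unfolding completely_reversed_def by blast

section \<open>Semi-single-peakedness and semi-hybridness in terms of separation\<close>

text \<open>Common shape of the two conditions: \<open>C\<close> is a set hanging off the vertex \<open>a\<close>, and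
  \<open>S x u y\<close> says that \<open>u\<close> lies between \<open>x\<close> and \<open>y\<close>. Taking \<open>C = - {a}\<close> yields
  semi-single-peakedness with respect to \<open>a\<close>.\<close>

definition hangs_in :: "('a \<Rightarrow> 'a \<Rightarrow> 'a \<Rightarrow> bool) \<Rightarrow> 'a set \<Rightarrow> 'a \<Rightarrow> 'a pref \<Rightarrow> bool" where
  "hangs_in S C a R \<longleftrightarrow>
     (peak R \<in> C \<longrightarrow> (\<forall>u v. S (peak R) u a \<longrightarrow> S (peak R) u v \<longrightarrow> u \<noteq> v \<longrightarrow> (u, v) \<in> R)) \<and>
     (peak R \<notin> C \<longrightarrow> (\<forall>v\<in>C. (a, v) \<in> R))"

text \<open>Both clauses merge into one: a vertex on the way to the threshold beats everything
  behind it. For \<open>v\<close> off the path, the comparison runs from \<open>u\<close> to the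
  projection of \<open>v\<close> and from there to \<open>v\<close>.\<close>

lemma ssp_iff:
  fixes R :: "'a::finite pref"
  assumes T: "tree UNIV T" and R: "preference R"
  shows "semi_single_peaked T x R \<longleftrightarrow>
    (\<forall>u v. sep T (peak R) u x \<longrightarrow> sep T (peak R) u v \<longrightarrow> u \<noteq> v \<longrightarrow> (u, v) \<in> R)" (is "?L \<longleftrightarrow> ?R")
proof -
  interpret separation "sep T" using tree_separation[OF T] .
  define p where "p = peak R"
  define q where "q v = proj T (path_set T p x) v" for v
  have q: "sep T p (q v) x" "sep T p (q v) v" "sep T x (q v) v" for v
    using proj_path_setD[OF T] unfolding q_def by auto
  have L: "?L \<longleftrightarrow> (\<forall>a b. sep T p a x \<longrightarrow> sep T p b x \<longrightarrow> a \<noteq> b \<longrightarrow> sep T p a b \<longrightarrow> (a, b) \<in> R) \<and>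
    (\<forall>a. \<not> sep T p a x \<longrightarrow> (q a, a) \<in> R)"
    unfolding semi_single_peaked_def tree_path_set[OF T] q_def p_def by auto
  show ?thesis
  proof
    assume l: ?L
    show ?R
    proof (intro allI impI, fold p_def)
      fix u v assume u: "sep T p u x" "sep T p u v" "u \<noteq> v"
      show "(u, v) \<in> R"
      proof (cases "sep T p v x")
        case True
        then show ?thesis using l L u by blast
      next
        case False
        \<comment> \<open>Otherwise the projection comes before \<open>u\<close>, although
          \<open>u\<close> is on the way to both \<open>x\<close> and \<open>v\<close>. As the
          projection separates \<open>x\<close> from \<open>v\<close>, the two must
          coincide.\<close>
        have "sep T p u (q v)"
        proof (rule ccontr)
          assume n: "\<not> ?thesis"
          then have 1: "sep T p (q v) u" using chain[OF u(2) q(2)] by blast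
          then have "sep T (q v) u x" "sep T (q v) u v" using trans_inner u by blast+
          then have "u = q v"
            using split[OF q(3)[of v], of u] antisym[of x u "q v"] antisym[of v u "q v"] commute by metis
          then show False using n by simp
        qed
        moreover have "(q v, v) \<in> R" using l L False by blast
        ultimately show ?thesis
          using l L u(1) q(1)[of v] preferenceD(3)[OF R, of u "q v" v] by (cases "u = q v") auto
      qed
    qed
  next
    assume r: ?R
    have "(q a, a) \<in> R" if "\<not> sep T p a x" for a
      using r q[of a] that unfolding p_def by metis
    then show ?L using r L unfolding p_def by blast
  qed
qed

lemma ssp_iff_hangs_in:
  fixes R :: "'a::finite pref"
  assumes T: "tree UNIV T" and R: "preference R"
  shows "semi_single_peaked T x R \<longleftrightarrow> hangs_in (sep T) (-{x}) x R"
proof (cases "peak R = x")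
  case True
  interpret separation "sep T" using tree_separation[OF T] .
  have "(u, v) \<in> R" if "sep T x u x" "u \<noteq> v" for u v
    using that refl_eq[OF that(1)] peak_better[OF R, of v] True by simp
  moreover have "(x, v) \<in> R" if "v \<noteq> x" for v
    using that peak_better[OF R, of v] True by simp
  ultimately show ?thesis unfolding ssp_iff[OF assms] hangs_in_def True by simp
next
  case False
  then show ?thesis unfolding ssp_iff[OF assms] hangs_in_def by simp
qed

lemma beyond_iff: "tree UNIV T \<Longrightarrow> beyond T a b = {z. sep T z a b}"
  by (simp add: beyond_def tree_path_set)

lemma dual_thresholds_iff:
  assumes T: "tree UNIV T"
  shows "dual_thresholds T a b \<longleftrightarrow> a \<noteq> b \<and> (\<forall>c. sep T a c b \<or> sep T c a b \<or> sep T c b a)"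
proof -
  interpret separation "sep T" using tree_separation[OF T] .
  have "proj T (path_set T a b) c \<in> {a, b} \<longleftrightarrow> sep T c a b \<or> sep T c b a" for c
  proof
    assume "proj T (path_set T a b) c \<in> {a, b}"
    then show "sep T c a b \<or> sep T c b a"
      using proj_path_setD(2,3)[where T = T and x = a and y = b and a = c, OF T] commute by auto
  next
    assume "sep T c a b \<or> sep T c b a"
    then show "proj T (path_set T a b) c \<in> {a, b}"
      using proj_path_set[OF T, of a a b c] proj_path_set[OF T, of a b b c] by (auto dest: commute)
  qed
  then show ?thesis unfolding dual_thresholds_def tree_path_set[OF T] by auto
qed

text \<open>The cases by position of the peak regroup into one condition per threshold: the
  \<open>best\<close> clause of a side is demanded exactly when the peak is not strictly beyond that
  threshold. The two sides can then be studied separately.\<close>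

lemma semi_hybrid_iff:
  fixes R :: "'a::finite pref"
  assumes T: "tree UNIV T" and dt: "dual_thresholds T a b" and R: "preference R"
  shows "semi_hybrid T a b R \<longleftrightarrow>
    hangs_in (sep T) (beyond T a b - {a}) a R \<and> hangs_in (sep T) (beyond T b a - {b}) b R"
proof -
  interpret separation "sep T" using tree_separation[OF T] .
  have ab: "a \<noteq> b" and cover: "\<And>c. sep T a c b \<or> sep T c a b \<or> sep T c b a"
    using dt dual_thresholds_iff[OF T] by auto
  have a: "a \<in> beyond T a b" and b: "b \<in> beyond T b a" using beyond_iff[OF T] by auto
  have best: "best R (beyond T a b) = a \<longleftrightarrow> (\<forall>v\<in>beyond T a b - {a}. (a, v) \<in> R)"
    "best R (beyond T b a) = b \<longleftrightarrow> (\<forall>v\<in>beyond T b a - {b}. (b, v) \<in> R)"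
    using best_iff[OF R a] best_iff[OF R b] by auto
  have disj: "\<not> (z \<in> beyond T a b \<and> z \<in> beyond T b a)" for z
    unfolding beyond_iff[OF T] using antisym[of z a b] ab by auto
  have path: "z \<in> path_set T a b \<longleftrightarrow> z \<notin> beyond T a b - {a} \<and> z \<notin> beyond T b a - {b}" for z
  proof -
    have "sep T a z b \<Longrightarrow> sep T z a b \<Longrightarrow> z = a" using antisym[of b z a] commute by blast
    moreover have "sep T a z b \<Longrightarrow> sep T z b a \<Longrightarrow> z = b" using antisym[of a z b] commute by blast
    ultimately show ?thesis
      unfolding tree_path_set[OF T] beyond_iff[OF T] using cover[of z] by auto
  qed
  show ?thesis
    unfolding semi_hybrid_def best path hangs_in_def ssp_iff[OF T R] using disj by blast
qed

section \<open>Path-connected domains\<close>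

locale path_connected_domain =
  fixes D :: "'a::finite pref set"
  assumes card3: "CARD('a) \<ge> 3" and dom: "is_domain D" and conn: "path_connected_dom D"
begin

abbreviation G where "G \<equiv> adj_graph D"
abbreviation S where "S \<equiv> sep (adj_graph D)"

lemma pref: "R \<in> D \<Longrightarrow> preference R"
  using dom by (simp add: is_domain_def)

lemma second_neq: "R \<in> D \<Longrightarrow> ranked 2 R \<noteq> peak R"
  using second_better(1)[OF pref] card3 by simp

lemma second_best: "R \<in> D \<Longrightarrow> x \<noteq> peak R \<Longrightarrow> x \<noteq> ranked 2 R \<Longrightarrow> (ranked 2 R, x) \<in> R"
  using second_better(2)[OF pref] card3 by simp

lemma peak_best: "R \<in> D \<Longrightarrow> x \<noteq> peak R \<Longrightarrow> (peak R, x) \<in> R"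
  using peak_better pref by blast

text \<open>Equal ranks from the third position on leave only the pair \<open>{a, b}\<close> on
  which the two preferences can disagree.\<close>

lemma edgeE:
  assumes "(a, b) \<in> G"
  obtains R R' where "R \<in> D" "R' \<in> D" "peak R = a" "ranked 2 R = b" "peak R' = b" "ranked 2 R' = a"
    "\<And>x y. {x, y} \<noteq> {a, b} \<Longrightarrow> (x, y) \<in> R \<longleftrightarrow> (x, y) \<in> R'"
proof -
  obtain R R' where R: "R \<in> D" "R' \<in> D" "peak R = a" "ranked 2 R = b" "peak R' = b" "ranked 2 R' = a"
    "\<forall>k\<in>{3..CARD('a)}. ranked k R = ranked k R'"
    using assms unfolding adj_graph_def adjacent_def by auto
  note p = pref[OF R(1)] pref[OF R(2)]
  have r: "rank R a = 1" "rank R b = 2" "rank R' b = 1" "rank R' a = 2"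
    using rank_ranked[OF p(1), of 1] rank_ranked[OF p(1), of 2]
      rank_ranked[OF p(2), of 1] rank_ranked[OF p(2), of 2] R card3 by auto
  have r': "rank R x = rank R' x \<and> rank R x \<ge> 3" if "x \<noteq> a" "x \<noteq> b" for x
  proof -
    have "rank R x \<noteq> 1" "rank R x \<noteq> 2" using that r rank_eq_iff[OF p(1)] by metis+
    moreover have "rank R x \<in> {1..CARD('a)}" using rank_bij[OF p(1)] by (auto simp: bij_betw_def)
    ultimately have k: "rank R x \<in> {3..CARD('a)}" by auto
    then have "ranked (rank R x) R' = x" using R(7) ranked_rank[OF p(1)] by metis
    then show ?thesis using k rank_ranked[OF p(2), of "rank R x"] by auto
  qed
  have "(x, y) \<in> R \<longleftrightarrow> (x, y) \<in> R'" if "{x, y} \<noteq> {a, b}" for x y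
  proof -
    have "rank R x < rank R y \<longleftrightarrow> rank R' x < rank R' y"
      using that r r'[of x] r'[of y] by (cases "x = a"; cases "x = b"; cases "y = a"; cases "y = b") auto
    then show ?thesis using rank_less_iff p by blast
  qed
  then show ?thesis using that R by blast
qed

lemma sym_G: "sym G"
proof (rule symI)
  fix a b assume "(a, b) \<in> G"
  then obtain R R' where "a \<noteq> b" "R \<in> D" "R' \<in> D" "ranked 1 R = a" "ranked 2 R' = a"
    "ranked 1 R' = b" "ranked 2 R = b" "\<forall>k\<in>{3..CARD('a)}. ranked k R' = ranked k R"
    unfolding adj_graph_def adjacent_def by auto
  then show "(b, a) \<in> G" unfolding adj_graph_def adjacent_def by blast
qed

lemma edge_commute: "(a, b) \<in> G \<Longrightarrow> (b, a) \<in> G"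
  using sym_G by (rule symD)

lemma edge_neq: "(a, b) \<in> G \<Longrightarrow> a \<noteq> b"
  by (simp add: adj_graph_def adjacent_def)

lemma G_rtrancl: "(x, y) \<in> G\<^sup>*"
  using conn connected_graph_iff[of G UNIV] by (simp add: path_connected_dom_def)

sublocale separation S
  using separation_sep[OF sym_G G_rtrancl] .

lemma edge_sep: "(x, y) \<in> G \<Longrightarrow> S x u y \<Longrightarrow> u = x \<or> u = y"
  using sep_edge by metis

lemma ex_neighbor: "\<exists>y. (x, y) \<in> G"
proof -
  have "\<exists>y. y \<noteq> x"
  proof (rule ccontr)
    assume "\<not> ?thesis"
    then have "(UNIV :: 'a set) = {x}" by auto
    then have "CARD('a) = card {x}" by simp
    then show False using card3 by simp
  qed
  then obtain y where "y \<noteq> x" by blast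
  then show ?thesis using G_rtrancl[of x y] by (auto elim: converse_rtranclE)
qed

lemma ex_pref: "\<exists>R\<in>D. peak R = x"
proof -
  obtain y where "(x, y) \<in> G" using ex_neighbor by blast
  then show ?thesis by (elim edgeE) blast
qed

section \<open>Hanging sets\<close>

text \<open>A semi-single-peaked part of the domain: \<open>C\<close> is a union of components of \<open>G\<close> without
  \<open>a\<close> on which \<open>G\<close> is a forest.\<close>

definition hung :: "'a set \<Rightarrow> 'a \<Rightarrow> bool" where
  "hung C a \<longleftrightarrow> a \<notin> C \<and> (\<forall>x\<in>C. \<forall>y. y \<notin> C \<longrightarrow> S x a y) \<and>
     (\<forall>u v x. (u, v) \<in> G \<longrightarrow> u \<in> insert a C \<longrightarrow> v \<in> insert a C \<longrightarrow> S x u v \<or> S x v u) \<and>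
     (\<forall>R\<in>D. hangs_in S C a R)"

lemma hungD:
  assumes "hung C a"
  shows "a \<notin> C" "x \<in> C \<Longrightarrow> y \<notin> C \<Longrightarrow> S x a y"
    "(u, v) \<in> G \<Longrightarrow> u \<in> insert a C \<Longrightarrow> v \<in> insert a C \<Longrightarrow> S x u v \<or> S x v u"
    "R \<in> D \<Longrightarrow> peak R \<in> C \<Longrightarrow> S (peak R) u a \<Longrightarrow> S (peak R) u v \<Longrightarrow> u \<noteq> v \<Longrightarrow> (u, v) \<in> R"
    "R \<in> D \<Longrightarrow> peak R \<notin> C \<Longrightarrow> v \<in> C \<Longrightarrow> (a, v) \<in> R"
  using assms unfolding hung_def hangs_in_def by blast+

lemma hungI:
  assumes "a \<notin> C" "\<And>x y. x \<in> C \<Longrightarrow> y \<notin> C \<Longrightarrow> S x a y"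
    "\<And>u v x. (u, v) \<in> G \<Longrightarrow> u \<in> insert a C \<Longrightarrow> v \<in> insert a C \<Longrightarrow> S x u v \<or> S x v u"
    "\<And>R u v. R \<in> D \<Longrightarrow> peak R \<in> C \<Longrightarrow> S (peak R) u a \<Longrightarrow> S (peak R) u v \<Longrightarrow> u \<noteq> v \<Longrightarrow> (u, v) \<in> R"
    "\<And>R v. R \<in> D \<Longrightarrow> peak R \<notin> C \<Longrightarrow> v \<in> C \<Longrightarrow> (a, v) \<in> R"
  shows "hung C a"
  unfolding hung_def hangs_in_def using assms by blast

lemma hung_empty: "hung {} a"
  by (rule hungI) (auto dest: edge_neq)

lemma hung_edge:
  assumes "hung C a" "(u, v) \<in> G" "u \<in> C"
  shows "v \<in> insert a C"
proof (rule ccontr)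
  assume n: "v \<notin> insert a C"
  then have "S u a v" using hungD(2)[OF assms(1,3)] by simp
  then show False using edge_sep[OF assms(2)] n assms(3) hungD(1)[OF assms(1)] by auto
qed

text \<open>The case that needs an argument is a peak in \<open>C - C'\<close>: there
  \<open>a\<close> lies on the way to \<open>C'\<close>, so semi-single-peakedness towards
  \<open>a\<close> already puts \<open>a\<close> above \<open>C'\<close>.\<close>

lemma hung_subset:
  assumes h: "hung C a" and sub: "C' \<subseteq> C" and closed: "\<And>x y. x \<in> C' \<Longrightarrow> y \<notin> C' \<Longrightarrow> S x a y"
  shows "hung C' a"
proof (rule hungI)
  show "a \<notin> C'" using hungD(1)[OF h] sub by blast
  show "S x a y" if "x \<in> C'" "y \<notin> C'" for x y using closed that by blast
  show "S x u v \<or> S x v u" if "(u, v) \<in> G" "u \<in> insert a C'" "v \<in> insert a C'" for u v x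
    using hungD(3)[OF h] that sub by blast
  show "(u, v) \<in> R" if "R \<in> D" "peak R \<in> C'" "S (peak R) u a" "S (peak R) u v" "u \<noteq> v" for R u v
    using hungD(4)[OF h] that sub by blast
  show "(a, v) \<in> R" if "R \<in> D" "peak R \<notin> C'" "v \<in> C'" for R v
  proof (cases "peak R \<in> C")
    case True
    have "S v a (peak R)" using closed that by blast
    then have "S (peak R) a v" by (rule commute)
    moreover have "a \<noteq> v" using that sub hungD(1)[OF h] by blast
    ultimately show ?thesis using hungD(4)[OF h that(1) True right] by blast
  qed (use hungD(5)[OF h] that sub in blast)
qed

lemma hung_Un:
  assumes h: "hung C a" and h': "hung C' a" and disj: "C \<inter> C' = {}"
  shows "hung (C \<union> C') a"
proof (rule hungI)
  show "a \<notin> C \<union> C'" using hungD(1)[OF h] hungD(1)[OF h'] by blast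
  show "S x a y" if "x \<in> C \<union> C'" "y \<notin> C \<union> C'" for x y
    using that hungD(2)[OF h] hungD(2)[OF h'] by blast
  show "S x u v \<or> S x v u" if e: "(u, v) \<in> G" "u \<in> insert a (C \<union> C')" "v \<in> insert a (C \<union> C')" for u v x
  proof -
    have "u \<in> insert a C \<and> v \<in> insert a C \<or> u \<in> insert a C' \<and> v \<in> insert a C'"
      using hung_edge[OF h, of u v] hung_edge[OF h', of u v] hung_edge[OF h, of v u]
        hung_edge[OF h', of v u] e edge_commute by blast
    then show ?thesis using hungD(3)[OF h e(1)] hungD(3)[OF h' e(1)] by blast
  qed
  show "(u, v) \<in> R" if "R \<in> D" "peak R \<in> C \<union> C'" "S (peak R) u a" "S (peak R) u v" "u \<noteq> v" for R u v
    using that hungD(4)[OF h, of R u v] hungD(4)[OF h', of R u v] by blast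
  show "(a, v) \<in> R" if "R \<in> D" "peak R \<notin> C \<union> C'" "v \<in> C \<union> C'" for R v
    using that hungD(5)[OF h, of R v] hungD(5)[OF h', of R v] by blast
qed

text \<open>Here \<open>b\<close> lies in \<open>C\<close> and \<open>a\<close> in \<open>H\<close>.
  From a peak outside \<open>C\<close> the way to \<open>b\<close> leads through \<open>a\<close>,
  so the condition towards \<open>b\<close> contains the one towards \<open>a\<close>. Below, a set
  of the form \<open>-{x}\<close> hung on \<open>x\<close> is called a center \<open>x\<close>; this
  lemma moves centers and produces them.\<close>

lemma hung_cover:
  assumes h: "hung C a" and k: "hung H b" and cover: "C \<union> H = UNIV"
  shows "hung (-{a}) a"
proof (rule hungI)
  have a: "a \<in> H" "a \<notin> C" and b: "b \<in> C" "b \<notin> H" using hungD(1)[OF h] hungD(1)[OF k] cover by auto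
  show "S x u v \<or> S x v u" if e: "(u, v) \<in> G" "u \<in> insert a (-{a})" "v \<in> insert a (-{a})" for u v x
  proof -
    have "u \<in> insert a C \<and> v \<in> insert a C \<or> u \<in> insert b H \<and> v \<in> insert b H"
      using hung_edge[OF h, of u v] hung_edge[OF k, of u v] hung_edge[OF h, of v u]
        hung_edge[OF k, of v u] e(1) edge_commute[OF e(1)] cover by blast
    then show ?thesis using hungD(3)[OF h e(1)] hungD(3)[OF k e(1)] by blast
  qed
  show "(a, v) \<in> R" if "R \<in> D" "peak R \<notin> - {a}" "v \<in> - {a}" for R v
    using peak_best[OF that(1), of v] that by auto
  show "(u, v) \<in> R" if R: "R \<in> D" "peak R \<in> - {a}" and s: "S (peak R) u a" "S (peak R) u v" "u \<noteq> v" for R u v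
  proof (cases "peak R \<in> C")
    case True
    then show ?thesis using hungD(4)[OF h R(1)] s by blast
  next
    case False
    then have 1: "peak R \<in> H" using cover by auto
    have ba: "S (peak R) a b" using hungD(2)[OF h b(1) False] commute by blast
    have "S (peak R) u b" using trans_outer[OF ba s(1)] .
    then show ?thesis using hungD(4)[OF k R(1) 1] s by blast
  qed
qed auto

text \<open>A zone consisting of \<open>a\<close> and \<open>b\<close> alone is degenerate:
  \<open>b\<close> together with \<open>C'\<close> hangs on \<open>a\<close>, and so does everything
  else. This is what forces a third vertex into the zone of a hybrid rule.\<close>

lemma hung_two:
  assumes h: "hung C a" and k: "hung C' b" and ab: "a \<noteq> b" "a \<notin> C'" "b \<notin> C" "C \<inter> C' = {}"
    and cover: "insert a (insert b (C \<union> C')) = UNIV"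
  shows "hung (-{a}) a"
proof -
  let ?B = "insert b C'"
  have cov: "x = a \<or> x = b \<or> x \<in> C \<or> x \<in> C'" for x using cover by blast
  have "hung ?B a"
  proof (rule hungI)
    show "a \<notin> ?B" using ab by auto
    show "S x a y" if "x \<in> ?B" "y \<notin> ?B" for x y
    proof (cases "y = a")
      case False
      then have "y \<in> C" using that cov[of y] by blast
      then show ?thesis using hungD(2)[OF h, of y x] that ab commute by blast
    qed simp
    have ba: "S x b a" if "x \<in> C'" for x using hungD(2)[OF k that ab(2)] .
    have ca: "S x a y" if "x \<in> C" "y \<in> ?B" for x y using hungD(2)[OF h that(1), of y] that ab by blast
    show "S x u v \<or> S x v u" if e: "(u, v) \<in> G" "u \<in> insert a ?B" "v \<in> insert a ?B" for u v x
    proof -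
      consider "u \<in> ?B" "v \<in> ?B" | "u = a" "v = b" | "u = b" "v = a"
        using hung_edge[OF k, of u v] hung_edge[OF k, of v u] e edge_commute[OF e(1)] edge_neq[OF e(1)] ab
        by blast
      then show ?thesis
      proof cases
        case 1
        then show ?thesis using hungD(3)[OF k e(1)] by blast
      next
        case 2
        then show ?thesis using ba[of x] ca[of x b] cov[of x] left[of a b] left[of b a] by auto
      next
        case 3
        then show ?thesis using ba[of x] ca[of x b] cov[of x] left[of a b] left[of b a] by auto
      qed
    qed
    show "(a, v) \<in> R" if R: "R \<in> D" "peak R \<notin> ?B" "v \<in> ?B" for R v
    proof (cases "peak R = a")
      case True
      then show ?thesis using peak_best[OF R(1), of v] R ab by auto
    next
      case False
      then have "peak R \<in> C" using R cov[of "peak R"] by blast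
      moreover have "a \<noteq> v" using R ab by blast
      ultimately show ?thesis using hungD(4)[OF h R(1) _ right, of v] ca[of "peak R" v] R by blast
    qed
    show "(u, v) \<in> R" if R: "R \<in> D" "peak R \<in> ?B" and s: "S (peak R) u a" "S (peak R) u v" "u \<noteq> v" for R u v
    proof (cases "u = a")
      case True
      have pb: "S (peak R) b a" using R(2) ba[of "peak R"] by auto
      \<comment> \<open>Outside \<open>C\<close>, \<open>v\<close> would be \<open>b\<close> or
        separated from \<open>a\<close> by \<open>b\<close>, and could not lie behind
        \<open>a\<close>.\<close>
      have "v \<in> C"
      proof (rule ccontr)
        assume "v \<notin> C"
        then have v: "v \<in> ?B" using cov[of v] s True by blast
        then have "S v b a" using ba[of v] by auto
        have "S (peak R) a b \<or> S b a v" using split[OF s(2), of b] True by blast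
        then show False
          using antisym[of "peak R" a b] antisym[of v a b] pb \<open>S v b a\<close> ab commute[of b a v] by blast
      qed
      then show ?thesis using hungD(5)[OF h R(1)] True R ab by auto
    next
      case False
      \<comment> \<open>No third vertex lies between \<open>a\<close> and \<open>b\<close>, since
        every other vertex hangs on one of them.\<close>
      have "S (peak R) u b"
      proof (rule ccontr)
        assume n: "\<not> ?thesis"
        then have bua: "S b u a" using split[OF s(1), of b] by blast
        have ub: "u \<noteq> b" using n by auto
        moreover have "u \<notin> C"
          using ca[of u b] antisym[OF bua] False commute[of u a b] by blast
        moreover have "u \<notin> C'"
          using ba[of u] antisym[OF commute[OF bua]] ub commute[of u b a] by blast
        ultimately show False using False cov[of u] by blast
      qed
      then show ?thesis
        using hungD(4)[OF k R(1) _ _ s(2,3)] refl_eq[of b u] peak_best[OF R(1), of v] R(2) s(3)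
        by (cases "peak R = b") auto
    qed
  qed
  moreover have "C \<inter> ?B = {}" using ab by auto
  moreover have "C \<union> ?B = -{a}" using cov ab hungD(1)[OF h] by blast
  ultimately show ?thesis using hung_Un[OF h, of ?B] by simp
qed

text \<open>If both peaks were outside \<open>C\<close>, both reversed preferences would rank
  \<open>a\<close> above each vertex of \<open>C\<close>.\<close>

lemma hung_nonempty:
  assumes "hung C a" "C \<noteq> {}" "Rlo \<in> D" "Rhi \<in> D" "completely_reversed Rlo Rhi"
  shows "peak Rlo \<in> C \<or> peak Rhi \<in> C"
proof (rule ccontr)
  assume "\<not> ?thesis"
  moreover obtain v where "v \<in> C" using assms by blast
  ultimately have "(a, v) \<in> Rlo" "(a, v) \<in> Rhi" "a \<noteq> v" using hungD(5,1)[OF assms(1)] assms by auto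
  then show False using completely_reversed_eqI[OF assms(5) pref[OF assms(4)], of a v] by blast
qed

lemma hung_tree:
  assumes "hung (-{x}) x"
  shows "tree UNIV G"
proof -
  have "S z u v \<or> S z v u" if "(u, v) \<in> G" for u v z
    using hungD(3)[OF assms that] by auto
  then show ?thesis unfolding tree_iff_sep simple_graph_def
    using conn sym_G edge_neq by (auto simp: path_connected_dom_def irrefl_on_def) blast
qed

lemma hung_ssp:
  assumes "hung (-{x}) x" "R \<in> D"
  shows "semi_single_peaked G x R"
  using assms unfolding ssp_iff_hangs_in[OF hung_tree[OF assms(1)] pref[OF assms(2)]]
  by (simp add: hung_def)

lemma hung_ssp_domain:
  assumes "hung (-{x}) x"
  shows "ssp_domain D"
  unfolding ssp_domain_def ssp_prefs_def
  using hung_tree[OF assms] hung_ssp[OF assms] pref conn by (auto simp: path_connected_dom_def)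

end

section \<open>Hanging parts in trees and in the adjacency graph\<close>

context path_connected_domain
begin

text \<open>The edges of \<open>T\<close> need not be edges of \<open>G\<close>, but on the side
  \<open>X\<close> both betweenness relations coincide. An edge of \<open>G\<close> from
  \<open>u\<close> to \<open>v\<close> carries a preference with \<open>u\<close> first and
  \<open>v\<close> second, whereas hanging would rank a vertex strictly between them in
  \<open>T\<close> above \<open>v\<close>.\<close>

lemma hung_of_tree:
  assumes T: "tree UNIV T" and ab: "a \<noteq> b" and X: "X = {z. sep T z a b}"
    and hang: "\<And>R. R \<in> D \<Longrightarrow> hangs_in (sep T) (X - {a}) a R"
  shows "hung (X - {a}) a"
proof -
  interpret t: separation "sep T" using tree_separation[OF T] .
  have inX: "x \<in> X \<longleftrightarrow> sep T x a b" for x by (simp add: X)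
  have cross: "sep T x a y" if "x \<in> X" "y \<notin> X" for x y
    using t.split[of x a b y] t.commute that inX by blast
  have cvx: "m \<in> X" if "sep T x m y" "x \<in> X" "y \<in> X" for x m y
  proof (rule ccontr)
    assume n: "m \<notin> X"
    then have "sep T x a m" "sep T y a m" using cross that by blast+
    then have "sep T a m y" using t.trans_inner[OF that(1)] by blast
    then have "m = a" using \<open>sep T y a m\<close> t.antisym[of y a m] t.commute[of a m y] by blast
    then show False using n inX by simp
  qed
  have hang1: "(u, v) \<in> R" if "R \<in> D" "peak R \<in> X" "sep T (peak R) u a" "sep T (peak R) u v" "u \<noteq> v" for R u v
  proof (cases "peak R = a")
    case True
    then have "u = peak R" using t.refl_eq that(3) by simp
    then show ?thesis using peak_best[OF that(1), of v] that(5) by simp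
  next
    case False
    then show ?thesis using hang[OF that(1)] that unfolding hangs_in_def by blast
  qed
  \<comment> \<open>A preference with peak \<open>x\<close> and second \<open>y\<close> would have
    to rank \<open>a\<close> above \<open>y\<close>.\<close>
  have leave: False if e: "(x, y) \<in> G" and x: "x \<in> X - {a}" and y: "y \<notin> X" for x y
  proof -
    obtain R where R: "R \<in> D" "peak R = x" "ranked 2 R = y" using e by (elim edgeE)
    have ay: "a \<noteq> y" using y inX by auto
    have "(a, y) \<in> R" using hang1[OF R(1), of a y] cross[of x y] x y ay R(2) by simp
    moreover have "(y, a) \<in> R" using second_best[OF R(1), of a] R x ay by auto
    ultimately show False using preferenceD(4)[OF pref[OF R(1)]] by blast
  qed
  have sepa: "S x a y" if x: "x \<in> X - {a}" and y: "y \<notin> X - {a}" for x y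
  proof (rule ccontr)
    assume "\<not> S x a y"
    then have n: "y \<noteq> a" "(x, y) \<in> (Restr G (-{a}))\<^sup>*" by (auto simp: sep_def)
    have "z \<in> X - {a}" if "(x, z) \<in> (Restr G (-{a}))\<^sup>*" for z
      using that
    proof induction
      case (step z w)
      then show ?case using leave[of z w] by blast
    qed (use x in simp)
    then show False using n y by blast
  qed
  have edge: "w = u \<or> w = v" if e: "(u, v) \<in> G" and u: "u \<in> X" and v: "v \<in> X" and w: "sep T u w v" for u v w
  proof -
    \<comment> \<open>If \<open>w\<close> is also on the way to \<open>a\<close>, hanging puts it
      above \<open>v\<close>, yet \<open>v\<close> is second.\<close>
    have nearer: "w = v" if "(u, v) \<in> G" "u \<in> X" "sep T u w a" "sep T u w v" "w \<noteq> u" for u v w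
    proof (rule ccontr)
      assume n: "w \<noteq> v"
      note uv = that(1)
      obtain R where R: "R \<in> D" "peak R = u" "ranked 2 R = v" using uv by (elim edgeE)
      have "(w, v) \<in> R" using hang1[OF R(1), of w v] that R(2) n by simp
      moreover have "(v, w) \<in> R" using second_best[OF R(1), of w] R that n by auto
      ultimately show False using preferenceD(4)[OF pref[OF R(1)]] by blast
    qed
    obtain m where m: "sep T u m v" "sep T u m a" "sep T v m a" using tree_median[OF T] by blast
    \<comment> \<open>So one end of the edge lies on the way from the other end to \<open>a\<close>,
      and whatever is between the ends is on that way too.\<close>
    have "m = u \<or> m = v" using nearer[OF e u m(2,1)] by blast
    then show ?thesis
    proof
      assume "m = v"
      then have "sep T u w a" using t.trans_outer[OF m(2)] w by simp
      then show ?thesis using nearer[OF e u _ w] by blast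
    next
      assume "m = u"
      then have "sep T v w a" using t.trans_outer[OF m(3)] t.commute[OF w] by simp
      then show ?thesis using nearer[OF edge_commute[OF e] v _ t.commute[OF w]] by blast
    qed
  qed
  have T_G: "S x u v" if x: "x \<in> X" and v: "v \<in> X" and s: "sep T x u v" for x u v
  proof (rule ccontr)
    assume "\<not> S x u v"
    then have n: "x \<noteq> u" "v \<noteq> u" "(x, v) \<in> (Restr G (-{u}))\<^sup>*" by (auto simp: sep_def)
    \<comment> \<open>A walk may leave \<open>X\<close>, but only through \<open>a\<close>; during
      such an excursion the invariant is kept for \<open>a\<close> in place of the current
      vertex.\<close>
    have "(z \<in> X \<and> \<not> sep T x u z) \<or> (z \<notin> X \<and> u \<noteq> a \<and> \<not> sep T x u a)"
      if "(x, z) \<in> (Restr G (-{u}))\<^sup>*" for z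
      using that
    proof induction
      case base
      then show ?case using x t.refl_eq[of x u] n(1) by blast
    next
      case (step z w)
      then have e: "(z, w) \<in> G" "z \<noteq> u" "w \<noteq> u" by auto
      consider "z \<in> X" "w \<in> X" | "z \<in> X" "w \<notin> X" | "z \<notin> X" "w \<in> X" | "z \<notin> X" "w \<notin> X" by blast
      then show ?case
      proof cases
        case 1
        then have "\<not> sep T z u w" using edge[OF e(1)] e by blast
        then show ?thesis using step.IH 1 t.split[of x u w z] by blast
      next
        case 2
        then have "z = a" using leave[OF e(1)] by blast
        then show ?thesis using step.IH 2 e by blast
      next
        case 3
        then have "w = a" using leave[OF edge_commute[OF e(1)]] by blast
        then show ?thesis using step.IH 3 by blast
      qed (use step.IH in blast)
    qed
    then show False using n v s by blast
  qed
  \<comment> \<open>The median in \<open>T\<close> of \<open>x\<close>, \<open>y\<close> and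
    \<open>u\<close> separates in \<open>G\<close> as well; as \<open>u\<close> separates
    \<open>x\<close> from \<open>y\<close> in \<open>G\<close>, antisymmetry identifies it with
    \<open>u\<close>.\<close>
  have G_T: "sep T x u y" if x: "x \<in> X" and u: "u \<in> X" and y: "y \<in> X" and s: "S x u y" for x u y
  proof -
    obtain m where m: "sep T x m y" "sep T x m u" "sep T y m u" using tree_median[OF T] by blast
    have s': "S x m u" "S y m u" using T_G m x u y by blast+
    have "m = u" using split[OF s, of m] antisym[OF s'(1)] antisym[OF s'(2)] commute[of m u y] by blast
    then show ?thesis using m by simp
  qed
  show ?thesis
  proof (rule hungI)
    show "S x a y" if "x \<in> X - {a}" "y \<notin> X - {a}" for x y using sepa that by blast
    show "S x u v \<or> S x v u" if e: "(u, v) \<in> G" "u \<in> insert a (X - {a})" "v \<in> insert a (X - {a})" for u v x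
    proof -
      have aX: "a \<in> X" using inX by simp
      have uv: "u \<in> X" "v \<in> X" using e(2,3) aX by blast+
      have *: "S z u v \<or> S z v u" if z: "z \<in> X" for z
      proof -
        obtain m where m: "sep T u m v" "sep T u m z" "sep T v m z" using tree_median[OF T] by blast
        have "m = u \<or> m = v" using edge[OF e(1) uv m(1)] .
        then have "sep T z u v \<or> sep T z v u" using m(2,3) t.commute[of v m z] t.commute[of u m z] by auto
        then show ?thesis using T_G[OF z uv(1)] T_G[OF z uv(2)] by auto
      qed
      have **: "S x u v" if s: "S a u v" and x: "x \<notin> X" and uv: "u \<in> X" "v \<in> X" for u v
      proof -
        consider "S a u x" | "S x u v" using split[OF s] by blast
        then show ?thesis
        proof cases
          case 1
          show ?thesis
          proof (cases "u = a")
            case True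
            show ?thesis
            proof (cases "v = a")
              case False
              then have "S v a x" using sepa[of v x] uv x by simp
              then show ?thesis using True commute by blast
            qed (use True in simp)
          next
            case False
            then have "S x a u" using sepa[of u x] uv x commute by simp
            then show ?thesis using False antisym[OF commute[OF 1]] by blast
          qed
        qed
      qed
      show ?thesis
      proof (cases "x \<in> X")
        case False
        then show ?thesis using *[OF aX] **[of u v] **[of v u] uv by blast
      qed (use * in blast)
    qed
    show "(u, v) \<in> R" if R: "R \<in> D" "peak R \<in> X - {a}" and s: "S (peak R) u a" "S (peak R) u v" "u \<noteq> v" for R u v
    proof -
      have aX: "a \<in> X" using inX by simp
      have x: "peak R \<in> X" using R by simp
      have u: "u \<in> X"
      proof (rule ccontr)
        assume n: "u \<notin> X"
        then have "S (peak R) a u" using sepa[of "peak R" u] R by blast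
        then have "u = a" using antisym[OF s(1)] by blast
        then show False using n aX by simp
      qed
      have ua: "sep T (peak R) u a" using G_T[OF x u aX s(1)] .
      have "sep T (peak R) u v"
      proof (cases "v \<in> X")
        case True
        then show ?thesis using G_T[OF x u _ s(2)] by blast
      next
        case False
        then show ?thesis using t.trans_outer[OF cross[OF x False] ua] by blast
      qed
      then show ?thesis using hang1[OF R(1) x ua] s by blast
    qed
    show "(a, v) \<in> R" if "R \<in> D" "peak R \<notin> X - {a}" "v \<in> X - {a}" for R v
      using hang[OF that(1)] that unfolding hangs_in_def by blast
  qed simp
qed

text \<open>The tree-free content of semi-hybridness: \<open>M\<close> is a candidate for the free
  zone, with the two parts hung on its ends. Candidates arising from different trees become
  comparable.\<close>

definition zone :: "'a set \<Rightarrow> 'a \<Rightarrow> 'a set \<Rightarrow> 'a \<Rightarrow> 'a set \<Rightarrow> bool" where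
  "zone C a C' b M \<longleftrightarrow> hung C a \<and> hung C' b \<and> a \<noteq> b \<and> a \<notin> C' \<and> b \<notin> C \<and> C \<inter> C' = {} \<and> M = -(C \<union> C')"

lemma zone_commute: "zone C a C' b M \<Longrightarrow> zone C' b C a M"
  unfolding zone_def by blast

lemma zone_of_sh:
  assumes T: "tree UNIV T" and dt: "dual_thresholds T a b" and sub: "D \<subseteq> sh_prefs T a b"
  shows "zone (beyond T a b - {a}) a (beyond T b a - {b}) b (path_set T a b)"
proof -
  interpret t: separation "sep T" using tree_separation[OF T] .
  have ab: "a \<noteq> b" and cover: "\<And>c. sep T a c b \<or> sep T c a b \<or> sep T c b a"
    using dt dual_thresholds_iff[OF T] by auto
  have hang: "hangs_in (sep T) (beyond T a b - {a}) a R" "hangs_in (sep T) (beyond T b a - {b}) b R"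
    if "R \<in> D" for R
    using that sub semi_hybrid_iff[OF T dt pref[OF that]] unfolding sh_prefs_def by auto
  have "hung (beyond T a b - {a}) a" "hung (beyond T b a - {b}) b"
    using hung_of_tree[OF T _ beyond_iff[OF T]] ab hang by auto
  moreover have disj: "\<not> (z \<in> beyond T a b \<and> z \<in> beyond T b a)" for z
    unfolding beyond_iff[OF T] using t.antisym[of z a b] ab by auto
  moreover have "z \<in> path_set T a b \<longleftrightarrow> z \<notin> beyond T a b - {a} \<and> z \<notin> beyond T b a - {b}" for z
  proof -
    have "sep T a z b \<Longrightarrow> sep T z a b \<Longrightarrow> z = a" using t.antisym[of b z a] t.commute by blast
    moreover have "sep T a z b \<Longrightarrow> sep T z b a \<Longrightarrow> z = b" using t.antisym[of a z b] t.commute by blast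
    ultimately show ?thesis
      unfolding tree_path_set[OF T] beyond_iff[OF T] using cover[of z] by auto
  qed
  moreover have "a \<in> beyond T a b" "b \<in> beyond T b a" by (simp_all add: beyond_iff[OF T])
  ultimately show ?thesis using ab unfolding zone_def by blast
qed

text \<open>The converse: hang the two semi-single-peaked parts of \<open>G\<close> on an arbitrary line through
  the zone.\<close>

lemma hung_glue:
  assumes h: "hung C a"
  shows "G = Restr G (insert a C) \<union> Restr G (-C)" "insert a C \<inter> -C = {a}"
proof -
  show "insert a C \<inter> -C = {a}" using hungD(1)[OF h] by blast
  show "G = Restr G (insert a C) \<union> Restr G (-C)"
    using hung_edge[OF h] edge_commute by fast
qed

lemma hung_sep:
  assumes h: "hung C a" and xy: "x \<in> insert a C" "y \<in> insert a C"
  shows "sep (Restr G (insert a C)) x u y \<longleftrightarrow> S x u y"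
proof -
  have "sep (Restr G (insert a C) \<union> Restr G (-C)) x u y \<longleftrightarrow> sep (Restr G (insert a C)) x u y"
    by (rule glue_sep_left[OF _ _ hung_glue(2)[OF h] xy]) auto
  then show ?thesis using hung_glue(1)[OF h] by simp
qed

lemma hung_subgraph_tree:
  assumes h: "hung C a"
  shows "tree (insert a C) (Restr G (insert a C))"
proof -
  let ?V = "insert a C"
  have "(x, y) \<in> (Restr G ?V)\<^sup>*" if "x \<in> ?V" "y \<in> ?V" for x y
  proof -
    have "(x, y) \<in> (Restr (Restr G ?V \<union> Restr G (-C)) UNIV)\<^sup>*"
      using G_rtrancl hung_glue(1)[OF h] by simp
    then have "(x, y) \<in> (Restr (Restr G ?V) UNIV)\<^sup>*"
      using glue_reach[OF _ _ hung_glue(2)[OF h] that(1)] that(2) by blast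
    then show ?thesis by simp
  qed
  then have "connected_graph ?V (Restr G ?V)" by (subst connected_graph_iff) auto
  moreover have "simple_graph ?V (Restr G ?V)"
    using sym_G edge_neq by (auto simp: simple_graph_def sym_def irrefl_on_def)
  moreover have "sep (Restr G ?V) x u v \<or> sep (Restr G ?V) x v u"
    if "(u, v) \<in> Restr G ?V" "x \<in> ?V" for u v x
    using that hungD(3)[OF h, of u v x] hung_sep[OF h] by auto
  ultimately show ?thesis unfolding tree_iff_sep by blast
qed

text \<open>Any tree that continues the hanging part outside \<open>C\<close> inherits its
  separation and its preferences. In the projection clause, a vertex \<open>y\<close> outside
  \<open>C\<close> is cut off by \<open>a\<close> in both graphs, so the median is \<open>a\<close>
  there.\<close>

lemma hung_extend:
  assumes h: "hung C a" and E: "E \<subseteq> (-C) \<times> (-C)" "sym E" and T: "T = Restr G (insert a C) \<union> E"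
    and tree: "tree UNIV T"
  shows "x \<in> insert a C \<Longrightarrow> y \<in> insert a C \<Longrightarrow> sep T x u y \<longleftrightarrow> S x u y"
    and "x \<in> insert a C \<Longrightarrow> y \<notin> C \<Longrightarrow> sep T x a y"
    and "R \<in> D \<Longrightarrow> hangs_in (sep T) C a R"
    and "x \<in> insert a C \<Longrightarrow> S x m y \<Longrightarrow> S x m a \<Longrightarrow> S y m a \<Longrightarrow> proj T (path_set T x y) a = m"
proof -
  interpret t: separation "sep T" using tree_separation[OF tree] .
  have sub: "Restr G (insert a C) \<subseteq> insert a C \<times> insert a C" by auto
  have symV: "sym (Restr G (insert a C))" using sym_G by (auto simp: sym_def)
  have 1: "sep T x u y \<longleftrightarrow> S x u y" if "x \<in> insert a C" "y \<in> insert a C" for x u y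
    unfolding T using glue_sep_left[OF sub E(1) hung_glue(2)[OF h] that] hung_sep[OF h that] by simp
  have 2: "sep T x a y" if "x \<in> insert a C" "y \<notin> C" for x y
    unfolding T using glue_sep_cross[OF sub E(1) hung_glue(2)[OF h] symV E(2) that(1)] that by simp
  show "x \<in> insert a C \<Longrightarrow> y \<in> insert a C \<Longrightarrow> sep T x u y \<longleftrightarrow> S x u y" using 1 .
  show "x \<in> insert a C \<Longrightarrow> y \<notin> C \<Longrightarrow> sep T x a y" using 2 .
  show "hangs_in (sep T) C a R" if R: "R \<in> D"
  proof -
    have "(u, v) \<in> R" if x: "peak R \<in> C" and s: "sep T (peak R) u a" "sep T (peak R) u v" "u \<noteq> v" for u v
    proof -
      have ua: "S (peak R) u a" using 1 s x by blast
      have "S (peak R) u v"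
      proof (cases "v \<in> C")
        case True
        then show ?thesis using 1 s x by blast
      next
        case False
        then show ?thesis using trans_outer[OF hungD(2)[OF h x False] ua] by blast
      qed
      then show ?thesis using hungD(4)[OF h R x ua] s by blast
    qed
    then show ?thesis unfolding hangs_in_def using hungD(5)[OF h R] by blast
  qed
  show "proj T (path_set T x y) a = m" if x: "x \<in> insert a C" and m: "S x m y" "S x m a" "S y m a"
  proof (rule proj_path_set[OF tree])
    have xa: "sep T x m a" using 1 x m by blast
    have "sep T x m y \<and> sep T y m a"
    proof (cases "y \<in> C")
      case True
      then show ?thesis using 1 x m by blast
    next
      case False
      have "S x a y"
      proof (cases "x = a")
        case False
        then show ?thesis using x hungD(2)[OF h, of x y] \<open>y \<notin> C\<close> by blast
      qed simp
      then have "m = a" using median_unique[of x m y a a] m by auto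
      then show ?thesis using 2[OF x False] by simp
    qed
    then show "sep T x m y" "sep T x m a" "sep T y m a" using xa by auto
  qed
qed

text \<open>The two final clauses record more than semi-hybridness: they translate medians in
  \<open>G\<close> into projections in the tree, which is how a rule is later recognized as
  hybrid.\<close>

lemma sh_of_zone:
  assumes z: "zone C a C' b M"
  shows "\<exists>T. tree UNIV T \<and> dual_thresholds T a b \<and> D \<subseteq> sh_prefs T a b \<and> path_set T a b = M \<and>
    beyond T a b = insert a C \<and> beyond T b a = insert b C' \<and>
    (\<forall>x y m. x \<in> insert a C \<longrightarrow> S x m y \<longrightarrow> S x m a \<longrightarrow> S y m a \<longrightarrow> proj T (path_set T x y) a = m) \<and>
    (\<forall>x y m. x \<in> insert b C' \<longrightarrow> S x m y \<longrightarrow> S x m b \<longrightarrow> S y m b \<longrightarrow> proj T (path_set T x y) b = m)"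
proof -
  have h: "hung C a" and k: "hung C' b" and ab: "a \<noteq> b" "a \<notin> C'" "b \<notin> C" "C \<inter> C' = {}" and M: "M = -(C \<union> C')"
    using z unfolding zone_def by auto
  have aM: "a \<in> M" "b \<in> M" using hungD(1)[OF h] hungD(1)[OF k] ab M by auto
  \<comment> \<open>Semi-hybridness leaves the order inside the zone free, so any enumeration
    starting in \<open>a\<close> and ending in \<open>b\<close> gives a line.\<close>
  obtain ms where ms: "set ms = M - {a, b}" "distinct ms" using finite_distinct_list[of "M - {a, b}"] by auto
  define line where "line = a # ms @ [b]"
  have line: "set line = M" "line \<noteq> []" "distinct line" "hd line = a" "last line = b"
    using ms aM ab by (auto simp: line_def)
  obtain L where L: "tree M L" "\<And>u. u \<in> M \<Longrightarrow> sep L a u b" using line_tree[OF line(2,3)] line by auto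
  let ?A = "Restr G (insert a C)" and ?B = "Restr G (insert b C')"
  define T where "T = ?A \<union> (L \<union> ?B)"
  have TB: "tree (M \<union> insert b C') (L \<union> ?B)"
    using glue_tree[OF L(1) hung_subgraph_tree[OF k], of b] aM M by auto
  have TA: "tree (M \<union> insert a C) (L \<union> ?A)"
    using glue_tree[OF L(1) hung_subgraph_tree[OF h], of a] aM M by auto
  have V: "M \<union> insert b C' = -C" "M \<union> insert a C = -C'"
    using M ab hungD(1)[OF h] hungD(1)[OF k] by auto
  have "tree (insert a C \<union> -C) T"
    using glue_tree[OF hung_subgraph_tree[OF h] TB[unfolded V] hung_glue(2)[OF h]] unfolding T_def .
  moreover have "insert a C \<union> -C = UNIV" by blast
  ultimately have T: "tree UNIV T" by simp
  interpret t: separation "sep T" using tree_separation[OF T] .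
  \<comment> \<open>The same tree decomposed at the end \<open>b\<close>.\<close>
  have T': "T = ?B \<union> (L \<union> ?A)" unfolding T_def by blast
  note extA = hung_extend[OF h tree_subset[OF TB[unfolded V]] tree_sym[OF TB] T_def T]
  note extB = hung_extend[OF k tree_subset[OF TA[unfolded V]] tree_sym[OF TA] T' T]
  have line_sep: "sep T a u b" if "u \<in> M" for u
  proof -
    have MB: "M \<inter> insert b C' = {b}" using M aM by auto
    have "sep (L \<union> ?B) a u b"
      using glue_sep_left[OF tree_subset[OF L(1)] tree_subset[OF hung_subgraph_tree[OF k]] MB aM] L(2)[OF that]
      by blast
    moreover have "sep ((L \<union> ?B) \<union> ?A) a u b \<longleftrightarrow> sep (L \<union> ?B) a u b"
    proof (rule glue_sep_left[OF tree_subset[OF TB[unfolded V]] tree_subset[OF hung_subgraph_tree[OF h]]])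
      show "- C \<inter> insert a C = {a}" using hung_glue(2)[OF h] by blast
    qed (use hungD(1)[OF h] ab in auto)
    ultimately show ?thesis unfolding T_def by (simp add: Un_commute)
  qed
  have sa: "sep T x a b" if "x \<in> insert a C" for x using extA(2)[OF that] ab by blast
  have sb: "sep T x b a" if "x \<in> insert b C'" for x using extB(2)[OF that] ab by blast
  have cov: "z \<in> C \<or> z \<in> C' \<or> z \<in> M" for z using M by blast
  have ba: "beyond T a b = insert a C"
  proof -
    have "z \<in> insert a C" if s: "sep T z a b" for z
    proof -
      have "z \<notin> C'" using sb[of z] t.antisym[OF s] ab by blast
      moreover have "z \<in> M \<Longrightarrow> z = a" using line_sep[of z] t.antisym[of b z a] t.commute s by blast
      ultimately show ?thesis using cov[of z] by blast
    qed
    then show ?thesis unfolding beyond_iff[OF T] using sa by blast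
  qed
  have bb: "beyond T b a = insert b C'"
  proof -
    have "z \<in> insert b C'" if s: "sep T z b a" for z
    proof -
      have "z \<notin> C" using sa[of z] t.antisym[OF s] ab by blast
      moreover have "z \<in> M \<Longrightarrow> z = b" using line_sep[of z] t.antisym[of a z b] t.commute s by blast
      ultimately show ?thesis using cov[of z] by blast
    qed
    then show ?thesis unfolding beyond_iff[OF T] using sb by blast
  qed
  have dt: "dual_thresholds T a b"
    unfolding dual_thresholds_iff[OF T] using ab(1) cov line_sep sa sb by blast
  have "D \<subseteq> sh_prefs T a b"
  proof
    fix R assume R: "R \<in> D"
    have "insert a C - {a} = C" "insert b C' - {b} = C'" using hungD(1)[OF h] hungD(1)[OF k] by auto
    then show "R \<in> sh_prefs T a b"
      unfolding sh_prefs_def using semi_hybrid_iff[OF T dt pref[OF R]] extA(3)[OF R] extB(3)[OF R] pref[OF R]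
      unfolding ba bb by simp
  qed
  moreover have "path_set T a b = M"
  proof -
    have "z \<notin> C" "z \<notin> C'" if s: "sep T a z b" for z
      using sa[of z] sb[of z] t.antisym[of b z a] t.antisym[OF s] t.commute s hungD(1)[OF h] hungD(1)[OF k] ab
      by blast+
    then show ?thesis unfolding tree_path_set[OF T] using line_sep cov by blast
  qed
  ultimately show ?thesis using T dt ba bb extA(4) extB(4) by blast
qed

end

section \<open>Two-voter tops-only strategy-proof rules\<close>

context path_connected_domain
begin

text \<open>\<open>g\<close> is the outcome as a function of one voter's preference. By
  strategy-proofness in both directions the two preferences disagree on the pair of outcomes, and
  the swapped pair is the only one on which they can.\<close>

lemma swap_step:
  assumes sp: "\<And>R R'. R \<in> D \<Longrightarrow> R' \<in> D \<Longrightarrow> g R = g R' \<or> (g R, g R') \<in> R"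
    and R: "R \<in> D" "R' \<in> D" "peak R = x" "peak R' = x'"
      "\<And>a b. {a, b} \<noteq> {x, x'} \<Longrightarrow> (a, b) \<in> R \<longleftrightarrow> (a, b) \<in> R'"
    and neq: "g R \<noteq> g R'"
  shows "g R = x \<and> g R' = x'"
proof -
  have 1: "(g R, g R') \<in> R" "(g R', g R) \<in> R'" using sp[OF R(1,2)] sp[OF R(2,1)] neq by auto
  have "{g R, g R'} = {x, x'}"
  proof (rule ccontr)
    assume "\<not> ?thesis"
    then have "(g R, g R') \<in> R'" using R(5) 1 by blast
    then show False using 1 preferenceD(4)[OF pref[OF R(2)]] by blast
  qed
  moreover have "g R' \<noteq> x" using 1 peak_unbeaten[OF pref[OF R(1)]] R(3) by auto
  ultimately show ?thesis by (auto simp: doubleton_eq_iff)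
qed

text \<open>Along a walk avoiding \<open>g x\<close> the outcome stays \<open>g x\<close>: a step
  could change it only if it were the peak being left, and that vertex is never
  \<open>g x\<close>.\<close>

lemma change_sep:
  assumes sp: "\<And>R x'. R \<in> D \<Longrightarrow> g (peak R) = g x' \<or> (g (peak R), g x') \<in> R"
    and neq: "g x \<noteq> g x'"
  shows "S x (g x) x'"
proof (rule ccontr)
  assume "\<not> ?thesis"
  then have n: "(x, x') \<in> (Restr G (-{g x}))\<^sup>*" by (auto simp: sep_def)
  have "g z = g x" if "(x, z) \<in> (Restr G (-{g x}))\<^sup>*" for z
    using that
  proof induction
    case (step z w)
    then have e: "(z, w) \<in> G" "z \<noteq> g x" by auto
    obtain R R' where R: "R \<in> D" "R' \<in> D" "peak R = z" "peak R' = w"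
      "\<And>a b. {a, b} \<noteq> {z, w} \<Longrightarrow> (a, b) \<in> R \<longleftrightarrow> (a, b) \<in> R'" using e(1) by (elim edgeE) blast
    have "g w = g z"
    proof (rule ccontr)
      assume n: "g w \<noteq> g z"
      have "g (peak R) = z \<and> g (peak R') = w"
      proof (rule swap_step)
        show "g (peak R) = g (peak R') \<or> (g (peak R), g (peak R')) \<in> R" if "R \<in> D" for R R'
          using sp that .
      qed (use R n in auto)
      then show False using step.IH e(2) R(3) by simp
    qed
    then show ?case using step.IH by simp
  qed simp
  then show False using n neq by metis
qed

end

locale two_voter_tops_rule = path_connected_domain +
  fixes F :: "'a \<Rightarrow> 'a \<Rightarrow> 'a"
  assumes unan: "F x x = x"
    and sp1: "R \<in> D \<Longrightarrow> F (peak R) y = F x' y \<or> (F (peak R) y, F x' y) \<in> R"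
    and sp2: "R \<in> D \<Longrightarrow> F x (peak R) = F x y' \<or> (F x (peak R), F x y') \<in> R"
begin

lemma swapped: "two_voter_tops_rule D (\<lambda>x y. F y x)"
proof
  show "F x x = x" for x by (rule unan)
  show "F y (peak R) = F y x' \<or> (F y (peak R), F y x') \<in> R" if "R \<in> D" for R y x' using sp2[OF that] .
  show "F (peak R) x = F y' x \<or> (F (peak R) x, F y' x) \<in> R" if "R \<in> D" for R x y' using sp1[OF that] .
qed

lemma change1: "F x y \<noteq> F x' y \<Longrightarrow> S x (F x y) x'"
  using change_sep[of "\<lambda>x. F x y" x x', OF sp1] by simp

lemma change2: "F x y \<noteq> F x y' \<Longrightarrow> S y (F x y) y'"
  using change_sep[of "F x" y y', OF sp2] by simp

text \<open>A voter whose peak is \<open>F x y\<close> could report \<open>x\<close> and obtain that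
  peak, so truth-telling must give it as well.\<close>

lemma idem1: "F (F x y) y = F x y"
proof -
  obtain R where R: "R \<in> D" "peak R = F x y" using ex_pref by blast
  then show ?thesis using sp1[OF R(1), of y x] peak_unbeaten[OF pref[OF R(1)]] by auto
qed

lemma between: "S x (F x y) y"
  using change1[of x y y] unan[of y] by (cases "F x y = y") auto

text \<open>With either reversed preference voter 2 obtains \<open>c\<close> and could obtain
  \<open>F x y\<close> instead, so \<open>c\<close> is weakly better in both.\<close>

lemma reversed_const:
  assumes "Rlo \<in> D" "Rhi \<in> D" "completely_reversed Rlo Rhi" "F x (peak Rlo) = c" "F x (peak Rhi) = c"
  shows "F x y = c"
proof -
  have "c = F x y \<or> (c, F x y) \<in> Rlo" "c = F x y \<or> (c, F x y) \<in> Rhi"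
    using sp2[OF assms(1), of x y] sp2[OF assms(2), of x y] assms(4,5) by auto
  then show ?thesis using completely_reversed_eqI[OF assms(3) pref[OF assms(2)]] by metis
qed

text \<open>A vertex \<open>c\<close> that wins against \<open>insert c C\<close> forces the value to be the median of the two
  peaks and \<open>c\<close>.\<close>

lemma median_rooted:
  assumes "\<And>y. F c y = c" "F x c = c"
  shows "S x (F x y) y" "S x (F x y) c" "S y (F x y) c"
proof -
  show "S x (F x y) y" using between .
  show "S x (F x y) c" using change1[of x y c] assms(1) by (cases "F x y = c") auto
  show "S y (F x y) c" using change2[of x y c] assms(2) by (cases "F x y = c") auto
qed

text \<open>Suppose \<open>x\<close> reaches each end of the edge without the other. Then
  \<open>u\<close> must win against \<open>x\<close>, so moving voter 2 to \<open>v\<close> leaves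
  only \<open>u\<close> and \<open>v\<close> as outcomes. The first would separate \<open>x\<close>
  from \<open>v\<close>, and the second would separate \<open>x\<close> from
  \<open>u\<close>.\<close>

lemma edge_separates:
  assumes e: "(u, v) \<in> G" and F: "F u v = u" "F v u = u"
  shows "S x u v \<or> S x v u"
proof (rule ccontr)
  assume n: "\<not> ?thesis"
  have xu: "F x u = u"
  proof (rule ccontr)
    assume "F x u \<noteq> u"
    then have "S v u x" using change1[of v u x] F(2) by simp
    then show False using n commute by blast
  qed
  have "F x v = u \<or> F x v = v"
  proof (rule ccontr)
    assume a: "\<not> ?thesis"
    have "S v (F x v) u" using change2[of x v u] xu a by simp
    then show False using edge_sep[OF edge_commute[OF e]] a by blast
  qed
  moreover have "F x v \<noteq> u" using between[of x v] n by auto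
  moreover have "F x v \<noteq> v" using change1[of x v u] F(1) n edge_neq[OF e] by auto
  ultimately show False by blast
qed

text \<open>On \<open>insert c C\<close> the rule is the median with \<open>c\<close>, hence
  symmetric, so every edge has the same winner in both orders and separates; this gives the forest.
  The ranking conditions are read off from manipulations.\<close>

lemma rooted_hung:
  assumes c: "c \<notin> C" and closed: "\<And>x y. x \<in> C \<Longrightarrow> y \<notin> C \<Longrightarrow> S x c y"
    and c1: "\<And>y. F c y = c" and c2: "\<And>x. x \<in> C \<Longrightarrow> F x c = c"
  shows "hung C c"
proof (rule hungI)
  have med: "S x (F x y) y" "S x (F x y) c" "S y (F x y) c" if "x \<in> insert c C" for x y
    using median_rooted[OF c1, of x] c1 c2 that by auto
  have med_eq: "F x y = m" if "x \<in> insert c C" "S x m y" "S x m c" "S y m c" for x y m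
    using median_unique[OF med[OF that(1)]] that by blast
  show "c \<notin> C" "\<And>x y. x \<in> C \<Longrightarrow> y \<notin> C \<Longrightarrow> S x c y" using c closed by auto
  show "S x u v \<or> S x v u" if e: "(u, v) \<in> G" "u \<in> insert c C" "v \<in> insert c C" for u v x
  proof -
    have eq: "F u v = F v u"
      using med_eq[OF e(2)] med[OF e(3), of u] commute by blast
    have "F u v = u \<or> F u v = v" using edge_sep[OF e(1) between] .
    then show ?thesis
      using edge_separates[OF e(1)] edge_separates[OF edge_commute[OF e(1)]] eq by auto
  qed
  show "(u, v) \<in> R" if R: "R \<in> D" "peak R \<in> C" and s: "S (peak R) u c" "S (peak R) u v" "u \<noteq> v" for R u v
  proof -
    define x where "x = peak R"
    \<comment> \<open>\<open>m\<close> mediates: against an opponent at \<open>u\<close> the report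
      \<open>m\<close> yields \<open>m\<close> instead of \<open>u\<close>, and against an opponent
      at \<open>v\<close> the report \<open>v\<close> yields \<open>v\<close> instead of
      \<open>m\<close>. Hence \<open>u\<close> is weakly above \<open>m\<close>, and
      \<open>m\<close> weakly above \<open>v\<close>.\<close>
    define m where "m = F x v"
    have x: "x \<in> insert c C" using R by (simp add: x_def)
    note s = s[folded x_def]
    have m: "S x m v" "S x m c" "S v m c" using med[OF x] by (auto simp: m_def)
    have um: "S x u m"
    proof (rule ccontr)
      assume n: "\<not> ?thesis"
      then have mu: "S x m u" using chain[OF s(2) m(1)] by blast
      have 1: "S m u v" "S m u c" using trans_inner[OF s(2) mu] trans_inner[OF s(1) mu] .
      have "S v m u \<or> S u m c" using split[OF m(3)] .
      then have "m = u"
        using antisym[of v m u] antisym[of c m u] commute[OF 1(1)] commute[OF 1(2)] commute[of u m c] by blast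
      then show False using n by simp
    qed
    have mX: "m \<in> insert c C"
    proof (rule ccontr)
      assume a: "m \<notin> insert c C"
      then have "S x c m" using closed[of x m] R by (simp add: x_def)
      then show False using antisym[OF m(2)] a by blast
    qed
    have xu: "F x u = u" using med_eq[OF x _ s(1)] by simp
    have mu: "F m u = m" using med_eq[OF mX left left trans_inner[OF m(2) um]] .
    have "u = m \<or> (u, m) \<in> R" using sp1[OF R(1), of u m] xu mu by (simp add: x_def)
    moreover have "m = v \<or> (m, v) \<in> R" using sp1[OF R(1), of v v] unan by (simp add: m_def x_def)
    ultimately show ?thesis using s(3) preferenceD(3)[OF pref[OF R(1)]] by blast
  qed
  show "(c, v) \<in> R" if R: "R \<in> D" "peak R \<notin> C" "v \<in> C" for R v
  proof -
    \<comment> \<open>Voter 2 obtains \<open>c\<close> but could obtain \<open>v\<close> by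
      reporting it.\<close>
    have "F v (peak R) = c" using med_eq[of v c "peak R"] closed[OF R(3,2)] R by simp
    then show ?thesis using sp2[OF R(1), of v v] unan c R(3) by auto
  qed
qed

end

section \<open>Rules evaluated at the reversed pair\<close>

locale reversed_rule = two_voter_tops_rule +
  fixes Rlo Rhi :: "'a pref"
  assumes Rlo: "Rlo \<in> D" and Rhi: "Rhi \<in> D" and rev: "completely_reversed Rlo Rhi"
begin

abbreviation s where "s \<equiv> peak Rlo"
abbreviation t where "t \<equiv> peak Rhi"

lemma swapped_voters: "reversed_rule D (\<lambda>x y. F y x) Rlo Rhi"
proof -
  interpret sw: two_voter_tops_rule D "\<lambda>x y. F y x" using swapped .
  show ?thesis by unfold_locales (rule Rlo Rhi rev)+
qed

lemma swapped_ends: "reversed_rule D F Rhi Rlo"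
proof
  have "(a, b) \<in> Rhi \<longleftrightarrow> (b, a) \<in> Rlo" if "a \<noteq> b" for a b
    using rev[unfolded completely_reversed_def, rule_format, of b a] that by auto
  then show "completely_reversed Rhi Rlo" unfolding completely_reversed_def by simp
qed (rule Rlo Rhi)+

lemma reversed_eqI: "(x = y \<or> (x, y) \<in> Rlo) \<Longrightarrow> (x = y \<or> (x, y) \<in> Rhi) \<Longrightarrow> x = y"
  using completely_reversed_eqI[OF rev pref[OF Rhi]] .

text \<open>If \<open>w = F x c\<close> differs from \<open>c\<close>, it cannot win against both
  \<open>s\<close> and \<open>t\<close>, since then \<open>c\<close> would be weakly above
  \<open>w\<close> in both reversed preferences. Losing against one of them forces the outcome
  \<open>c\<close> against the other, so \<open>w\<close> separates \<open>c\<close> from both,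
  although \<open>c\<close> separates \<open>s\<close> from \<open>t\<close>.\<close>

lemma invariant_center1:
  assumes c: "F s t = c" "F t s = c"
  shows "F x c = c"
proof (rule ccontr)
  define w where "w = F x c"
  assume "F x c \<noteq> c"
  then have wc: "w \<noteq> c" by (simp add: w_def)
  have wcw: "F w c = w" using idem1 by (simp add: w_def)
  have sct: "S s c t" using between[of s t] c by simp
  have A: "F w t \<noteq> w \<or> F w s \<noteq> w"
  proof (rule ccontr)
    assume "\<not> ?thesis"
    then have "c = w \<or> (c, w) \<in> Rlo" "c = w \<or> (c, w) \<in> Rhi"
      using sp1[OF Rlo, of t w] sp1[OF Rhi, of s w] c by auto
    then show False using reversed_eqI[of c w] wc by blast
  qed
  have B: False if "F w t \<noteq> w"
  proof -
    have cwt: "S t w c" using change2[of w c t] that wcw commute by simp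
    have "F w s = c"
    proof (rule ccontr)
      assume "\<not> ?thesis"
      then have "S t c w" using change1[of t s w] c by simp
      then show False using antisym[OF _ cwt] wc by blast
    qed
    then have cws: "S s w c" using change2[of w c s] wcw wc commute by simp
    have "S s c w \<or> S w c t" using split[OF sct] .
    then show False using antisym[OF cws] antisym[OF cwt] wc commute[of w c t] by blast
  qed
  have "F w s \<noteq> w" using A B by blast
  then have cws: "S s w c" using change2[of w c s] wcw commute by simp
  have "F w t = c"
  proof (rule ccontr)
    assume "\<not> ?thesis"
    then have "S s c w" using change1[of s t w] c by simp
    then show False using antisym[OF _ cws] wc by blast
  qed
  then show False using B wc by simp
qed

lemma invariant_center:
  assumes c: "F s t = c" "F t s = c"
  shows "F x c = c" "F c x = c"
proof -
  interpret sw: reversed_rule D "\<lambda>x y. F y x" Rlo Rhi using swapped_voters .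
  show "F x c = c" using invariant_center1[OF c] .
  show "F c x = c" using sw.invariant_center1[OF c(2,1)] .
qed

lemma invariant_hung:
  assumes c: "F s t = c" "F t s = c"
  shows "hung (-{c}) c"
proof (rule rooted_hung)
  show "F c y = c" for y using invariant_center(2)[OF c] .
  show "F x c = c" for x using invariant_center(1)[OF c] .
qed auto

lemma invariant_median:
  assumes c: "F s t = c" "F t s = c"
  shows "F x y = proj G (path_set G x y) c"
proof -
  have "S x (F x y) y" "S x (F x y) c" "S y (F x y) c"
    using median_rooted[of c x y] invariant_center[OF c] by auto
  then show ?thesis using proj_path_set[OF hung_tree[OF invariant_hung[OF c]]] by simp
qed

text \<open>\<open>p\<close> is the end of the zone on the side of \<open>s\<close>. That
  \<open>p\<close> wins for voter 1 need only be checked against \<open>t\<close>, where it is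
  idempotence, and against \<open>s\<close>, where another outcome would lie between
  \<open>p\<close> and both \<open>s\<close> and \<open>q\<close>, while \<open>p\<close> separates
  these two.\<close>

lemma root_facts:
  assumes p: "F s t = p" and q: "F t s = q" and pq: "p \<noteq> q" "S s p q"
  shows "F p y = p" "\<not> S s p x \<Longrightarrow> F x p = p"
proof -
  have qs: "F q s = q" using idem1[of t s] q by simp
  have pt: "F p t = p" using idem1[of s t] p by simp
  have ps: "F p s = p"
  proof (rule ccontr)
    define w where "w = F p s"
    assume "F p s \<noteq> p"
    then have wp: "w \<noteq> p" by (simp add: w_def)
    have pws: "S s w p" using between[of p s] commute by (simp add: w_def)
    show False
    proof (cases "w = q")
      case True
      then show False using antisym[OF pq(2)] pws pq(1) by blast
    next
      case False
      then have "S q w p" using change1[of p s q] qs commute by (simp add: w_def)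
      moreover have "S s p w \<or> S w p q" using split[OF pq(2)] .
      ultimately show False using antisym[OF pws] antisym[of q w p] wp commute[of w p q] by blast
    qed
  qed
  show "F p y = p" using reversed_const[OF Rlo Rhi rev ps pt] .
  show "F x p = p" if x: "\<not> S s p x"
  proof (rule ccontr)
    define w where "w = F x p"
    assume "F x p \<noteq> p"
    then have wp: "w \<noteq> p" by (simp add: w_def)
    have ww: "F w p = w" using idem1 by (simp add: w_def)
    have xw: "S x w p" using between by (simp add: w_def)
    have w: "\<not> S s p w"
    proof
      assume "S s p w"
      then have "S x p w" using split[of s p w x] x by blast
      then show False using antisym[OF xw] wp by blast
    qed
    have "F w t = w"
    proof (rule ccontr)
      assume "\<not> ?thesis"
      then have "S t w p" using change2[of w p t] ww commute by simp
      moreover have "S w p t" using split[of s p t w] between[of s t] p w by auto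
      ultimately show False using antisym[of t w p] wp commute by blast
    qed
    then have "S s p w" using change1[of s t w] p wp by simp
    then show False using w by blast
  qed
qed

text \<open>Both ends win for voter 1, so every outcome with voter 1 at \<open>z\<close> separates
  \<open>z\<close> from \<open>p\<close> and from \<open>q\<close>. Distinct outcomes against
  \<open>s\<close> and \<open>t\<close> would both lie between \<open>p\<close> and \<open>q\<close>
  and be gates of \<open>z\<close> there. Hence the outcome is constant in voter 2, and unanimity
  makes it \<open>z\<close>.\<close>

lemma dictated_middle:
  assumes p: "F s t = p" and q: "F t s = q" and pq: "p \<noteq> q" "S s p q" "S t q p"
    and z: "S s p z" "S t q z"
  shows "F z y = z"
proof -
  interpret se: reversed_rule D F Rhi Rlo using swapped_ends .
  have P: "F p y = p" for y using root_facts(1)[OF p q pq(1,2)] .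
  have Q: "F q y = q" for y using se.root_facts(1)[OF q p _ pq(3)] pq(1) by blast
  have near: "S z (F z y) c" if "\<And>y. F c y = c" for y c
    using change1[of z y c] that by (cases "F z y = c") auto
  have near: "S z (F z y) p" "S z (F z y) q" for y using near[OF P] near[OF Q] .
  have ends: "S s p (F z y)" "S t q (F z y)" for y
  proof -
    have "S s p (F z y) \<or> S (F z y) p z" using split[OF z(1)] .
    then show "S s p (F z y)"
      using antisym[OF near(1)[of y]] commute[of "F z y" p z] right[of s p] by metis
    have "S t q (F z y) \<or> S (F z y) q z" using split[OF z(2)] .
    then show "S t q (F z y)"
      using antisym[OF near(2)[of y]] commute[of "F z y" q z] right[of t q] by metis
  qed
  \<comment> \<open>A vertex between \<open>p\<close> and \<open>q\<close> that separates
    \<open>z\<close> from both is unique; of two candidates, \<open>w\<close> is the one nearer to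
    \<open>z\<close>.\<close>
  have *: "w = w'" if w: "S z w p" "S z w q" "S p w q" and w': "S z w' p" "S z w' q" and ww: "S z w w'" for w w'
  proof -
    have 1: "S w w' p" "S w w' q" using trans_inner[OF w'(1) ww] trans_inner[OF w'(2) ww] .
    have "S p w w' \<or> S w' w q" using split[OF w(3)] .
    then show ?thesis
      using antisym[of p w w'] antisym[of q w w'] commute[OF 1(1)] commute[OF 1(2)] commute[of w' w q] by blast
  qed
  have "F z s = F z t"
  proof (rule ccontr)
    assume n: "F z s \<noteq> F z t"
    define w where "w = F z s"
    define w' where "w' = F z t"
    have 1: "S s w t" "S t w' s" using change2[of z s t] change2[of z t s] n by (auto simp: w_def w'_def)
    have mid: "S p v q" if "S s v t" "S s p v" "S t q v" for v
      using trans_inner[OF commute[OF trans_inner[OF that(1,2)]] that(3)] commute by blast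
    have "S p w q" "S p w' q"
      using mid[OF 1(1)] mid[OF commute[OF 1(2)]] ends by (auto simp: w_def w'_def)
    moreover have "S z w w' \<or> S z w' w" using chain[OF near(1) near(1)] by (simp add: w_def w'_def)
    ultimately have "w = w'" using *[of w w'] *[of w' w] near by (auto simp: w_def w'_def)
    then show False using n by (simp add: w_def w'_def)
  qed
  then have c: "F z y = F z s" for y using reversed_const[OF Rlo Rhi rev, of z] by metis
  show ?thesis using c[of y] c[of z] unan[of z] by simp
qed

text \<open>\<open>C\<close> collects what \<open>s\<close> reaches without \<open>p\<close>, and
  \<open>C'\<close> what \<open>t\<close> reaches without \<open>q\<close>; what remains is dictated
  by voter 1. The final clause about \<open>s\<close> and \<open>t\<close> serves the comparison
  with minimal zones.\<close>

lemma rule_zone: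
  assumes p: "F s t = p" and q: "F t s = q" and pq: "p \<noteq> q" "S s p q"
  shows "\<exists>C C' M. zone C p C' q M \<and> (\<forall>z\<in>M. \<forall>y. F z y = z) \<and>
    (\<forall>x\<in>insert p C. \<forall>y. S x (F x y) y \<and> S x (F x y) p \<and> S y (F x y) p) \<and>
    (\<forall>x\<in>insert q C'. \<forall>y. S x (F x y) y \<and> S x (F x y) q \<and> S y (F x y) q) \<and>
    (C \<noteq> {} \<longrightarrow> s \<in> C) \<and> (C' \<noteq> {} \<longrightarrow> t \<in> C')"
proof -
  interpret se: reversed_rule D F Rhi Rlo using swapped_ends .
  have "S s q t" using between[of t s] q commute by simp
  then have qp: "S t q p" using trans_inner[OF _ pq(2)] commute by blast
  define C where "C = {z. \<not> S s p z}"
  define C' where "C' = {z. \<not> S t q z}"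
  define M where "M = -(C \<union> C')"
  have P: "F p y = p" "x \<in> C \<Longrightarrow> F x p = p" for x y using root_facts[OF p q pq] by (auto simp: C_def)
  have Q: "F q y = q" "x \<in> C' \<Longrightarrow> F x q = q" for x y
    using se.root_facts[OF q p _ qp] pq(1) by (auto simp: C'_def)
  have hC: "hung C p"
  proof (rule rooted_hung)
    show "p \<notin> C" by (simp add: C_def)
    show "S x p y" if "x \<in> C" "y \<notin> C" for x y using split[of s p y x] that by (auto simp: C_def)
  qed (use P in auto)
  have hC': "hung C' q"
  proof (rule rooted_hung)
    show "q \<notin> C'" by (simp add: C'_def)
    show "S x q y" if "x \<in> C'" "y \<notin> C'" for x y using split[of t q y x] that by (auto simp: C'_def)
  qed (use Q in auto)
  have "C \<inter> C' = {}"
  proof (rule ccontr)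
    assume "C \<inter> C' \<noteq> {}"
    then obtain z where z: "\<not> S s p z" "\<not> S t q z" by (auto simp: C_def C'_def)
    have "S z p t" using split[of s p t z] between[of s t] p z by auto
    moreover have "S s q z" using split[OF \<open>S s q t\<close>, of z] z commute by blast
    ultimately have 1: "S z p q \<or> S q p t" "S s q p \<or> S p q z" using split by blast+
    have "\<not> S s q p" using antisym[OF pq(2)] pq(1) by blast
    moreover have "\<not> S q p t" using antisym[OF qp] commute[of q p t] pq(1) by blast
    ultimately have "S z p q" "S z q p" using 1 commute by blast+
    then show False using antisym pq(1) by blast
  qed
  then have zone: "zone C p C' q M"
    unfolding zone_def using hC hC' pq qp M_def by (auto simp: C_def C'_def)
  have f1: "F z y = z" if "z \<in> M" for z y
    using dictated_middle[OF p q pq qp] that by (auto simp: M_def C_def C'_def)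
  have f2: "S x (F x y) y \<and> S x (F x y) p \<and> S y (F x y) p" if "x \<in> insert p C" for x y
    using median_rooted[of p x y] P that by auto
  have f3: "S x (F x y) y \<and> S x (F x y) q \<and> S y (F x y) q" if "x \<in> insert q C'" for x y
    using median_rooted[of q x y] Q that by auto
  \<comment> \<open>If \<open>s\<close> is missing from \<open>C\<close>, then \<open>p = s\<close>,
    and \<open>s\<close> trivially separates itself from everything, so \<open>C\<close> is
    empty.\<close>
  have f4: "C \<noteq> {} \<longrightarrow> s \<in> C" "C' \<noteq> {} \<longrightarrow> t \<in> C'"
    using refl_eq[of s p] refl_eq[of t q] left[of s] left[of t] by (auto simp: C_def C'_def)
  show ?thesis
    by (rule exI[of _ C], rule exI[of _ C'], rule exI[of _ M]) (use zone f1 f2 f3 f4 in blast)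
qed

end

lemma successively_conj:
  "successively P xs \<Longrightarrow> successively Q xs \<Longrightarrow> successively (\<lambda>x y. P x y \<and> Q x y) xs"
  by (induction xs) (auto simp: successively_Cons)

section \<open>Domains without unique seconds are dictatorial\<close>

locale two_voter_rule = path_connected_domain +
  fixes h :: "'a pref \<Rightarrow> 'a pref \<Rightarrow> 'a"
  assumes una: "R \<in> D \<Longrightarrow> Q \<in> D \<Longrightarrow> peak R = peak Q \<Longrightarrow> h R Q = peak Q"
    and s1: "R \<in> D \<Longrightarrow> R' \<in> D \<Longrightarrow> Q \<in> D \<Longrightarrow> h R Q = h R' Q \<or> (h R Q, h R' Q) \<in> R"
    and s2: "R \<in> D \<Longrightarrow> Q \<in> D \<Longrightarrow> Q' \<in> D \<Longrightarrow> h R Q = h R Q' \<or> (h R Q, h R Q') \<in> Q"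
begin

definition wins1 :: "'a \<Rightarrow> 'a \<Rightarrow> bool" where
  "wins1 x y \<longleftrightarrow> (\<forall>R\<in>D. \<forall>Q\<in>D. peak R = x \<longrightarrow> peak Q = y \<longrightarrow> h R Q = x)"

definition wins2 :: "'a \<Rightarrow> 'a \<Rightarrow> bool" where
  "wins2 x y \<longleftrightarrow> (\<forall>R\<in>D. \<forall>Q\<in>D. peak R = x \<longrightarrow> peak Q = y \<longrightarrow> h R Q = y)"

text \<open>Weaker than adjacency, since the preferences need not agree from the third position on.
  Leaf symmetry provides links of this kind that are not edges.\<close>

definition linked :: "'a \<Rightarrow> 'a \<Rightarrow> bool" where
  "linked x y \<longleftrightarrow> x \<in> seconds D y \<and> y \<in> seconds D x"

lemma secondsE:
  assumes "y \<in> seconds D x"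
  obtains R where "R \<in> D" "peak R = x" "ranked 2 R = y"
  using assms unfolding seconds_def by blast

lemma secondsI: "R \<in> D \<Longrightarrow> ranked 2 R \<in> seconds D (peak R)"
  unfolding seconds_def by blast

lemma edge_linked: "(x, y) \<in> G \<Longrightarrow> linked x y"
  unfolding linked_def by (elim edgeE) (metis secondsI)

lemma linked_commute: "linked x y \<Longrightarrow> linked y x"
  by (simp add: linked_def)

lemma linked_neq: "linked x y \<Longrightarrow> x \<noteq> y"
  unfolding linked_def by (auto elim!: secondsE dest: second_neq)

lemma unbeaten: "R \<in> D \<Longrightarrow> (x, peak R) \<notin> R"
  using peak_unbeaten pref by blast

lemma at_least_second:
  assumes R: "R \<in> D" and v: "v = ranked 2 R \<or> (v, ranked 2 R) \<in> R"
  shows "v = peak R \<or> v = ranked 2 R"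
proof (rule ccontr)
  assume a: "\<not> ?thesis"
  then have "(ranked 2 R, v) \<in> R" using second_best[OF R] by blast
  then show False using a v preferenceD(4)[OF pref[OF R]] by blast
qed

text \<open>With preferences ranking \<open>x\<close> and \<open>y\<close> on top in the two orders,
  the outcome is one of these two. That single outcome decides all other profiles with the same
  peaks by strategy-proofness.\<close>

lemma linked_cases:
  assumes "linked x y"
  shows "wins1 x y \<or> wins2 x y"
proof -
  obtain P1 where P1: "P1 \<in> D" "peak P1 = x" "ranked 2 P1 = y"
    using assms by (auto simp: linked_def elim: secondsE)
  obtain P2 where P2: "P2 \<in> D" "peak P2 = y" "ranked 2 P2 = x"
    using assms by (auto simp: linked_def elim: secondsE)
  have xy: "x \<noteq> y" using linked_neq[OF assms] .
  have v1: "h P1 Q = x \<or> h P1 Q = y" if "Q \<in> D" "peak Q = y" for Q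
    using at_least_second[OF P1(1), of "h P1 Q"] s1[OF P1(1) that(1) that(1)] una[OF that(1) that(1)] that P1
    by simp
  have v2: "h R P2 = x \<or> h R P2 = y" if "R \<in> D" "peak R = x" for R
    using at_least_second[OF P2(1), of "h R P2"] s2[OF that(1) P2(1) that(1)] una[OF that(1) that(1)] that P2
    by auto
  consider "h P1 P2 = x" | "h P1 P2 = y" using v1[OF P2(1,2)] by blast
  then show ?thesis
  proof cases
    case 1
    have "h R Q = x" if R: "R \<in> D" "peak R = x" and Q: "Q \<in> D" "peak Q = y" for R Q
    proof -
      have "h P1 Q \<noteq> y"
        using s2[OF P1(1) P2(1) Q(1)] unbeaten[OF P2(1), of x] 1 xy P2(2) by auto
      then have "h P1 Q = x" using v1[OF Q] by blast
      then show ?thesis using s1[OF R(1) P1(1) Q(1)] unbeaten[OF R(1)] R(2) by auto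
    qed
    then show ?thesis unfolding wins1_def by blast
  next
    case 2
    have "h R Q = y" if R: "R \<in> D" "peak R = x" and Q: "Q \<in> D" "peak Q = y" for R Q
    proof -
      have "h R P2 \<noteq> x"
        using s1[OF P1(1) R(1) P2(1)] unbeaten[OF P1(1), of y] 2 xy P1(2) by auto
      then have "h R P2 = y" using v2[OF R] by blast
      then show ?thesis using s2[OF R(1) Q(1) P2(1)] unbeaten[OF Q(1)] Q(2) by auto
    qed
    then show ?thesis unfolding wins2_def by blast
  qed
qed

text \<open>Otherwise voter 1 loses on the second link. On the link that is an edge, a swap of that
  voter's top two leaves the outcome unchanged; on the other link, a voter with the suitable second
  choice then gains that alternative by misreporting.\<close>

lemma propagate:
  assumes xy: "linked x y" and yz: "linked y z" and xz: "x \<noteq> z" and G: "(x, y) \<in> G \<or> (y, z) \<in> G"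
    and w: "wins1 x y"
  shows "wins1 y z"
proof (rule ccontr)
  assume "\<not> ?thesis"
  then have w2: "wins2 y z" using linked_cases[OF yz] by blast
  have neq: "x \<noteq> y" "y \<noteq> z" using linked_neq xy yz by auto
  from G show False
  proof
    assume e: "(x, y) \<in> G"
    obtain P P' where P: "P \<in> D" "P' \<in> D" "peak P = x" "peak P' = y"
      "\<And>a b. {a, b} \<noteq> {x, y} \<Longrightarrow> (a, b) \<in> P \<longleftrightarrow> (a, b) \<in> P'" using e by (elim edgeE) blast
    obtain Q where Q: "Q \<in> D" "peak Q = z" using ex_pref by blast
    obtain Q' where Q': "Q' \<in> D" "peak Q' = y" "ranked 2 Q' = z"
      using yz by (auto simp: linked_def elim: secondsE)
    have PQ': "h P' Q = z" using w2 P Q by (simp add: wins2_def)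
    have "h P Q = z"
    proof (rule ccontr)
      assume "h P Q \<noteq> z"
      then have "h P Q = x \<and> h P' Q = y"
        using swap_step[of "\<lambda>R. h R Q", OF s1[OF _ _ Q(1)] P] PQ' by simp
      then show False using PQ' neq by simp
    qed
    moreover have "h P Q' = x" using w P Q' by (simp add: wins1_def)
    ultimately have "(x, z) \<in> Q'" using s2[OF P(1) Q'(1) Q(1)] xz by simp
    then show False
      using second_best[OF Q'(1), of x] preferenceD(4)[OF pref[OF Q'(1)], of x z] Q' neq xz by simp
  next
    assume e: "(y, z) \<in> G"
    obtain Q Q' where Q: "Q \<in> D" "Q' \<in> D" "peak Q = y" "peak Q' = z"
      "\<And>a b. {a, b} \<noteq> {y, z} \<Longrightarrow> (a, b) \<in> Q \<longleftrightarrow> (a, b) \<in> Q'" using e by (elim edgeE) blast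
    obtain R where R: "R \<in> D" "peak R = x" using ex_pref by blast
    obtain P where P: "P \<in> D" "peak P = y" "ranked 2 P = x"
      using xy by (auto simp: linked_def elim: secondsE)
    have RQ: "h R Q = x" using w R Q by (simp add: wins1_def)
    have "h R Q' = x"
    proof (rule ccontr)
      assume "h R Q' \<noteq> x"
      then have "h R Q = y \<and> h R Q' = z"
        using swap_step[of "h R", OF s2[OF R(1)] Q] RQ by simp
      then show False using RQ neq by simp
    qed
    moreover have "h P Q' = z" using w2 P Q by (simp add: wins2_def)
    ultimately have "(z, x) \<in> P" using s1[OF P(1) R(1) Q(2)] xz by simp
    then show False
      using second_best[OF P(1), of z] preferenceD(4)[OF pref[OF P(1)], of z x] P neq xz by simp
  qed
qed

text \<open>Moving voter 1 from \<open>y\<close> to \<open>x\<close> along the edge either keeps the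
  outcome \<open>y\<close> or turns it into \<open>x\<close>. It cannot keep \<open>y\<close>,
  because a voter 2 with peak \<open>y\<close>, who gets \<open>x\<close>, would imitate
  \<open>Q\<close>.\<close>

lemma wins_trans:
  assumes e: "(x, y) \<in> G" and yz: "wins1 y z" and xy: "wins1 x y"
  shows "wins1 x z"
proof -
  obtain P P' where P: "P \<in> D" "P' \<in> D" "peak P = x" "peak P' = y"
    "\<And>a b. {a, b} \<noteq> {x, y} \<Longrightarrow> (a, b) \<in> P \<longleftrightarrow> (a, b) \<in> P'" using e by (elim edgeE) blast
  obtain Q1 where Q1: "Q1 \<in> D" "peak Q1 = y" using ex_pref by blast
  have "h R Q = x" if R: "R \<in> D" "peak R = x" and Q: "Q \<in> D" "peak Q = z" for R Q
  proof -
    have 1: "h P' Q = y" using yz P Q by (simp add: wins1_def)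
    have "h P Q1 = x" using xy P Q1 by (simp add: wins1_def)
    then have "h P Q \<noteq> y"
      using s2[OF P(1) Q1(1) Q(1)] unbeaten[OF Q1(1), of x] edge_neq[OF e] Q1(2) by auto
    then have "h P Q = x"
      using swap_step[of "\<lambda>R. h R Q", OF s1[OF _ _ Q(1)] P] 1 by simp
    then show ?thesis using s1[OF R(1) P(1) Q(1)] unbeaten[OF R(1)] R(2) by auto
  qed
  then show ?thesis by (simp add: wins1_def)
qed

lemma propagate_path:
  assumes "distinct (x # y # p)" "successively (\<lambda>u v. (u, v) \<in> G) (x # y # p)" "wins1 x y"
  shows "successively wins1 (x # y # p)"
  using assms
proof (induction p arbitrary: x y)
  case (Cons z p)
  have "wins1 y z" using propagate[of x y z] edge_linked Cons.prems by auto
  then show ?case using Cons.IH[of y z] Cons.prems by auto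
qed simp

lemma wins_path:
  assumes "successively (\<lambda>u v. (u, v) \<in> G \<and> wins1 u v) p" "length p \<ge> 2"
  shows "wins1 (hd p) (last p)"
  using assms
proof (induction p)
  case (Cons x p)
  show ?case
  proof (cases "length p \<ge> 2")
    case True
    then have "wins1 (hd p) (last p)" "(x, hd p) \<in> G" "wins1 x (hd p)"
      using Cons by (auto simp: successively_Cons)
    then show ?thesis using wins_trans[of x "hd p" "last p"] True by auto
  next
    case False
    then obtain y where "p = [y]" using Cons.prems(2) by (cases p; cases "tl p") auto
    then show ?thesis using Cons.prems by simp
  qed
qed simp

text \<open>Follow a path whose steps are won by voter 1 until it cannot be prolonged. It then closes a
  cycle, or ends in a leaf from which leaf symmetry offers a link to a vertex that is not a
  neighbour. Either way one can walk back along the path. The path is listed from its end.\<close>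

lemma wins_back:
  assumes ls: "leaf_symmetry D" and nu: "\<not> unique_seconds D"
    and "distinct (ps @ [y, x])" "successively (\<lambda>u v. (u, v) \<in> G \<and> wins1 v u) (ps @ [y, x])"
  shows "wins1 y x"
  using assms(3,4)
proof (induction "CARD('a) - length ps" arbitrary: ps rule: less_induct)
  case less
  define L where "L = ps @ [y, x]"
  obtain e m rest where L: "L = e # m # rest" by (cases ps; cases "tl ps") (auto simp: L_def)
  have dist: "distinct L" and suc: "successively (\<lambda>u v. (u, v) \<in> G \<and> wins1 v u) L"
    using less.prems by (auto simp: L_def)
  have em: "(e, m) \<in> G" "wins1 m e" using suc unfolding L by auto
  have sucG: "successively (\<lambda>u v. (u, v) \<in> G) L" using suc by (rule successively_mono) auto
  have final: "wins1 y x" if "successively wins1 (l @ [y, x])" for l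
    using that by (simp add: successively_append_iff)
  have "set L \<subseteq> UNIV" "length L = card (set L)" using dist distinct_card by force+
  then have len: "length L \<le> CARD('a)" by (simp add: card_mono)
  consider (extend) z where "(e, z) \<in> G" "z \<notin> set L"
    | (cycle) z where "(e, z) \<in> G" "z \<noteq> m" "z \<in> set L"
    | (leaf) "neighbors G e = {m}"
    using em unfolding neighbors_def by blast
  then show ?case
  proof cases
    case extend
    have "wins1 e z" using propagate[of m e z] edge_linked extend em edge_commute L by auto
    then have "successively (\<lambda>u v. (u, v) \<in> G \<and> wins1 v u) (z # L)"
      using suc extend edge_commute unfolding L by auto
    moreover have "distinct (z # L)" using dist extend by simp
    moreover have "length ps < CARD('a)" using len by (simp add: L_def)
    ultimately show ?thesis using less.hyps[of "z # ps"] by (simp add: L_def)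
  next
    case cycle
    have ez: "wins1 e z" using propagate[of m e z] edge_linked cycle em edge_commute by auto
    have "z \<noteq> e" using cycle edge_neq by blast
    obtain l1 l2 where l: "L = l1 @ z # l2" using split_list[OF cycle(3)] by blast
    have l1: "l1 \<noteq> []" using l L \<open>z \<noteq> e\<close> by (cases l1) auto
    show ?thesis
    \<comment> \<open>If the cycle closes before \<open>x\<close>, the tail from \<open>z\<close> on
      already ends with the step from \<open>y\<close> to \<open>x\<close>.\<close>
    proof (cases "l2 = []")
      case False
      then obtain w l3 where w: "l2 = w # l3" by (cases l2) auto
      have "e \<in> set l1" using l1 l L by (cases l1) auto
      then have "distinct (e # z # l2)" using dist unfolding l by auto
      moreover have "successively (\<lambda>u v. (u, v) \<in> G) (e # z # l2)"
        using sucG cycle(1) unfolding l by (auto simp: successively_append_iff)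
      ultimately have "successively wins1 (z # l2)" using propagate_path[OF _ _ ez] by auto
      moreover have "\<exists>l. z # l2 = l @ [y, x]"
      proof -
        have "ps @ [y, x] = l1 @ z # l2" using l by (simp add: L_def)
        then show ?thesis using w by (auto simp: append_eq_append_conv2 Cons_eq_append_conv append_eq_Cons_conv)
      qed
      ultimately show ?thesis using final by metis
    next
      case True
      then have zx: "z = x" using l by (simp add: L_def)
      \<comment> \<open>The cycle closes in \<open>x\<close> itself. Composing the wins along the
        whole path gives a win of \<open>x\<close> against \<open>e\<close>; the closing edge passes
        it on to the step from \<open>e\<close> to \<open>m\<close>, and thence backwards along the
        path.\<close>
      have "successively (\<lambda>u v. (u, v) \<in> G \<and> wins1 u v) (rev L)"
        unfolding successively_rev by (rule successively_mono[OF suc]) (use edge_commute in auto)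
      then have "wins1 (hd (rev L)) (last (rev L))"
        using wins_path[of "rev L"] L by simp
      moreover have "last L = x" by (simp add: L_def)
      moreover have "hd L = e" using L by simp
      ultimately have "wins1 x e" by (simp add: hd_rev last_rev)
      then have "wins1 e m"
        using propagate[of x e m] edge_linked cycle em edge_commute zx by auto
      then have "successively wins1 L" using propagate_path[of e m rest] dist sucG unfolding L by blast
      then show ?thesis using final[of ps] by (simp add: L_def)
    qed
  next
    case leaf
    have "e \<in> leaves UNIV G" using leaf by (simp add: leaves_def)
    moreover have "card (seconds D e) > 1"
    proof -
      have "m \<in> seconds D e" using edge_linked[OF em(1)] by (simp add: linked_def)
      then have "card (seconds D e) \<noteq> 0" by auto
      moreover have "card (seconds D e) \<noteq> 1" using nu by (auto simp: unique_seconds_def)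
      ultimately show ?thesis by linarith
    qed
    ultimately obtain z where z: "z \<in> seconds D e" "z \<notin> neighbors G e" "e \<in> seconds D z"
      using ls unfolding leaf_symmetry_def by blast
    have ez: "linked e z" "(e, z) \<notin> G" using z by (auto simp: linked_def neighbors_def)
    have "wins1 e z"
      using propagate[of m e z] edge_linked em edge_commute ez by auto
    \<comment> \<open>The path from \<open>z\<close> back to \<open>e\<close> allows turning round:
      its first step continues the link from \<open>e\<close>, and its composed wins give a win of
      \<open>z\<close> against \<open>e\<close>, which the link passes on to
      \<open>m\<close>.\<close>
    obtain p where p: "is_path G z p e" using rtrancl_imp_path[OF G_rtrancl] by blast
    have "z \<noteq> e" using linked_neq ez by blast
    then obtain q where q: "p = z # q" "q \<noteq> []" "(z, hd q) \<in> G" "z \<notin> set q" "is_path G (hd q) q e"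
      by (cases rule: is_path_ConsE[OF p]) auto
    obtain u q' where u: "q = u # q'" using q(2) by (cases q) auto
    have "u \<noteq> e" using q(3) u ez edge_commute by auto
    then have "wins1 z u"
      using propagate[of e z u] ez linked_commute edge_linked q(3) u \<open>wins1 e z\<close> by auto
    moreover have dp: "distinct (z # u # q')" "successively (\<lambda>u v. (u, v) \<in> G) (z # u # q')"
      using p unfolding is_path_def q(1) u by auto
    ultimately have "successively wins1 (z # u # q')" using propagate_path by blast
    then have "successively (\<lambda>u v. (u, v) \<in> G \<and> wins1 u v) p"
      using dp(2) unfolding q(1) u by (intro successively_conj)
    then have "wins1 (hd p) (last p)" using wins_path[of p] q(1) u by simp
    then have "wins1 z e" using p by (simp add: is_path_def)
    then have "wins1 e m"
      using propagate[of z e m] linked_commute[OF ez(1)] edge_linked[OF em(1)] em(1) ez(2) by auto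
    then have "successively wins1 L" using propagate_path[of e m rest] dist sucG unfolding L by blast
    then show ?thesis using final[of ps] by (simp add: L_def)
  qed
qed

text \<open>Wins on single edges can be reversed, hence spread to all edges at a vertex and, by
  connectedness, to the whole graph; composition along paths covers all pairs of peaks.\<close>

lemma wins_everywhere:
  assumes "leaf_symmetry D" "\<not> unique_seconds D" and e: "(x, y) \<in> G" "wins1 x y"
    and R: "R \<in> D" and Q: "Q \<in> D"
  shows "h R Q = peak R"
proof -
  have reverse: "wins1 v u" if "(u, v) \<in> G" "wins1 u v" for u v
    using wins_back[OF assms(1,2), of "[]" v u] that edge_commute edge_neq by auto
  have star: "wins1 v w" if "(u, v) \<in> G" "wins1 u v" "(v, w) \<in> G" for u v w
    using propagate[of u v w] edge_linked reverse that by blast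
  have all: "wins1 v w" if "(v, w) \<in> G" for v w
  proof -
    have "(y, v) \<in> G\<^sup>*" by (rule G_rtrancl)
    then have "\<forall>w. (v, w) \<in> G \<longrightarrow> wins1 v w"
    proof induction
      case base
      then show ?case using star[OF e] by blast
    next
      case (step u v)
      then show ?case using star[of u v] by blast
    qed
    then show ?thesis using that by blast
  qed
  show ?thesis
  proof (cases "peak R = peak Q")
    case False
    obtain p where p: "is_path G (peak R) p (peak Q)" using rtrancl_imp_path[OF G_rtrancl] by blast
    then have "length p \<ge> 2" using False by (cases p; cases "tl p") (auto simp: is_path_def)
    moreover have "successively (\<lambda>u v. (u, v) \<in> G \<and> wins1 u v) p"
    proof (rule successively_mono)
      show "successively (\<lambda>u v. (u, v) \<in> G) p" using p by (simp add: is_path_def)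
    qed (use all in auto)
    ultimately have "wins1 (peak R) (peak Q)" using wins_path[of p] p by (simp add: is_path_def)
    then show ?thesis using R Q by (simp add: wins1_def)
  qed (use una[OF R Q] in simp)
qed

lemma swapped_rule: "two_voter_rule D (\<lambda>R Q. h Q R)"
proof
  show "h Q R = peak Q" if "R \<in> D" "Q \<in> D" "peak R = peak Q" for R Q
    using una[OF that(2,1)] that(3) by simp
  show "h Q R = h Q R' \<or> (h Q R, h Q R') \<in> R" if "R \<in> D" "R' \<in> D" "Q \<in> D" for R R' Q
    using s2 that by blast
  show "h Q R = h Q' R \<or> (h Q R, h Q' R) \<in> Q" if "R \<in> D" "Q \<in> D" "Q' \<in> D" for R Q Q'
    using s1 that by blast
qed

lemma dictated:
  assumes "leaf_symmetry D" "\<not> unique_seconds D"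
  shows "(\<forall>R\<in>D. \<forall>Q\<in>D. h R Q = peak R) \<or> (\<forall>R\<in>D. \<forall>Q\<in>D. h R Q = peak Q)"
proof -
  interpret sw: two_voter_rule D "\<lambda>R Q. h Q R" using swapped_rule .
  obtain x y where e: "(x, y) \<in> G" using ex_neighbor by blast
  have "wins1 x y \<or> wins2 x y" using linked_cases[OF edge_linked[OF e]] .
  then show ?thesis
  proof
    assume "wins1 x y"
    then show ?thesis using wins_everywhere[OF assms e] by blast
  next
    assume "wins2 x y"
    then have "sw.wins1 y x" unfolding wins2_def sw.wins1_def by blast
    then show ?thesis using sw.wins_everywhere[OF assms edge_commute[OF e]] by blast
  qed
qed

end

section \<open>From two to many voters\<close>

lemma profiles_upd: "P \<in> profiles n D \<Longrightarrow> i \<in> voters n \<Longrightarrow> R \<in> D \<Longrightarrow> P(i := R) \<in> profiles n D"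
  by (auto simp: PiE_iff extensional_def)

lemma profiles_app: "P \<in> profiles n D \<Longrightarrow> i \<in> voters n \<Longrightarrow> P i \<in> D"
  by (auto simp: PiE_iff)

lemma strategy_proofD:
  "strategy_proof n D f \<Longrightarrow> P \<in> profiles n D \<Longrightarrow> i \<in> voters n \<Longrightarrow> R \<in> D \<Longrightarrow>
    f P = f (P(i := R)) \<or> (f P, f (P(i := R))) \<in> P i"
  unfolding strategy_proof_def by blast

lemma rule_onD:
  "rule_on n D f \<Longrightarrow> P \<in> profiles n D \<Longrightarrow> (\<And>i. i \<in> voters n \<Longrightarrow> peak (P i) = a) \<Longrightarrow> f P = a"
  unfolding rule_on_def by blast

section \<open>Profiles of two voters\<close>

lemma voters_2: "i \<in> {Suc 0..2} \<longleftrightarrow> i = Suc 0 \<or> i = 2"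
  by auto

lemma profile2_simps [simp]:
  "profile2 R R' (Suc 0) = R" "profile2 R R' 2 = R'"
  "(profile2 R R')(Suc 0 := Q) = profile2 Q R'" "(profile2 R R')(2 := Q) = profile2 R Q"
  by (auto simp: profile2_def fun_eq_iff)

lemma profile2_in: "R \<in> D \<Longrightarrow> R' \<in> D \<Longrightarrow> profile2 R R' \<in> profiles 2 D"
  by (auto simp: profile2_def)

lemma profiles_2E:
  assumes "P \<in> profiles 2 D"
  obtains R R' where "R \<in> D" "R' \<in> D" "P = profile2 R R'"
proof -
  have "P = profile2 (P 1) (P 2)"
  proof
    fix i
    show "P i = profile2 (P 1) (P 2) i"
    proof (cases "i \<in> voters 2")
      case True
      then have "i = 1 \<or> i = 2" by auto
      then show ?thesis by auto
    next
      case False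
      then show ?thesis using PiE_arb[OF assms False] by (auto simp: profile2_def)
    qed
  qed
  moreover have "P 1 \<in> D" "P 2 \<in> D" using assms by (auto simp: PiE_iff)
  ultimately show ?thesis using that by blast
qed

lemma strategy_proof_2:
  "strategy_proof 2 D f \<longleftrightarrow> (\<forall>R\<in>D. \<forall>R'\<in>D. \<forall>Q\<in>D.
     (f (profile2 R R') = f (profile2 Q R') \<or> (f (profile2 R R'), f (profile2 Q R')) \<in> R) \<and>
     (f (profile2 R R') = f (profile2 R Q) \<or> (f (profile2 R R'), f (profile2 R Q)) \<in> R'))"
    (is "?L \<longleftrightarrow> ?R")
proof
  assume l: ?L
  show ?R
  proof (intro ballI)
    fix R R' Q assume "R \<in> D" "R' \<in> D" "Q \<in> D"
    then show "(f (profile2 R R') = f (profile2 Q R') \<or> (f (profile2 R R'), f (profile2 Q R')) \<in> R) \<and>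
     (f (profile2 R R') = f (profile2 R Q) \<or> (f (profile2 R R'), f (profile2 R Q)) \<in> R')"
      using strategy_proofD[OF l profile2_in, of R R' "Suc 0" Q]
        strategy_proofD[OF l profile2_in, of R R' 2 Q] by (simp add: voters_2 del: atLeastAtMost_iff)
  qed
next
  assume r: ?R
  show ?L unfolding strategy_proof_def
  proof (intro ballI)
    fix P i Q assume P: "P \<in> profiles 2 D" and i: "i \<in> voters 2" and Q: "Q \<in> D"
    obtain R R' where R: "R \<in> D" "R' \<in> D" "P = profile2 R R'" using profiles_2E[OF P] .
    have "i = Suc 0 \<or> i = 2" using i by auto
    then show "f P = f (P(i := Q)) \<or> (f P, f (P(i := Q))) \<in> P i"
      using r[rule_format, OF R(1,2) Q] R(3) by auto
  qed
qed

lemma rule_on_2: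
  "rule_on 2 D f \<longleftrightarrow> (\<forall>R\<in>D. \<forall>R'\<in>D. peak R = peak R' \<longrightarrow> f (profile2 R R') = peak R')"
proof
  assume l: "rule_on 2 D f"
  show "\<forall>R\<in>D. \<forall>R'\<in>D. peak R = peak R' \<longrightarrow> f (profile2 R R') = peak R'"
  proof (intro ballI impI)
    fix R R' assume "R \<in> D" "R' \<in> D" "peak R = peak R'"
    then show "f (profile2 R R') = peak R'"
      by (intro rule_onD[OF l profile2_in]) (auto simp: voters_2 simp del: atLeastAtMost_iff)
  qed
next
  assume r: "\<forall>R\<in>D. \<forall>R'\<in>D. peak R = peak R' \<longrightarrow> f (profile2 R R') = peak R'"
  show "rule_on 2 D f"
    unfolding rule_on_def
  proof (intro ballI allI impI)
    fix P a assume P: "P \<in> profiles 2 D" "\<forall>i\<in>voters 2. peak (P i) = a"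
    obtain R R' where "R \<in> D" "R' \<in> D" "P = profile2 R R'" using profiles_2E[OF P(1)] .
    then show "f P = a" using r P(2)[rule_format, of 1] P(2)[rule_format, of 2] by simp
  qed
qed

lemma tops_only_2:
  "tops_only 2 D f \<longleftrightarrow> (\<forall>R\<in>D. \<forall>R'\<in>D. \<forall>Q\<in>D. \<forall>Q'\<in>D. peak R = peak Q \<longrightarrow> peak R' = peak Q' \<longrightarrow>
     f (profile2 R R') = f (profile2 Q Q'))"
proof
  assume t: "tops_only 2 D f"
  show "\<forall>R\<in>D. \<forall>R'\<in>D. \<forall>Q\<in>D. \<forall>Q'\<in>D. peak R = peak Q \<longrightarrow> peak R' = peak Q' \<longrightarrow>
     f (profile2 R R') = f (profile2 Q Q')"
  proof (intro ballI impI)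
    fix R R' Q Q' assume "R \<in> D" "R' \<in> D" "Q \<in> D" "Q' \<in> D" "peak R = peak Q" "peak R' = peak Q'"
    then show "f (profile2 R R') = f (profile2 Q Q')"
      by (intro t[unfolded tops_only_def, rule_format, OF profile2_in profile2_in])
        (auto simp: voters_2 simp del: atLeastAtMost_iff)
  qed
next
  assume r: "\<forall>R\<in>D. \<forall>R'\<in>D. \<forall>Q\<in>D. \<forall>Q'\<in>D. peak R = peak Q \<longrightarrow> peak R' = peak Q' \<longrightarrow>
     f (profile2 R R') = f (profile2 Q Q')"
  show "tops_only 2 D f"
    unfolding tops_only_def
  proof (intro ballI impI)
    fix P P' assume P: "P \<in> profiles 2 D" "P' \<in> profiles 2 D" "\<forall>i\<in>voters 2. peak (P i) = peak (P' i)"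
    obtain R R' where 1: "R \<in> D" "R' \<in> D" "P = profile2 R R'" using profiles_2E[OF P(1)] .
    obtain Q Q' where 2: "Q \<in> D" "Q' \<in> D" "P' = profile2 Q Q'" using profiles_2E[OF P(2)] .
    show "f P = f P'"
      using r[rule_format, OF 1(1,2) 2(1,2)] P(3)[rule_format, of 1] P(3)[rule_format, of 2] 1(3) 2(3)
      by simp
  qed
qed

context path_connected_domain
begin

text \<open>Kalai and Muller's cloning argument: give the last two voters the same preference.\<close>

lemma clone_rule:
  assumes n: "n \<ge> 1" and f: "rule_on (Suc n) D f" "strategy_proof (Suc n) D f"
  defines "g \<equiv> \<lambda>P. f (P(Suc n := P n))"
  shows "rule_on n D g" "strategy_proof n D g"
proof -
  have ext: "P(Suc n := R) \<in> profiles (Suc n) D" if "P \<in> profiles n D" "R \<in> D" for P R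
    using that by (auto simp: PiE_iff extensional_def le_Suc_eq)
  have nin: "n \<in> voters n" "n \<in> voters (Suc n)" "Suc n \<in> voters (Suc n)" using n by auto
  show "rule_on n D g"
    unfolding rule_on_def
  proof (intro ballI allI impI)
    fix P a assume P: "P \<in> profiles n D" "\<forall>i\<in>voters n. peak (P i) = a"
    have "f (P(Suc n := P n)) = a"
    proof (rule rule_onD[OF f(1) ext[OF P(1) profiles_app[OF P(1) nin(1)]]])
      fix i assume "i \<in> voters (Suc n)"
      then show "peak ((P(Suc n := P n)) i) = a" using P(2) nin(1) by (auto simp: le_Suc_eq)
    qed
    then show "g P = a" by (simp add: g_def)
  qed
  show "strategy_proof n D g"
    unfolding strategy_proof_def
  proof (intro ballI)
    fix P i R assume P: "P \<in> profiles n D" and i: "i \<in> voters n" and R: "R \<in> D"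
    define P' where "P' = P(Suc n := P n)"
    have Pn: "P n \<in> D" using profiles_app[OF P nin(1)] .
    have P': "P' \<in> profiles (Suc n) D" using ext[OF P Pn] by (simp add: P'_def)
    have i': "i \<in> voters (Suc n)" using i by auto
    show "g P = g (P(i := R)) \<or> (g P, g (P(i := R))) \<in> P i"
    proof (cases "i = n")
      case False
      have "(P(i := R))(Suc n := (P(i := R)) n) = P'(i := R)"
        using i False by (auto simp: P'_def fun_eq_iff)
      then have "g (P(i := R)) = f (P'(i := R))" by (simp add: g_def)
      moreover have "P' i = P i" using i by (simp add: P'_def)
      ultimately show ?thesis using strategy_proofD[OF f(2) P' i' R] by (simp add: g_def P'_def)
    next
      case True
      define Q where "Q = P'(n := R)"
      have Q: "Q \<in> profiles (Suc n) D" unfolding Q_def using profiles_upd[OF P' nin(2) R] .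
      have "(P(i := R))(Suc n := (P(i := R)) n) = Q(Suc n := R)"
        by (auto simp: Q_def P'_def fun_eq_iff True)
      then have g: "g (P(i := R)) = f (Q(Suc n := R))" by (simp add: g_def)
      have "f P' = f Q \<or> (f P', f Q) \<in> P n"
        using strategy_proofD[OF f(2) P' nin(2) R] by (simp add: Q_def P'_def)
      moreover have "f Q = f (Q(Suc n := R)) \<or> (f Q, f (Q(Suc n := R))) \<in> P n"
        using strategy_proofD[OF f(2) Q nin(3) R] by (simp add: Q_def P'_def)
      moreover have "g P = f P'" by (simp add: g_def P'_def)
      ultimately show ?thesis using g True preferenceD(3)[OF pref[OF Pn]] by metis
    qed
  qed
qed

text \<open>Freezing the other voters yields a two-voter rule precisely when agreement of the last
  two is respected, which \<open>clone\<close> guarantees. Agreement in peaks alone is enough, as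
  voter \<open>Suc n\<close> could copy voter \<open>n\<close>.\<close>

lemma last_two_rule:
  assumes n: "n \<ge> 1" and f: "rule_on (Suc n) D f" "strategy_proof (Suc n) D f"
    and clone: "\<And>P. P \<in> profiles n D \<Longrightarrow> f (P(Suc n := P n)) = peak (P n)"
    and P: "P \<in> profiles (Suc n) D"
  shows "two_voter_rule D (\<lambda>R Q. f (P(n := R, Suc n := Q)))"
proof -
  have nin: "n \<in> voters n" "n \<in> voters (Suc n)" "Suc n \<in> voters (Suc n)" using n by auto
  have in2: "P(n := R, Suc n := Q) \<in> profiles (Suc n) D" if "R \<in> D" "Q \<in> D" for R Q
    using profiles_upd[OF profiles_upd[OF P nin(2) that(1)] nin(3) that(2)] .
  have b: "f (P(n := R, Suc n := Q)) = f (P(n := R, Suc n := Q')) \<or>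
      (f (P(n := R, Suc n := Q)), f (P(n := R, Suc n := Q'))) \<in> Q"
    if "R \<in> D" "Q \<in> D" "Q' \<in> D" for R Q Q'
    using strategy_proofD[OF f(2) in2[OF that(1,2)] nin(3) that(3)] by simp
  have a: "f (P(n := R, Suc n := Q)) = f (P(n := R', Suc n := Q)) \<or>
      (f (P(n := R, Suc n := Q)), f (P(n := R', Suc n := Q))) \<in> R"
    if "R \<in> D" "R' \<in> D" "Q \<in> D" for R R' Q
  proof -
    have "P(n := R, Suc n := Q, n := R') = P(n := R', Suc n := Q)" by (auto simp: fun_eq_iff)
    then show ?thesis using strategy_proofD[OF f(2) in2[OF that(1,3)] nin(2) that(2)] by simp
  qed
  have c: "f (P(n := R, Suc n := R)) = peak R" if R: "R \<in> D" for R
  proof -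
    define P0 where "P0 = restrict (P(n := R)) (voters n)"
    have "P0 \<in> profiles n D" using P R by (auto simp: P0_def PiE_iff)
    moreover have "P0(Suc n := P0 n) = P(n := R, Suc n := R)"
      using P n by (auto simp: P0_def fun_eq_iff restrict_def PiE_iff extensional_def le_Suc_eq)
    moreover have "P0 n = R" using nin by (simp add: P0_def)
    ultimately show ?thesis using clone[of P0] by simp
  qed
  show ?thesis
  proof
    show "f (P(n := R, Suc n := Q)) = peak Q" if "R \<in> D" "Q \<in> D" "peak R = peak Q" for R Q
      using b[of R Q R] c[OF that(1)] that peak_unbeaten[OF pref[OF that(2)]] by auto
    show "f (P(n := R, Suc n := Q)) = f (P(n := R', Suc n := Q)) \<or>
        (f (P(n := R, Suc n := Q)), f (P(n := R', Suc n := Q))) \<in> R"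
      if "R \<in> D" "R' \<in> D" "Q \<in> D" for R R' Q using a[OF that] .
    show "f (P(n := R, Suc n := Q)) = f (P(n := R, Suc n := Q')) \<or>
        (f (P(n := R, Suc n := Q)), f (P(n := R, Suc n := Q'))) \<in> Q"
      if "R \<in> D" "Q \<in> D" "Q' \<in> D" for R Q Q' using b[OF that] .
  qed
qed

lemma many_voters_dictated:
  assumes two: "\<And>h. two_voter_rule D h \<Longrightarrow>
      (\<forall>R\<in>D. \<forall>Q\<in>D. h R Q = peak R) \<or> (\<forall>R\<in>D. \<forall>Q\<in>D. h R Q = peak Q)"
    and "n \<ge> 2" "rule_on n D f" "strategy_proof n D f"
  shows "dictatorship n D f"
  using assms(2-4)
proof (induction n arbitrary: f rule: nat_induct_at_least)
  case base
  define h where "h R Q = f (profile2 R Q)" for R Q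
  have "two_voter_rule D h"
    by unfold_locales
      (use base[unfolded strategy_proof_2 rule_on_2] in \<open>auto simp: h_def\<close>)
  then consider "\<forall>R\<in>D. \<forall>Q\<in>D. h R Q = peak R" | "\<forall>R\<in>D. \<forall>Q\<in>D. h R Q = peak Q" using two by blast
  then show ?case
  proof cases
    case 1
    then have "f P = peak (P 1)" if "P \<in> profiles 2 D" for P
      using profiles_2E[OF that] by (metis h_def profile2_simps(1) One_nat_def)
    moreover have "1 \<in> voters 2" by simp
    ultimately show ?thesis unfolding dictatorship_def by blast
  next
    case 2
    then have "f P = peak (P 2)" if "P \<in> profiles 2 D" for P
      using profiles_2E[OF that] by (metis h_def profile2_simps(2))
    moreover have "2 \<in> voters 2" by simp
    ultimately show ?thesis unfolding dictatorship_def by blast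
  qed
next
  case (Suc n)
  define g where "g P = f (P(Suc n := P n))" for P
  have n: "n \<ge> 1" using Suc.hyps by simp
  have nin: "n \<in> voters n" "n \<in> voters (Suc n)" "Suc n \<in> voters (Suc n)" using n by auto
  note f = Suc.prems
  have g_eq: "g = (\<lambda>P. f (P(Suc n := P n)))" by (simp add: g_def fun_eq_iff)
  have "rule_on n D g" "strategy_proof n D g"
    using clone_rule[OF n f] unfolding g_eq by blast+
  then have "dictatorship n D g" by (rule Suc.IH)
  then obtain i where i: "i \<in> voters n" "\<And>P. P \<in> profiles n D \<Longrightarrow> g P = peak (P i)"
    unfolding dictatorship_def by auto
  have eq: "f P = peak (P i)" if P: "P \<in> profiles (Suc n) D" "P (Suc n) = P n" for P
  proof -
    define P0 where "P0 = restrict P (voters n)"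
    have "P0 \<in> profiles n D" using P by (auto simp: P0_def PiE_iff)
    moreover have "P0(Suc n := P0 n) = P"
      using P n by (auto simp: P0_def fun_eq_iff restrict_def PiE_iff extensional_def le_Suc_eq)
    moreover have "P0 i = P i" using i by (simp add: P0_def)
    ultimately show ?thesis using i(2)[of P0] by (simp add: g_def)
  qed
  show ?case
  proof (cases "i = n")
    case False
    have "f P = peak (P i)" if P: "P \<in> profiles (Suc n) D" for P
    proof -
      define R where "R = P n"
      define R' where "R' = P (Suc n)"
      have R: "R \<in> D" "R' \<in> D" using profiles_app[OF P] nin by (auto simp: R_def R'_def)
      have i': "i \<noteq> n" "i \<noteq> Suc n" using i False by auto
      define P1 where "P1 = P(Suc n := R)"
      define P2 where "P2 = P(n := R')"
      have 1: "P1 \<in> profiles (Suc n) D" "P2 \<in> profiles (Suc n) D"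
        using profiles_upd[OF P] nin R unfolding P1_def P2_def by blast+
      have v: "f P1 = peak (P i)" "f P2 = peak (P i)"
        using eq[OF 1(1)] eq[OF 1(2)] i' by (auto simp: R_def R'_def P1_def P2_def)
      have upd: "P1(Suc n := R') = P" "P1 (Suc n) = R" "P(n := R') = P2" "P n = R"
        by (auto simp: R_def R'_def P1_def P2_def)
      \<comment> \<open>Voter \<open>Suc n\<close> at \<open>P1\<close> and voter \<open>n\<close>
        at \<open>P\<close> both hold \<open>R\<close> and can deviate to \<open>R'\<close>, leading
        to \<open>P\<close> and \<open>P2\<close>. The dictator's peak is thus weakly above and
        weakly below \<open>f P\<close> in \<open>R\<close>.\<close>
      have "peak (P i) = f P \<or> (peak (P i), f P) \<in> R"
        using strategy_proofD[OF f(2) 1(1) nin(3) R(2), unfolded upd] v by simp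
      moreover have "f P = peak (P i) \<or> (f P, peak (P i)) \<in> R"
        using strategy_proofD[OF f(2) P nin(2) R(2), unfolded upd] v by simp
      ultimately show ?thesis using preferenceD(4)[OF pref[OF R(1)]] by metis
    qed
    moreover have "i \<in> voters (Suc n)" using i by auto
    ultimately show ?thesis unfolding dictatorship_def by blast
  next
    case True
    define first where "first P \<longleftrightarrow> (\<forall>R\<in>D. \<forall>Q\<in>D. f (P(n := R, Suc n := Q)) = peak R)" for P
    define second where "second P \<longleftrightarrow> (\<forall>R\<in>D. \<forall>Q\<in>D. f (P(n := R, Suc n := Q)) = peak Q)" for P
    have cl: "f (P(Suc n := P n)) = peak (P n)" if "P \<in> profiles n D" for P
      using i(2)[OF that] unfolding g_def True .
    have either: "first P \<or> second P" if "P \<in> profiles (Suc n) D" for P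
      unfolding first_def second_def
      using two[OF last_two_rule[OF n f cl that]] .
    \<comment> \<open>If changing voter \<open>j\<close> exchanged the dictators, let one of the
      last two have the peak of \<open>P j\<close> and the other a different peak \<open>b\<close>,
      arranged so that truth yields \<open>b\<close>; then \<open>j\<close> gains by
      deviating.\<close>
    have conflict: False
      if "first P \<and> second (P(j := R0)) \<or> second P \<and> first (P(j := R0))"
        and P: "P \<in> profiles (Suc n) D" and j: "j \<in> voters n" "j \<noteq> n" and R0: "R0 \<in> D" for P j R0
    proof -
      obtain b where b: "b \<noteq> peak (P j)" using second_neq[OF profiles_app[OF P, of j]] j by auto
      obtain A where A: "A \<in> D" "peak A = peak (P j)" using ex_pref by blast
      obtain B where B: "B \<in> D" "peak B = b" using ex_pref by blast
      have j': "j \<in> voters (Suc n)" "j \<noteq> Suc n" using j by auto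
      have sp: "f (P(n := R, Suc n := Q)) = f ((P(j := R0))(n := R, Suc n := Q)) \<or>
          (f (P(n := R, Suc n := Q)), f ((P(j := R0))(n := R, Suc n := Q))) \<in> P j"
        if "R \<in> D" "Q \<in> D" for R Q
      proof -
        define W where "W = P(n := R, Suc n := Q)"
        have W: "W \<in> profiles (Suc n) D"
          using profiles_upd[OF profiles_upd[OF P nin(2) that(1)] nin(3) that(2)] by (simp add: W_def)
        have upd: "W(j := R0) = (P(j := R0))(n := R, Suc n := Q)" "W j = P j"
          using j j' by (auto simp: W_def fun_eq_iff)
        show ?thesis
          using strategy_proofD[OF f(2) W j'(1) R0, unfolded upd] unfolding W_def .
      qed
      have "(b, peak (P j)) \<in> P j"
        using that(1) sp[OF A(1) B(1)] sp[OF B(1) A(1)] A B b unfolding first_def second_def by auto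
      then show False using peak_unbeaten[OF pref[OF profiles_app[OF P j'(1)]]] by blast
    qed
    have same: "first P \<Longrightarrow> first Q" if P: "P \<in> profiles (Suc n) D" and Q: "Q \<in> profiles (Suc n) D" for P Q
    proof -
      assume fP: "first P"
      \<comment> \<open>Interpolates between the profiles by replacing one voter at a time; the last
        two voters are overwritten anyway.\<close>
      define mix where "mix k = (\<lambda>j. if j \<le> k then Q j else P j)" for k
      have mixin: "mix k \<in> profiles (Suc n) D" for k
        using P Q by (auto simp: mix_def PiE_iff extensional_def)
      have mix_Suc: "mix (Suc k) = (mix k)(Suc k := Q (Suc k))" for k
        by (auto simp: mix_def fun_eq_iff le_Suc_eq)
      have "first (mix k)" if "k < n" for k
        using that
      proof (induction k)
        case 0
        have "P 0 = Q 0" using P Q by (auto simp: PiE_iff extensional_def)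
        then have "mix 0 = P" by (auto simp: mix_def fun_eq_iff)
        then show ?case using fP by simp
      next
        case (Suc k)
        have j: "Suc k \<in> voters n" "Suc k \<noteq> n" "Suc k \<in> voters (Suc n)" using Suc.prems by auto
        have "\<not> second (mix (Suc k))"
          unfolding mix_Suc
          using conflict[OF _ mixin j(1,2) profiles_app[OF Q j(3)], of k] Suc by auto
        then show ?case using either[OF mixin] by blast
      qed
      then have "first (mix (n - 1))" using n by simp
      moreover have "(mix (n - 1))(n := R, Suc n := S) = Q(n := R, Suc n := S)" for R S
        using P Q n by (auto simp: mix_def fun_eq_iff PiE_iff extensional_def)
      ultimately show "first Q" by (simp add: first_def)
    qed
    have self: "P(n := P n, Suc n := P (Suc n)) = P" for P :: "'a profile" by simp
    show ?thesis
    proof (cases "\<exists>P\<in>profiles (Suc n) D. first P")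
      case True
      then have "first P" if "P \<in> profiles (Suc n) D" for P using same that by blast
      then have "f P = peak (P n)" if "P \<in> profiles (Suc n) D" for P
        using that profiles_app[OF that] nin self[of P] unfolding first_def by metis
      then show ?thesis unfolding dictatorship_def using nin by blast
    next
      case False
      then have "second P" if "P \<in> profiles (Suc n) D" for P using either that by blast
      then have "f P = peak (P (Suc n))" if "P \<in> profiles (Suc n) D" for P
        using that profiles_app[OF that] nin self[of P] unfolding second_def by metis
      then show ?thesis unfolding dictatorship_def using nin by blast
    qed
  qed
qed

lemma unique_seconds_necessary:
  assumes "leaf_symmetry D" "non_dictatorial D"
  shows "unique_seconds D"
proof (rule ccontr)
  assume n: "\<not> ?thesis"
  have "dictatorship n D f" if "n \<ge> 2" "rule_on n D f" "strategy_proof n D f" for n f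
    by (rule many_voters_dictated[OF _ that]) (rule two_voter_rule.dictated[OF _ assms(1) n])
  then show False using assms(2) unfolding non_dictatorial_def by blast
qed

end

section \<open>Minimal zones\<close>

context path_connected_domain
begin

lemma zoneD:
  assumes "zone C a C' b M"
  shows "hung C a" "hung C' b" "a \<noteq> b" "a \<notin> C'" "b \<notin> C" "C \<inter> C' = {}" "M = -(C \<union> C')" "a \<in> M" "b \<in> M"
  using assms hungD(1) unfolding zone_def by blast+

lemma zoneI:
  "hung C a \<Longrightarrow> hung C' b \<Longrightarrow> a \<noteq> b \<Longrightarrow> a \<notin> C' \<Longrightarrow> b \<notin> C \<Longrightarrow> C \<inter> C' = {} \<Longrightarrow> zone C a C' b (-(C \<union> C'))"
  by (simp add: zone_def)

lemma zoneI_single: "hung C a \<Longrightarrow> b \<notin> C \<Longrightarrow> b \<noteq> a \<Longrightarrow> zone C a {} b (-C)"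
  using hung_empty by (auto simp: zone_def)

lemma zone_tree:
  assumes "zone C a C' b M"
  shows "\<exists>T. tree UNIV T \<and> dual_thresholds T a b \<and> D \<subseteq> sh_prefs T a b \<and> path_set T a b = M"
  using sh_of_zone[OF assms] by (elim exE conjE, intro exI conjI)

definition minimal_zone :: "'a set \<Rightarrow> bool" where
  "minimal_zone M \<longleftrightarrow> (\<exists>C a C' b. zone C a C' b M) \<and> (\<forall>C a C' b M'. zone C a C' b M' \<longrightarrow> \<not> M' \<subset> M)"

lemma minimal_zoneD: "minimal_zone M \<Longrightarrow> zone C a C' b M' \<Longrightarrow> M' \<subset> M \<Longrightarrow> False"
  unfolding minimal_zone_def by blast

text \<open>Every zone is realized by some tree, so minimality among trees is minimality among
  zones.\<close>

lemma sh_domain_on_minimal_zone: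
  assumes "sh_domain_on D T a b"
  shows "zone (beyond T a b - {a}) a (beyond T b a - {b}) b (path_set T a b)" "minimal_zone (path_set T a b)"
proof -
  have 1: "tree UNIV T" "dual_thresholds T a b" "D \<subseteq> sh_prefs T a b"
    and 2: "\<not> (\<exists>T' a' b'. tree UNIV T' \<and> dual_thresholds T' a' b' \<and> D \<subseteq> sh_prefs T' a' b' \<and>
          path_set T' a' b' \<subset> path_set T a b)"
    using assms unfolding sh_domain_on_def by blast+
  show z: "zone (beyond T a b - {a}) a (beyond T b a - {b}) b (path_set T a b)" using zone_of_sh[OF 1] .
  have "\<not> M' \<subset> path_set T a b" if z': "zone C p C' q M'" for C p C' q M'
  proof -
    obtain T' where "tree UNIV T'" "dual_thresholds T' p q" "D \<subseteq> sh_prefs T' p q" "path_set T' p q = M'"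
      using zone_tree[OF z'] by blast
    then show ?thesis using 2 by blast
  qed
  then show "minimal_zone (path_set T a b)" using z unfolding minimal_zone_def by blast
qed

lemma ex_minimal_zone: "\<exists>M. minimal_zone M"
proof -
  obtain a b where "(a, b) \<in> G" using ex_neighbor by blast
  then have "zone {} a {} b (-({} \<union> {}))" by (intro zoneI hung_empty) (auto dest: edge_neq)
  then have "\<exists>C a C' b. zone C a C' b UNIV" by auto
  then obtain M where M: "\<exists>C a C' b. zone C a C' b M"
    "\<And>M'. \<exists>C a C' b. zone C a C' b M' \<Longrightarrow> card M \<le> card M'"
    using ex_has_least_nat[of "\<lambda>M. \<exists>C a C' b. zone C a C' b M" _ card] by blast
  have "\<not> M' \<subset> M" if "zone C a C' b M'" for C a C' b M'
    using M(2)[of M'] that psubset_card_mono[of M M'] by fastforce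
  then show ?thesis using M(1) unfolding minimal_zone_def by blast
qed

lemma ssp_hung:
  assumes T: "tree UNIV G" and ssp: "\<And>R. R \<in> D \<Longrightarrow> semi_single_peaked G x R"
  shows "hung (-{x}) x"
proof -
  have "hangs_in S (-{x}) x R" if "R \<in> D" for R
    using ssp[OF that] ssp_iff_hangs_in[OF T pref[OF that]] by blast
  moreover have "S z u v \<or> S z v u" if "(u, v) \<in> G" for u v z
    using tree_edge_sep[OF T that] by simp
  ultimately show ?thesis unfolding hung_def by auto
qed

text \<open>A minimal zone always exists; without a center, the leaf condition of semi-hybridness
  holds at every vertex.\<close>

lemma sh_domain_of_no_center:
  assumes "\<And>x. \<not> hung (-{x}) x"
  shows "sh_domain D"
proof -
  obtain M where M: "minimal_zone M" using ex_minimal_zone by blast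
  then obtain C a C' b where "zone C a C' b M" unfolding minimal_zone_def by blast
  then obtain T where T: "tree UNIV T" "dual_thresholds T a b" "D \<subseteq> sh_prefs T a b" "path_set T a b = M"
    using zone_tree by blast
  have "\<not> path_set T' a' b' \<subset> M" if "tree UNIV T'" "dual_thresholds T' a' b'" "D \<subseteq> sh_prefs T' a' b'" for T' a' b'
    using minimal_zoneD[OF M zone_of_sh[OF that]] by blast
  moreover have "\<exists>R\<in>D. \<not> semi_single_peaked G x R" if "tree UNIV G" for x
    using ssp_hung[OF that] assms by blast
  ultimately have "sh_domain_on D T a b"
    using T conn unfolding sh_domain_on_def path_connected_dom_def by blast
  then show ?thesis unfolding sh_domain_def by blast
qed

text \<open>Otherwise no walk from \<open>a\<close> could leave \<open>insert a C\<close>, and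
  \<open>b\<close> would be unreachable.\<close>

lemma zone_end_neighbor:
  assumes "zone C a C' b M"
  shows "\<exists>y\<in>M. (a, y) \<in> G"
proof (rule ccontr)
  assume n: "\<not> ?thesis"
  note z = zoneD[OF assms]
  have a: "y \<in> C" if "(a, y) \<in> G" for y
  proof (rule ccontr)
    assume "y \<notin> C"
    moreover have "y \<notin> M" using n that by blast
    ultimately have "y \<in> C'" using z(7) by blast
    then have "a \<in> insert b C'" using hung_edge[OF z(2) edge_commute[OF that]] by blast
    then show False using z by blast
  qed
  have "(a, b) \<in> G\<^sup>*" by (rule G_rtrancl)
  then have "b \<in> insert a C"
  proof induction
    case (step y w)
    then show ?case using a hung_edge[OF z(1)] by blast
  qed simp
  then show False using z by blast
qed

lemma zone_neighbor:
  assumes z: "zone C a C' b M" and x: "x \<in> M"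
  shows "\<exists>y\<in>M. (x, y) \<in> G"
proof -
  consider "x = a" | "x = b" | "x \<noteq> a" "x \<noteq> b" by blast
  then show ?thesis
  proof cases
    case 3
    obtain y where y: "(x, y) \<in> G" using ex_neighbor by blast
    note zz = zoneD[OF z]
    have "y \<notin> C" using hung_edge[OF zz(1) edge_commute[OF y]] 3 x zz(7) by blast
    moreover have "y \<notin> C'" using hung_edge[OF zz(2) edge_commute[OF y]] 3 x zz(7) by blast
    ultimately show ?thesis using y zz(7) by blast
  qed (use zone_end_neighbor[OF z] zone_end_neighbor[OF zone_commute[OF z]] in auto)
qed

text \<open>If a domain were semi-single-peaked with respect to a vertex \<open>x\<close> of a zone that has two
  neighbours in the zone, branches at \<open>x\<close> could be hung on \<open>x\<close>, shrinking the zone.\<close>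

lemma center_shrinks_zone:
  assumes z: "zone C a C' b M" and min: "minimal_zone M" and h: "hung (-{x}) x" and x: "x \<in> M" "x \<noteq> b"
    and y: "y \<in> M" "y' \<in> M" "y \<noteq> y'" "(x, y) \<in> G" "(x, y') \<in> G"
  shows False
proof -
  note zz = zoneD[OF z]
  have xC: "x \<notin> C" "x \<notin> C'" using x zz(7) by auto
  have "S y' x y \<or> S y' y x" using hungD(3)[OF h y(4), of y'] by auto
  moreover have "\<not> S y' y x" using edge_sep[OF edge_commute[OF y(5)], of y] y(3) edge_neq[OF y(4)] by blast
  ultimately have "S y x y'" using commute by blast
  then have "S y x b \<or> S b x y'" using split by blast
  \<comment> \<open>One of the two neighbours is on the far side of \<open>x\<close> as seen from
    \<open>b\<close>, and will leave the zone or serve as a new end.\<close>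
  then obtain y0 where y0: "y0 \<in> M" "y0 \<noteq> x" "S y0 x b"
    using y edge_neq commute by blast
  have sub: "hung H x" if "x \<notin> H" "\<And>v w. v \<in> H \<Longrightarrow> w \<notin> H \<Longrightarrow> S v x w" for H
    by (rule hung_subset[OF h]) (use that in auto)
  show False
  proof (cases "S a x b")
    case True
    \<comment> \<open>Everything cut off from \<open>b\<close> by \<open>x\<close> is hung on
      \<open>x\<close>, including \<open>C\<close> and \<open>y0\<close>; the end \<open>a\<close>
      is replaced by \<open>x\<close>.\<close>
    define H where "H = {v. v \<noteq> x \<and> S v x b}"
    have H: "hung H x"
    proof (rule sub)
      show "S v x w" if "v \<in> H" "w \<notin> H" for v w
        using that split[of v x b w] right[of v x] commute[of w x b] unfolding H_def
        by (cases "w = x") auto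
    qed (simp add: H_def)
    have "b \<notin> H" using refl_eq[of b x] x(2) by (auto simp: H_def)
    moreover have "H \<inter> C' = {}"
    proof -
      have False if "v \<in> H" "v \<in> C'" for v
      proof -
        have "S v b x" using hungD(2)[OF zz(2) that(2) xC(2)] .
        then show False using antisym[of v x b] that(1) x(2) by (simp add: H_def)
      qed
      then show ?thesis by blast
    qed
    ultimately have "zone H x C' b (-(H \<union> C'))" using zoneI[OF H zz(2) x(2) xC(2)] by blast
    moreover have "C \<subseteq> H"
    proof
      fix v assume v: "v \<in> C"
      have "S a x v \<or> S v x b" using split[OF True] .
      moreover have "S v x b" if "S a x v"
      proof -
        have "x = a" using antisym[OF hungD(2)[OF zz(1) v xC(1)] commute[OF that]] by simp
        then show ?thesis using hungD(2)[OF zz(1) v zz(5)] by simp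
      qed
      ultimately show "v \<in> H" using v xC by (auto simp: H_def)
    qed
    then have "-(H \<union> C') \<subset> M" using zz(7) y0 by (auto simp: H_def)
    ultimately show False using minimal_zoneD[OF min] by blast
  next
    case False
    \<comment> \<open>Now \<open>a\<close> and \<open>b\<close> are on the same side of
      \<open>x\<close>. That side, with both old parts, is hung on \<open>x\<close>, and
      \<open>y0\<close> becomes the other end.\<close>
    define H where "H = {v. \<not> S v x b}"
    have H: "hung H x"
    proof (rule sub)
      show "S v x w" if "v \<in> H" "w \<notin> H" for v w
        using that split[of w x b v] commute[of w x v] unfolding H_def by auto
    qed (simp add: H_def)
    have "y0 \<notin> H" using y0 by (simp add: H_def)
    then have "zone H x {} y0 (-H)" using zoneI_single[OF H] y0(2) by blast
    moreover have "C \<subseteq> H"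
    proof
      fix v assume v: "v \<in> C"
      have "\<not> S v x b"
      proof
        assume "S v x b"
        then have "S v x a" using split[of v x b a] False by blast
        then have "x = a" using antisym[OF _ hungD(2)[OF zz(1) v xC(1)]] by blast
        then show False using False by simp
      qed
      then show "v \<in> H" by (simp add: H_def)
    qed
    moreover have "C' \<subseteq> H"
    proof
      fix v assume v: "v \<in> C'"
      have "\<not> S v x b" using antisym[OF _ hungD(2)[OF zz(2) v xC(2)]] x(2) by blast
      then show "v \<in> H" by (simp add: H_def)
    qed
    moreover have "a \<in> H" using False by (simp add: H_def)
    ultimately have "zone H x {} y0 (-H)" "-H \<subset> M" using zz(7,8) by auto
    then show False using minimal_zoneD[OF min] by blast
  qed
qed

text \<open>A center inside a hung part can be moved to its root, so some center lies in the free
  zone. The leaf condition gives it two neighbours there, against minimality.\<close>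

lemma sh_domain_no_center:
  assumes sh: "sh_domain D"
  shows "\<not> hung (-{x0}) x0"
proof
  assume h0: "hung (-{x0}) x0"
  obtain T a b where on: "sh_domain_on D T a b" using sh unfolding sh_domain_def by blast
  define M where "M = path_set T a b"
  obtain C C' where z: "zone C a C' b M" and min: "minimal_zone M"
    using sh_domain_on_minimal_zone[OF on] M_def by blast
  note zz = zoneD[OF z]
  have treeG: "tree UNIV G" using hung_tree[OF h0] .
  have noleaf: "x \<notin> leaves M (Restr G M)" if "hung (-{x}) x" for x
    using on hung_ssp[OF that] treeG unfolding sh_domain_on_def M_def by blast
  obtain x where x: "hung (-{x}) x" "x \<in> M"
  proof -
    consider "x0 \<in> M" | "x0 \<in> C" | "x0 \<in> C'" using zz(7) by blast
    then show ?thesis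
    proof cases
      case 1
      then show ?thesis using that h0 by blast
    next
      case 2
      then have "C \<union> -{x0} = UNIV" by blast
      then show ?thesis using that hung_cover[OF zz(1) h0] zz(8) by blast
    next
      case 3
      then have "C' \<union> -{x0} = UNIV" by blast
      then show ?thesis using that hung_cover[OF zz(2) h0] zz(9) by blast
    qed
  qed
  obtain y where y: "y \<in> M" "(x, y) \<in> G" using zone_neighbor[OF z x(2)] by blast
  have "card (neighbors (Restr G M) x) \<noteq> 1" using noleaf[OF x(1)] x(2) by (simp add: leaves_def)
  then have "neighbors (Restr G M) x \<noteq> {y}" by auto
  moreover have "y \<in> neighbors (Restr G M) x" using y x by (simp add: neighbors_def)
  ultimately obtain y' where "y' \<in> neighbors (Restr G M) x" "y' \<noteq> y" by blast
  then have y': "y' \<in> M" "(x, y') \<in> G" "y \<noteq> y'" by (auto simp: neighbors_def)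
  show False
  proof (cases "x = b")
    case False
    then show False using center_shrinks_zone[OF z min x False y(1) y'(1,3) y(2) y'(2)] by blast
  next
    case True
    then have "x \<noteq> a" using zz(3) by blast
    then show False
      using center_shrinks_zone[OF zone_commute[OF z] min x _ y(1) y'(1,3) y(2) y'(2)] by blast
  qed
qed

text \<open>If \<open>a\<close> were in \<open>C\<close>, the two parts would interlock and cover
  the graph, creating a center.\<close>

lemma hung_rest:
  assumes c: "hung C p" and k: "hung K a" and z: "z \<in> C" "z \<notin> K" and ne: "\<not> K \<subseteq> C"
    and nc: "\<And>x. \<not> hung (-{x}) x"
  shows "a \<notin> C" "p \<notin> K" "hung (K - C) a"
proof -
  have pC: "p \<notin> C" and aK: "a \<notin> K" using hungD(1) c k by auto
  show a: "a \<notin> C"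
  proof
    assume a: "a \<in> C"
    then have ap: "a \<noteq> p" using pC by blast
    have "p \<in> K"
    proof (rule ccontr)
      assume n: "p \<notin> K"
      obtain y where y: "y \<in> K" "y \<notin> C" using ne by blast
      have "S p a y" using hungD(2)[OF k y(1) n] commute by blast
      moreover have "S y p a" using hungD(2)[OF c a y(2)] commute by blast
      moreover have "S y a p" using hungD(2)[OF k y(1) n] .
      ultimately show False using antisym[of y p a] ap by blast
    qed
    have "C \<union> K = UNIV"
    proof (rule ccontr)
      assume "C \<union> K \<noteq> UNIV"
      then obtain y where y: "y \<notin> C" "y \<notin> K" by blast
      have "S y p a" using hungD(2)[OF c a y(1)] commute by blast
      moreover have "S y a p" using hungD(2)[OF k \<open>p \<in> K\<close> y(2)] commute by blast
      ultimately show False using antisym[of y p a] ap by blast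
    qed
    then show False using hung_cover[OF c k] nc by blast
  qed
  have zpa: "S z p a" using hungD(2)[OF c z(1) a] .
  show p: "p \<notin> K"
  proof
    assume p: "p \<in> K"
    then have "S z a p" using hungD(2)[OF k p z(2)] commute by blast
    then have "p = a" using antisym[OF zpa] by blast
    then show False using p aK by blast
  qed
  show "hung (K - C) a"
  proof (rule hung_subset[OF k])
    show "S x a y" if x: "x \<in> K - C" and y: "y \<notin> K - C" for x y
    proof (cases "y \<in> K")
      case False
      then show ?thesis using hungD(2)[OF k] x by blast
    next
      case True
      then have yC: "y \<in> C" using y by blast
      have "S y p a" using hungD(2)[OF c yC a] .
      moreover have "S y a p" using hungD(2)[OF k True p] .
      ultimately have "p = a" using antisym by blast
      then have "S y a x" using hungD(2)[OF c yC] x by blast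
      then show ?thesis by (rule commute)
    qed
  qed blast
qed

text \<open>Parts with a common root merge into one, and the absence of a center leaves a vertex for
  the other end.\<close>

lemma zone_of_two_hung:
  assumes c: "hung C p" and k: "hung K a" and disj: "K \<inter> C = {}" "a \<notin> C" "p \<notin> K"
    and nc: "\<And>x. \<not> hung (-{x}) x"
  shows "\<exists>C1 a1 C2 a2. zone C1 a1 C2 a2 (-(C \<union> K))"
proof (cases "a = p")
  case False
  have "zone C p K a (-(C \<union> K))" using zoneI[OF c k] False disj by blast
  then show ?thesis by blast
next
  case True
  have u: "hung (C \<union> K) p" using hung_Un[OF c _] k True disj(1) by blast
  have "\<exists>b. b \<notin> C \<union> K \<and> b \<noteq> p"
  proof (rule ccontr)
    assume "\<not> ?thesis"
    then have "C \<union> K = -{p}" using hungD(1)[OF u] by blast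
    then show False using u nc by simp
  qed
  then obtain b where b: "b \<notin> C \<union> K" "b \<noteq> p" by blast
  then have "zone (C \<union> K) p {} b (-(C \<union> K))" using zoneI_single[OF u] by blast
  then show ?thesis by blast
qed

text \<open>A vertex \<open>v\<close> of the zone inside \<open>C\<close> could be removed by
  hanging all of \<open>C\<close> together with the rests of \<open>C1\<close> and \<open>C2\<close>
  outside it. Two such rests cannot both be nonempty, because each must contain
  \<open>peak Rhi\<close>.\<close>

lemma minimal_zone_avoids:
  assumes z: "zone C1 a1 C2 a2 M" and min: "minimal_zone M" and nc: "\<And>x. \<not> hung (-{x}) x"
    and R: "Rlo \<in> D" "Rhi \<in> D" "completely_reversed Rlo Rhi"
    and c: "hung C p" and s: "C \<noteq> {} \<Longrightarrow> peak Rlo \<in> C"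
  shows "M \<inter> C = {}"
proof (rule ccontr)
  assume "M \<inter> C \<noteq> {}"
  then obtain v where v: "v \<in> M" "v \<in> C" by blast
  note zz = zoneD[OF z]
  have v': "v \<notin> C1" "v \<notin> C2" using v(1) zz(7) by auto
  have no: False if "zone A a B b N" "N \<subseteq> M" "v \<notin> N" for A a B b N
    using minimal_zoneD[OF min that(1)] that v(1) by blast
  have conf: False if k: "hung K a" "K - C \<noteq> {}" "v \<notin> K" and rest: "C1 \<union> C2 \<subseteq> C \<union> (K - C)" for K a
  proof -
    have ne: "\<not> K \<subseteq> C" using k(2) by blast
    have "\<exists>A a' B b. zone A a' B b (-(C \<union> (K - C)))"
      by (rule zone_of_two_hung[OF c hung_rest(3)[OF c k(1) v(2) k(3) ne nc] _ _ _ nc])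
        (use hung_rest(1,2)[OF c k(1) v(2) k(3) ne nc] in auto)
    then show False using no rest v(2) zz(7) by blast
  qed
  have t: "peak Rhi \<in> K" if "hung K a" "K \<inter> C = {}" "K \<noteq> {}" for K a
    using hung_nonempty[OF that(1,3) R] s that(2) v(2) by blast
  have one: "C1 \<subseteq> C \<or> C2 \<subseteq> C"
  proof (rule ccontr)
    assume n: "\<not> ?thesis"
    then have "peak Rhi \<in> C1 - C" "peak Rhi \<in> C2 - C"
      using t[OF hung_rest(3)[OF c zz(1) v(2) v'(1) _ nc]] t[OF hung_rest(3)[OF c zz(2) v(2) v'(2) _ nc]]
      by blast+
    then show False using zz(6) by blast
  qed
  show False
  proof (cases "C1 \<subseteq> C \<and> C2 \<subseteq> C")
    case True
    have "\<exists>q. q \<notin> C \<and> q \<noteq> p"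
    proof (rule ccontr)
      assume "\<not> ?thesis"
      then have "C = -{p}" using hungD(1)[OF c] by blast
      then show False using c nc by simp
    qed
    then obtain q where "q \<notin> C" "q \<noteq> p" by blast
    then have "zone C p {} q (-C)" using zoneI_single[OF c] by blast
    then show False using no True v zz(7) by blast
  next
    case False
    then show False using one conf[OF zz(1) _ v'(1)] conf[OF zz(2) _ v'(2)] by blast
  qed
qed

end

section \<open>The rule is hybrid unless the domain is semi-single-peaked\<close>

lemma path_set_commute: "tree UNIV T \<Longrightarrow> path_set T x y = path_set T y x"
  by (auto simp: tree_path_set sep_commute[OF tree_sym])

context reversed_rule
begin

lemma rule_hybrid:
  assumes p: "F s t = p" and q: "F t s = q" and pq: "p \<noteq> q" "S s p q" and nc: "\<And>x. \<not> hung (-{x}) x"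
  shows "\<exists>T. tree UNIV T \<and> dual_thresholds T p q \<and> card (path_set T p q) \<ge> 3 \<and>
    (\<forall>x y. (x \<in> path_set T p q \<longrightarrow> F x y = x) \<and>
      (x \<in> beyond T p q - {p} \<longrightarrow> F x y = proj T (path_set T x y) p) \<and>
      (x \<in> beyond T q p - {q} \<longrightarrow> F x y = proj T (path_set T x y) q)) \<and>
    (\<forall>T' a b. sh_domain_on D T' a b \<longrightarrow> path_set T' a b \<subseteq> path_set T p q)"
proof -
  obtain C C' M where z: "zone C p C' q M" and M: "\<forall>z\<in>M. \<forall>y. F z y = z"
    and C: "\<forall>x\<in>insert p C. \<forall>y. S x (F x y) y \<and> S x (F x y) p \<and> S y (F x y) p"
    and C': "\<forall>x\<in>insert q C'. \<forall>y. S x (F x y) y \<and> S x (F x y) q \<and> S y (F x y) q"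
    and st: "C \<noteq> {} \<longrightarrow> s \<in> C" "C' \<noteq> {} \<longrightarrow> t \<in> C'"
    using rule_zone[OF p q pq] by blast
  note zz = zoneD[OF z]
  obtain T where T_all: "tree UNIV T \<and> dual_thresholds T p q \<and> D \<subseteq> sh_prefs T p q \<and> path_set T p q = M \<and>
    beyond T p q = insert p C \<and> beyond T q p = insert q C' \<and>
    (\<forall>x y m. x \<in> insert p C \<longrightarrow> S x m y \<longrightarrow> S x m p \<longrightarrow> S y m p \<longrightarrow> proj T (path_set T x y) p = m) \<and>
    (\<forall>x y m. x \<in> insert q C' \<longrightarrow> S x m y \<longrightarrow> S x m q \<longrightarrow> S y m q \<longrightarrow> proj T (path_set T x y) q = m)"
    using sh_of_zone[OF z] ..
  then have T: "tree UNIV T" "dual_thresholds T p q" "path_set T p q = M"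
    "beyond T p q = insert p C" "beyond T q p = insert q C'"
    and projC: "\<And>x y m. x \<in> insert p C \<Longrightarrow> S x m y \<Longrightarrow> S x m p \<Longrightarrow> S y m p \<Longrightarrow> proj T (path_set T x y) p = m"
    and projC': "\<And>x y m. x \<in> insert q C' \<Longrightarrow> S x m y \<Longrightarrow> S x m q \<Longrightarrow> S y m q \<Longrightarrow> proj T (path_set T x y) q = m"
    by blast+
  have "card M \<ge> 3"
  proof (rule ccontr)
    assume "\<not> card M \<ge> 3"
    moreover have "card {p, q} = 2" "{p, q} \<subseteq> M" using zz by auto
    ultimately have "{p, q} = M" by (intro card_seteq) auto
    then have "insert p (insert q (C \<union> C')) = UNIV" using zz(7) by blast
    then show False using hung_two[OF zz(1-6)] nc by blast
  qed
  moreover have "path_set T' a b \<subseteq> M" if on: "sh_domain_on D T' a b" for T' a b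
  proof -
    note mz = sh_domain_on_minimal_zone[OF on]
    have rev': "completely_reversed Rhi Rlo" using reversed_rule.rev[OF swapped_ends] .
    have "path_set T' a b \<inter> C = {}"
      by (rule minimal_zone_avoids[OF mz nc Rlo Rhi rev zz(1)]) (use st(1) in auto)
    moreover have "path_set T' a b \<inter> C' = {}"
      by (rule minimal_zone_avoids[OF mz nc Rhi Rlo rev' zz(2)]) (use st(2) in auto)
    ultimately show ?thesis using zz(7) by blast
  qed
  moreover have "F x y = proj T (path_set T x y) p" if "x \<in> insert p C" for x y
    using projC[OF that, of "F x y" y] C[rule_format, OF that, of y] by simp
  moreover have "F x y = proj T (path_set T x y) q" if "x \<in> insert q C'" for x y
    using projC'[OF that, of "F x y" y] C'[rule_format, OF that, of y] by simp
  ultimately show ?thesis using T M by (intro exI[of _ T]) auto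
qed

end

section \<open>The classification\<close>

lemma proj_peak_span_2:
  assumes T: "tree UNIV T" and P: "P = profile2 R R'"
  shows "proj T (peak_span T 2 P) x = proj T (path_set T (peak R) (peak R')) x"
  using P by (simp add: peak_span_2[OF T])

lemma projection_rule_inv:
  assumes f: "projection_rule 2 D f" "strategy_proof 2 D f" and R: "Rlo \<in> D" "Rhi \<in> D"
  shows "inv_to_sp_rule D Rlo Rhi f"
proof -
  obtain T x where T: "tree UNIV T" and fP: "\<And>P. P \<in> profiles 2 D \<Longrightarrow> f P = proj T (peak_span T 2 P) x"
    using f(1) unfolding projection_rule_def by blast
  have f2: "f (profile2 R R') = proj T (path_set T (peak R) (peak R')) x" if "R \<in> D" "R' \<in> D" for R R'
    using fP[OF profile2_in[OF that]] proj_peak_span_2[OF T] by simp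
  have "proj T (path_set T a a) x = a" for a
    using proj_path_set[OF T, of a a a x] by simp
  then have "rule_on 2 D f" unfolding rule_on_2 using f2 by simp
  moreover have "invariant Rlo Rhi f"
    unfolding invariant_def using f2 R path_set_commute[OF T] by metis
  moreover have "tops_only 2 D f" unfolding tops_only_2 using f2 by simp
  ultimately show ?thesis using f(2) unfolding inv_to_sp_rule_def by blast
qed

text \<open>The rule is the median of the peaks and the threshold. The median lies on the voter's
  way to the threshold and also on the way to any outcome reachable by misreporting, so
  semi-single-peakedness ranks it higher.\<close>

lemma ssp_domain_projection_rule:
  fixes D :: "'a::finite pref set"
  assumes "ssp_domain D" "is_domain D"
  shows "\<exists>f. projection_rule 2 D f \<and> strategy_proof 2 D f"
proof -
  obtain T x where T: "tree UNIV T" and D: "D \<subseteq> ssp_prefs T x"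
    using assms unfolding ssp_domain_def by blast
  interpret separation "sep T" using tree_separation[OF T] .
  define F where "F y z = proj T (path_set T y z) x" for y z
  define f where "f P = proj T (peak_span T 2 P) x" for P :: "'a profile"
  have f: "f (profile2 R R') = F (peak R) (peak R')" for R R'
    unfolding f_def F_def using proj_peak_span_2[OF T] by blast
  have F: "sep T y (F y z) z" "sep T y (F y z) x" "sep T z (F y z) x" for y z
    unfolding F_def using proj_path_setD[OF T] by blast+
  have Fc: "F y z = F z y" for y z unfolding F_def using path_set_commute[OF T] by metis
  have sp: "F (peak R) z = F y z \<or> (F (peak R) z, F y z) \<in> R" if R: "R \<in> D" for R y z
  proof -
    have pR: "preference R" "semi_single_peaked T x R" using D R by (auto simp: ssp_prefs_def)
    define m where "m = F (peak R) z"
    define m' where "m' = F y z"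
    have m: "sep T (peak R) m z" "sep T (peak R) m x" "sep T z m x" using F by (auto simp: m_def)
    have m': "sep T z m' x" using F by (auto simp: m'_def)
    have "sep T (peak R) m m'"
    proof (rule ccontr)
      assume n: "\<not> ?thesis"
      then have 1: "sep T m' m z" "sep T m' m x" using split m by blast+
      have "sep T z m' m \<or> sep T m m' x" using split[OF m'] .
      then have "m = m'"
        using antisym[of z m m'] antisym[of x m m'] commute[OF 1(1)] commute[OF 1(2)] commute[of m m' x] by blast
      then show False using n by simp
    qed
    then show ?thesis
      using pR(2)[unfolded ssp_iff[OF T pR(1)]] m(2) unfolding m_def[symmetric] m'_def[symmetric] by blast
  qed
  have "strategy_proof 2 D f"
    unfolding strategy_proof_2
  proof (intro ballI conjI)
    fix R R' Q assume "R \<in> D" "R' \<in> D" "Q \<in> D"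
    then show "f (profile2 R R') = f (profile2 Q R') \<or> (f (profile2 R R'), f (profile2 Q R')) \<in> R"
      using sp[of R "peak R'" "peak Q"] by (simp add: f)
    show "f (profile2 R R') = f (profile2 R Q) \<or> (f (profile2 R R'), f (profile2 R Q)) \<in> R'"
      using sp[of R' "peak R" "peak Q"] \<open>R' \<in> D\<close> Fc[of "peak R"] by (simp add: f)
  qed
  moreover have "projection_rule 2 D f" unfolding projection_rule_def f_def using T by blast
  ultimately show ?thesis by blast
qed

lemma (in path_connected_domain) tops_rule_representation:
  assumes f: "rule_on 2 D f" "tops_only 2 D f" "strategy_proof 2 D f"
    and R: "Rlo \<in> D" "Rhi \<in> D" "completely_reversed Rlo Rhi"
  shows "\<exists>F. reversed_rule D F Rlo Rhi \<and> (\<forall>R\<in>D. \<forall>R'\<in>D. f (profile2 R R') = F (peak R) (peak R'))"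
proof -
  define r where "r x = (SOME R. R \<in> D \<and> peak R = x)" for x
  have r: "r x \<in> D \<and> peak (r x) = x" for x
    unfolding r_def by (rule someI_ex) (use ex_pref in blast)
  define F where "F x y = f (profile2 (r x) (r y))" for x y
  have F: "f (profile2 R R') = F (peak R) (peak R')" if "R \<in> D" "R' \<in> D" for R R'
    using f(2)[unfolded tops_only_2, rule_format, of R R' "r (peak R)" "r (peak R')"] that r
    by (simp add: F_def)
  have "reversed_rule D F Rlo Rhi"
  proof unfold_locales
    show "F x x = x" for x
      using f(1)[unfolded rule_on_2, rule_format, of "r x" "r x"] r by (simp add: F_def)
    show "F (peak R) y = F x' y \<or> (F (peak R) y, F x' y) \<in> R" if "R \<in> D" for R y x'
      using f(3)[unfolded strategy_proof_2, rule_format, of R "r y" "r x'"] F r that by simp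
    show "F x (peak R) = F x y' \<or> (F x (peak R), F x y') \<in> R" if "R \<in> D" for R x y'
      using f(3)[unfolded strategy_proof_2, rule_format, of "r x" R "r y'"] F r that by simp
  qed (use R in auto)
  then show ?thesis using F by blast
qed

theorem theorem1:
  fixes D :: "'a::finite pref set" and Rlo Rhi :: "'a pref"
  assumes "CARD('a) \<ge> 3"
    and "is_domain D"
    and "non_dictatorial D"
    and "unidimensional D"
    and "Rlo \<in> D" "Rhi \<in> D" "completely_reversed Rlo Rhi"
  shows
    "(((\<exists>f. inv_to_sp_rule D Rlo Rhi f) \<longleftrightarrow> ssp_domain D) \<and>
      ((\<exists>f. inv_to_sp_rule D Rlo Rhi f) \<longleftrightarrow>
         (\<exists>f. projection_rule 2 D f \<and> strategy_proof 2 D f)) \<and>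
      (\<forall>f. inv_to_sp_rule D Rlo Rhi f \<longrightarrow> projection_rule 2 D f)) \<and>
     (((\<nexists>f. inv_to_sp_rule D Rlo Rhi f) \<longleftrightarrow> sh_domain D \<and> unique_seconds D) \<and>
      ((\<nexists>f. inv_to_sp_rule D Rlo Rhi f) \<longrightarrow>
         (\<forall>f. rule_on 2 D f \<and> tops_only 2 D f \<and> strategy_proof 2 D f \<longrightarrow>
            hybrid_rule 2 D f \<and>
            (\<forall>T a b. sh_domain_on D T a b \<longrightarrow>
               (\<exists>B. path_set T a b \<subseteq> B \<and> dictatorship_like_on 2 D f B)))))"
proof -
  have uni: "path_connected_dom D" "leaf_symmetry D" using assms(4) by (auto simp: unidimensional_def)
  interpret path_connected_domain D by unfold_locales (use assms uni in auto)
  let ?E = "\<exists>f. inv_to_sp_rule D Rlo Rhi f"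
  have E_hung: "projection_rule 2 D f \<and> (\<exists>x. hung (-{x}) x)" if f: "inv_to_sp_rule D Rlo Rhi f" for f
  proof -
    have f': "rule_on 2 D f" "tops_only 2 D f" "strategy_proof 2 D f" "invariant Rlo Rhi f"
      using f unfolding inv_to_sp_rule_def by auto
    obtain F where F: "reversed_rule D F Rlo Rhi"
      "\<forall>R\<in>D. \<forall>R'\<in>D. f (profile2 R R') = F (peak R) (peak R')"
      using tops_rule_representation[OF f'(1-3) assms(5-7)] by blast
    interpret reversed_rule D F Rlo Rhi using F(1) .
    define c where "c = F s t"
    have c: "F s t = c" "F t s = c"
      using f'(4) F(2) assms(5,6) by (auto simp: invariant_def c_def)
    have h: "hung (-{c}) c" using invariant_hung[OF c] .
    have T: "tree UNIV G" using hung_tree[OF h] .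
    have "f P = proj G (peak_span G 2 P) c" if P: "P \<in> profiles 2 D" for P
    proof -
      obtain R R' where R: "R \<in> D" "R' \<in> D" "P = profile2 R R'" using profiles_2E[OF P] .
      then show ?thesis using F(2)[rule_format, OF R(1,2)] invariant_median[OF c] proj_peak_span_2[OF T R(3)] by simp
    qed
    then show ?thesis using T h unfolding projection_rule_def by blast
  qed
  have hung_ssp: "ssp_domain D" if "hung (-{x}) x" for x using hung_ssp_domain[OF that] .
  have ssp_proj: "\<exists>f. projection_rule 2 D f \<and> strategy_proof 2 D f" if "ssp_domain D"
    using ssp_domain_projection_rule[OF that assms(2)] .
  have proj_E: "?E" if "projection_rule 2 D f" "strategy_proof 2 D f" for f
    using projection_rule_inv[OF that assms(5,6)] by blast
  have nc: "\<not> hung (-{x}) x" if "\<not> ?E" for x using that hung_ssp ssp_proj proj_E by blast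
  have us: "unique_seconds D" using unique_seconds_necessary[OF uni(2) assms(3)] .
  have neg: "\<not> ?E \<longleftrightarrow> sh_domain D"
    using sh_domain_of_no_center nc sh_domain_no_center E_hung by blast
  have hyb: "hybrid_rule 2 D f \<and>
      (\<forall>T a b. sh_domain_on D T a b \<longrightarrow> (\<exists>B. path_set T a b \<subseteq> B \<and> dictatorship_like_on 2 D f B))"
    if nE: "\<not> ?E" and f: "rule_on 2 D f" "tops_only 2 D f" "strategy_proof 2 D f" for f
  proof -
    obtain F where F: "reversed_rule D F Rlo Rhi"
      "\<forall>R\<in>D. \<forall>R'\<in>D. f (profile2 R R') = F (peak R) (peak R')"
      using tops_rule_representation[OF f assms(5-7)] by blast
    interpret reversed_rule D F Rlo Rhi using F(1) .
    interpret sw: reversed_rule D "\<lambda>x y. F y x" Rlo Rhi using swapped_voters .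
    \<comment> \<open>Stated for either order of the voters, \<open>i\<close> being the one who
      dictates on the zone.\<close>
    have main: ?thesis
      if i: "i \<in> voters 2" "j \<in> voters 2"
        and T: "tree UNIV T" "dual_thresholds T p q" "card (path_set T p q) \<ge> 3"
        and H: "\<And>x y. (x \<in> path_set T p q \<longrightarrow> H x y = x) \<and>
          (x \<in> beyond T p q - {p} \<longrightarrow> H x y = proj T (path_set T x y) p) \<and>
          (x \<in> beyond T q p - {q} \<longrightarrow> H x y = proj T (path_set T x y) q)"
        and sub: "\<And>T' a b. sh_domain_on D T' a b \<Longrightarrow> path_set T' a b \<subseteq> path_set T p q"
        and fH: "\<And>P. P \<in> profiles 2 D \<Longrightarrow> f P = H (peak (P i)) (peak (P j))"
        and span: "\<And>P. peak_span T 2 P = path_set T (peak (P i)) (peak (P j))"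
      for i j T p q H
    proof -
      have "hybrid_rule 2 D f"
        unfolding hybrid_rule_def
        by (intro exI[of _ T] exI[of _ p] exI[of _ q] conjI bexI[of _ i] ballI T i(1))
          (use H fH span in auto)
      moreover have "dictatorship_like_on 2 D f (path_set T p q)"
        unfolding dictatorship_like_on_def
      proof
        show "path_set T p q \<noteq> {}" using T(3) by auto
        show "\<exists>i\<in>voters 2. \<forall>P\<in>profiles 2 D.
            (\<forall>j\<in>voters 2. peak (P j) \<in> path_set T p q) \<longrightarrow> f P = peak (P i)"
          using i(1) fH H by (intro bexI[of _ i]) auto
      qed
      ultimately show ?thesis using sub by blast
    qed
    define p where "p = F s t"
    define q where "q = F t s"
    have pq: "p \<noteq> q"
    proof
      assume "p = q"
      then have "invariant Rlo Rhi f" using F(2) assms(5,6) by (simp add: invariant_def p_def q_def)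
      then show False using nE f unfolding inv_to_sp_rule_def by blast
    qed
    have "S s p t" "S s q t" using between[of s t] between[of t s] commute by (auto simp: p_def q_def)
    \<comment> \<open>Both outcomes lie between \<open>s\<close> and \<open>t\<close>. The order in
      which they come from \<open>s\<close> decides which voter dictates on the zone; the second
      case is the first with the voters exchanged.\<close>
    then consider "S s p q" | "S s q p" using chain by blast
    then show ?thesis
    proof cases
      case 1
      obtain T where T: "tree UNIV T" "dual_thresholds T p q" "card (path_set T p q) \<ge> 3"
        "\<forall>x y. (x \<in> path_set T p q \<longrightarrow> F x y = x) \<and>
          (x \<in> beyond T p q - {p} \<longrightarrow> F x y = proj T (path_set T x y) p) \<and>
          (x \<in> beyond T q p - {q} \<longrightarrow> F x y = proj T (path_set T x y) q)"
        "\<forall>T' a b. sh_domain_on D T' a b \<longrightarrow> path_set T' a b \<subseteq> path_set T p q"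
        using rule_hybrid[OF p_def[symmetric] q_def[symmetric] pq 1 nc[OF nE]] by blast
      show ?thesis
      proof (rule main[of 1 2 T p q F])
        show "f P = F (peak (P 1)) (peak (P 2))" if P: "P \<in> profiles 2 D" for P
        proof -
          obtain R R' where R: "R \<in> D" "R' \<in> D" "P = profile2 R R'" using profiles_2E[OF P] .
          then show ?thesis using F(2)[rule_format, OF R(1,2)] by simp
        qed
        show "peak_span T 2 P = path_set T (peak (P 1)) (peak (P 2))" for P
          using peak_span_2[OF T(1)] .
      qed (use T in auto)
    next
      case 2
      obtain T where T: "tree UNIV T" "dual_thresholds T q p" "card (path_set T q p) \<ge> 3"
        "\<forall>x y. (x \<in> path_set T q p \<longrightarrow> F y x = x) \<and>
          (x \<in> beyond T q p - {q} \<longrightarrow> F y x = proj T (path_set T x y) q) \<and>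
          (x \<in> beyond T p q - {p} \<longrightarrow> F y x = proj T (path_set T x y) p)"
        "\<forall>T' a b. sh_domain_on D T' a b \<longrightarrow> path_set T' a b \<subseteq> path_set T q p"
        using sw.rule_hybrid[OF q_def[symmetric] p_def[symmetric] pq[symmetric] 2 nc[OF nE]] by blast
      show ?thesis
      proof (rule main[of 2 1 T q p "\<lambda>x y. F y x"])
        show "f P = F (peak (P 1)) (peak (P 2))" if P: "P \<in> profiles 2 D" for P
        proof -
          obtain R R' where R: "R \<in> D" "R' \<in> D" "P = profile2 R R'" using profiles_2E[OF P] .
          then show ?thesis using F(2)[rule_format, OF R(1,2)] by simp
        qed
        show "peak_span T 2 P = path_set T (peak (P 2)) (peak (P 1))" for P
          using peak_span_2[OF T(1)] path_set_commute[OF T(1)] by metis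
      qed (use T in auto)
    qed
  qed
  have 1: "?E \<longleftrightarrow> ssp_domain D" using E_hung hung_ssp ssp_proj proj_E by blast
  have 2: "?E \<longleftrightarrow> (\<exists>f. projection_rule 2 D f \<and> strategy_proof 2 D f)"
    using 1 ssp_proj proj_E by blast
  have 3: "\<not> ?E \<longleftrightarrow> sh_domain D \<and> unique_seconds D" using neg us by blast
  show ?thesis
    by (intro conjI 1 2 3 allI impI) (use E_hung hyb in auto)
qed

end
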